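(* There exists a universal constant $C>0$ such that the following holds. Let $n\ge 1$ and let $\mathbf{x}=(\mathbf{x}_{ij})_{1\le i,j\le n}$ be a deterministic real $n\times n$ matrix with $\sum_{i,j=1}^n \mathbf{x}_{ij}=0$ and $\sum_{i,j=1}^n \mathbf{x}_{ij}^2=n^2$, and let $K=\max_{1\le i,j\le n}|\mathbf{x}_{ij}|$. Let $\pi$ be a uniform random permutation of $[n]\times[n]$ and let $X=(X_{ij})_{1\le i,j\le n}$ be the random matrix $X_{ij}=\mathbf{x}_{\pi(i,j)}$. Then for every $z\in\mathbb{C}$ and every $\varepsilon\in(0,1)$, $$\mathbb{P}\Big(s_n(X-\sqrt n\,z\,\mathrm{Id})\le\frac{1}{K+|z|}\,\varepsilon n^{-1/2}\Big)\le CK^2(K+|z|)\log(1+K+|z|)\,\varepsilon+C\,\frac{K^4(K+|z|)\log^{3/2}(1+K+|z|)}{n^{1/2}}.$$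
   Context: $[n]=\{1,\dots,n\}$. For an $n\times n$ complex matrix $A$, $s_n(A)$ denotes its smallest singular value, i.e. the smallest eigenvalue of $\sqrt{AA^*}$. $\mathrm{Id}$ is the $n\times n$ identity matrix. "Universal constant" means that $C$ depends on no parameter of the problem. The conditions on $\mathbf{x}$ force $K\ge1$ (and cannot be met for $n=1$, so the statement concerns $n\ge2$). *)

theory Defs
  imports "HOL-Probability.Probability"
    "HOL-Combinatorics.Permutations"
    "Jordan_Normal_Form.Schur_Decomposition"
    "Jordan_Normal_Form.Char_Poly"
begin

text \<open>HOL-Analysis and Jordan_Normal_Form both declare names such as \<open>mat\<close>; matrices here are always
  those of Jordan_Normal_Form, so the dimension is a natural number and the index sets are
  \<open>{0..<n}\<close> instead of \<open>{1..n}\<close>.\<close>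

definition pos_semidef :: "complex mat \<Rightarrow> bool" where
  "pos_semidef A \<longleftrightarrow> square_mat A \<and> mat_adjoint A = A \<and>
     (\<forall>v \<in> carrier_vec (dim_row A). 0 \<le> Re ((A *\<^sub>v v) \<bullet>c v))"

text \<open>Every positive semidefinite matrix has exactly one positive semidefinite square root, so the
  description below is proper whenever \<open>pos_semidef A\<close>, in particular for \<open>A = B B\<^sup>*\<close>.\<close>

definition psd_sqrt :: "complex mat \<Rightarrow> complex mat" where
  "psd_sqrt A = (THE P. P \<in> carrier_mat (dim_row A) (dim_row A) \<and> pos_semidef P \<and> P * P = A)"

text \<open>All eigenvalues of a positive semidefinite matrix are real, so restricting to real
  eigenvalues loses none. The set is finite, and nonempty if the dimension is positive.\<close>

definition smallest_singular_value :: "complex mat \<Rightarrow> real" where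
  "smallest_singular_value A =
     Min {s :: real. eigenvalue (psd_sqrt (A * mat_adjoint A)) (complex_of_real s)}"

definition uniform_index_perm :: "nat \<Rightarrow> (nat \<times> nat \<Rightarrow> nat \<times> nat) pmf" where
  "uniform_index_perm n = pmf_of_set {p. p permutes ({0..<n} \<times> {0..<n})}"

definition permute_entries :: "(nat \<times> nat \<Rightarrow> nat \<times> nat) \<Rightarrow> 'a mat \<Rightarrow> 'a mat" where
  "permute_entries p x = Matrix.mat (dim_row x) (dim_col x) (\<lambda>(i, j). x $$ p (i, j))"

end

theory Submission
  imports Defs "Jordan_Normal_Form.Spectral_Radius"
begin

text \<open>The proof follows the scheme of Rudelson and Vershynin. Put \<open>M = K + |z|\<close> and call a unit vector nearly
  constant if, up to an error of order \<open>1/M\<close>, it is a constant vector plus one with few nonzero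
  coordinates. All randomness is exploited through transpositions of entries: revealing a quarter of the
  entries leaves, on an event of overwhelming probability, a remainder of variance of order one, so that
  swapping unrevealed entries produces symmetric random signs with large coefficients.

  Swapping whole lines shows that a fixed vector is mapped to a short one with probability
  \<open>exp (- c n / K\<^sup>2)\<close>, and a union bound over a lattice net extends this to all nearly constant vectors.
  The operator norm needed for the net is estimated by negative association of the entries.
  If a singular vector is not nearly constant, many of its coordinates are of order at least \<open>1/(M \<surd>n)\<close>,
  and then each corresponding row has small inner product with the unit normal of the other rows. That
  normal is itself not nearly constant, so it has disjoint pairs of bounded coordinates whose
  differences carry a fixed share of its \<open>L\<^sup>2\<close> norm; permuting the row and
  swapping along these pairs turns the characteristic function into a product of cosines, and Esseen's
  inequality gives the small ball bound. Averaging over the rows finishes the argument.\<close>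

section \<open>Averages over permutations\<close>

text \<open>Entries are drawn without replacement, so no row is independent of the others and
  conditioning distorts the law. Rearranging slots on which an event does not depend keeps the law
  uniform; this replaces independence throughout. Excluding sparse vectors alone would not be
  enough: permuting a row leaves its inner product with a constant vector unchanged, so constants
  yield no small ball bound either.

  The two terms of the bound come from one balance. Write \<open>L = ln (1 + M)\<close>. A vector
  with \<open>m\<close> free coordinates, resolved to order 1/M, has entropy of order m L, which has
  to stay below the exponent of order n / K^2; hence \<open>m\<close> is of order n / (K^2 L).
  Averaging over rows then costs n / m, of order K^2 L. The small ball bound at radius r is of order
  (r + K / sqrt m) M, where r is of order \<epsilon>: the first summand gives K^2 M L \<epsilon>,
  the second K^4 M L^(3/2) / sqrt n.\<close>

text \<open>A finite sum instead of an integral against the pmf: swaps, exchanges of averages and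
  integrals over a frequency become finite manipulations. Values in a normed field cover complex
  characteristic functions as well.\<close>

definition perm_avg :: "'a set \<Rightarrow> (('a \<Rightarrow> 'a) \<Rightarrow> 'b::real_normed_field) \<Rightarrow> 'b" where
  "perm_avg E f = (\<Sum>p | p permutes E. f p) / of_nat (card {p. p permutes E})"

lemma card_permutes_pos: "finite E \<Longrightarrow> 0 < card {p. p permutes E}"
  by (metis card_gt_0_iff empty_iff finite_permutations mem_Collect_eq permutes_id)

lemma perm_avg_cong:
  "(\<And>p. p permutes E \<Longrightarrow> f p = g p) \<Longrightarrow> perm_avg E f = perm_avg E g"
  unfolding perm_avg_def by (intro arg_cong2[where f = "(/)"] sum.cong) auto

lemma perm_avg_mono:
  fixes f g :: "('a \<Rightarrow> 'a) \<Rightarrow> real"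
  shows "(\<And>p. p permutes E \<Longrightarrow> f p \<le> g p) \<Longrightarrow> perm_avg E f \<le> perm_avg E g"
  unfolding perm_avg_def by (intro divide_right_mono sum_mono) auto

lemma perm_avg_nonneg:
  fixes f :: "('a \<Rightarrow> 'a) \<Rightarrow> real"
  shows "(\<And>p. p permutes E \<Longrightarrow> 0 \<le> f p) \<Longrightarrow> 0 \<le> perm_avg E f"
  unfolding perm_avg_def by (intro divide_nonneg_nonneg sum_nonneg) auto

lemma perm_avg_const: "finite E \<Longrightarrow> perm_avg E (\<lambda>p. c) = c"
  unfolding perm_avg_def using card_permutes_pos[of E] by simp

lemma perm_avg_le_const:
  fixes f :: "('a \<Rightarrow> 'a) \<Rightarrow> real"
  shows "finite E \<Longrightarrow> (\<And>p. p permutes E \<Longrightarrow> f p \<le> c) \<Longrightarrow> perm_avg E f \<le> c"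
  using perm_avg_mono[of E f "\<lambda>_. c"] by (simp add: perm_avg_const)

lemma perm_avg_add: "perm_avg E (\<lambda>p. f p + g p) = perm_avg E f + perm_avg E g"
  unfolding perm_avg_def by (simp add: sum.distrib add_divide_distrib)

lemma perm_avg_diff: "perm_avg E (\<lambda>p. f p - g p) = perm_avg E f - perm_avg E g"
  unfolding perm_avg_def by (simp add: sum_subtractf diff_divide_distrib)

lemma perm_avg_cmult: "perm_avg E (\<lambda>p. c * f p) = c * perm_avg E f"
  unfolding perm_avg_def by (simp add: sum_distrib_left)

lemma perm_avg_multc: "perm_avg E (\<lambda>p. f p * c) = perm_avg E f * c"
  unfolding perm_avg_def by (simp add: sum_distrib_right)

lemma perm_avg_sum: "perm_avg E (\<lambda>p. \<Sum>i\<in>I. f i p) = (\<Sum>i\<in>I. perm_avg E (f i))"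
  unfolding perm_avg_def by (subst sum.swap) (simp add: sum_divide_distrib)

lemma norm_perm_avg_le:
  "norm (perm_avg E f) \<le> perm_avg E (\<lambda>p. norm (f p))"
  unfolding perm_avg_def by (simp add: norm_divide divide_right_mono norm_sum)

lemma Re_perm_avg: "Re (perm_avg E f) = perm_avg E (\<lambda>p. Re (f p))"
  unfolding perm_avg_def by (simp del: Re_divide_of_nat add: Re_divide_of_nat)

text \<open>Composition on the right rearranges slots and keeps the law uniform. Each source of
  randomness used later is an instance: swaps of two slots, of two lines, and rearrangements of a
  row.\<close>

lemma perm_avg_compose:
  assumes "q permutes E"
  shows "perm_avg E (\<lambda>p. f (p \<circ> q)) = perm_avg E f"
  unfolding perm_avg_def using sum_permutations_compose_right[OF assms, of f] by simp

lemma perm_avg_swap: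
  "a \<in> E \<Longrightarrow> b \<in> E \<Longrightarrow> perm_avg E (\<lambda>p. f (p \<circ> Transposition.transpose a b)) = perm_avg E f"
  by (rule perm_avg_compose[OF permutes_swap_id])

lemma perm_avg_swap_antisym:
  fixes f :: "('a \<Rightarrow> 'a) \<Rightarrow> real"
  assumes "a \<in> E" "b \<in> E" "\<And>p. p permutes E \<Longrightarrow> f (p \<circ> Transposition.transpose a b) = - f p"
  shows "perm_avg E f = 0"
proof -
  have "perm_avg E f = perm_avg E (\<lambda>p. f (p \<circ> Transposition.transpose a b))"
    using perm_avg_swap[OF assms(1,2), of f] by simp
  also have "\<dots> = perm_avg E (\<lambda>p. (-1) * f p)"
    by (rule perm_avg_cong) (simp add: assms(3))
  also have "\<dots> = (-1) * perm_avg E f" by (rule perm_avg_cmult)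
  finally show ?thesis by simp
qed

lemma perm_avg_swap_sym:
  fixes f :: "('a \<Rightarrow> 'a) \<Rightarrow> 'b::real_normed_field"
  assumes "a \<in> E" "b \<in> E"
  shows "perm_avg E f = perm_avg E (\<lambda>p. (f p + f (p \<circ> Transposition.transpose a b)) / 2)"
proof -
  have "perm_avg E (\<lambda>p. (1/2) * (f p + f (p \<circ> Transposition.transpose a b)))
      = (1/2) * (perm_avg E f + perm_avg E f)"
    by (simp only: perm_avg_cmult perm_avg_add perm_avg_swap[OF assms])
  also have "\<dots> = perm_avg E f" by (simp add: mult_2[symmetric])
  finally show ?thesis by simp
qed

text \<open>Negative association. Evaluating one factor at an already used slot can only increase the average, as
  one sees by symmetrizing over the swap of the two slots.\<close>

lemma perm_avg_prod_le:
  fixes g :: "'a \<Rightarrow> 'a \<Rightarrow> real"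
  assumes fin: "finite E" and "T \<subseteq> E"
    and nonneg: "\<And>e a. e \<in> T \<Longrightarrow> a \<in> E \<Longrightarrow> 0 \<le> g e a"
    and mon: "\<And>e e' a b. e \<in> T \<Longrightarrow> e' \<in> T \<Longrightarrow> a \<in> E \<Longrightarrow> b \<in> E \<Longrightarrow>
      0 \<le> (g e a - g e b) * (g e' a - g e' b)"
  shows "perm_avg E (\<lambda>p. \<Prod>e\<in>T. g e (p e)) \<le> (\<Prod>e\<in>T. (\<Sum>a\<in>E. g e a) / card E)"
proof -
  have "finite T" using assms(1,2) by (rule finite_subset[rotated])
  then show ?thesis using assms(2-4)
  proof (induction T rule: finite_induct)
    case empty
    then show ?case by (simp add: perm_avg_const[OF fin])
  next
    case (insert t T)
    define \<Phi> where "\<Phi> p = (\<Prod>e\<in>T. g e (p e))" for p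
    have t: "t \<in> E" and T: "T \<subseteq> E" and tT: "t \<notin> T" using insert by auto
    have Epos: "0 < card E" using t fin by (auto simp: card_gt_0_iff)
    have \<Phi>nn: "0 \<le> \<Phi> p" if "p permutes E" for p
      unfolding \<Phi>_def using T insert.prems(2) permutes_in_image[OF that] by (intro prod_nonneg) auto
    have key: "perm_avg E (\<lambda>p. \<Phi> p * g t (p t)) \<le> perm_avg E (\<lambda>p. \<Phi> p * g t (p u))"
      if u: "u \<in> E" for u
    proof (cases "u \<in> T")
      case False
      have "\<Phi> (p \<circ> Transposition.transpose t u) = \<Phi> p" for p
        unfolding \<Phi>_def using False tT
        by (intro prod.cong refl) (auto simp: Transposition.transpose_def)
      then have "perm_avg E (\<lambda>p. \<Phi> p * g t (p t)) = perm_avg E (\<lambda>p. \<Phi> p * g t (p u))"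
        using perm_avg_swap[OF t u, of "\<lambda>p. \<Phi> p * g t (p t)"] by simp
      then show ?thesis by simp
    next
      case True
      define \<Psi> where "\<Psi> p = (\<Prod>e\<in>T-{u}. g e (p e))" for p
      have \<Phi>: "\<Phi> p = g u (p u) * \<Psi> p" for p
        unfolding \<Phi>_def \<Psi>_def by (rule prod.remove[OF insert(1) True])
      have inv: "\<Psi> (p \<circ> Transposition.transpose t u) = \<Psi> p" for p
        unfolding \<Psi>_def using tT
        by (intro prod.cong refl) (auto simp: Transposition.transpose_def)
      have \<Psi>nn: "0 \<le> \<Psi> p" if "p permutes E" for p
        unfolding \<Psi>_def using T insert.prems(2) permutes_in_image[OF that] by (intro prod_nonneg) auto
      define h where "h p = \<Phi> p * g t (p u) - \<Phi> p * g t (p t)" for p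
      have "perm_avg E h = perm_avg E (\<lambda>p. (h p + h (p \<circ> Transposition.transpose t u)) / 2)"
        by (rule perm_avg_swap_sym[OF t u])
      also have "\<dots> \<ge> 0"
      proof (rule perm_avg_nonneg)
        fix p assume p: "p permutes E"
        \<comment> \<open>The symmetrized difference factors into two increments, which have equal
          sign by the monotonicity hypothesis.\<close>
        have eq: "h p + h (p \<circ> Transposition.transpose t u)
            = \<Psi> p * ((g u (p u) - g u (p t)) * (g t (p u) - g t (p t)))"
          unfolding h_def \<Phi> inv by (simp add: algebra_simps)
        have "0 \<le> (g u (p u) - g u (p t)) * (g t (p u) - g t (p t))"
          using True t u permutes_in_image[OF p] by (intro insert.prems(3)) auto
        then show "0 \<le> (h p + h (p \<circ> Transposition.transpose t u)) / 2"
          unfolding eq using \<Psi>nn[OF p] by simp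
      qed
      finally show ?thesis unfolding h_def by (simp add: perm_avg_diff)
    qed
    \<comment> \<open>Summed over all slots \<open>u\<close>, the factor \<open>g t (p u)\<close> no
      longer depends on \<open>p\<close> and leaves the average.\<close>
    have "card E * perm_avg E (\<lambda>p. \<Phi> p * g t (p t)) = (\<Sum>u\<in>E. perm_avg E (\<lambda>p. \<Phi> p * g t (p t)))"
      by simp
    also have "\<dots> \<le> (\<Sum>u\<in>E. perm_avg E (\<lambda>p. \<Phi> p * g t (p u)))"
      by (rule sum_mono) (rule key)
    also have "\<dots> = perm_avg E (\<lambda>p. \<Phi> p * (\<Sum>u\<in>E. g t (p u)))"
      by (simp add: perm_avg_sum sum_distrib_left)
    also have "\<dots> = perm_avg E (\<lambda>p. \<Phi> p * (\<Sum>a\<in>E. g t a))"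
      by (intro perm_avg_cong arg_cong2[where f = "(*)"] refl)
         (simp add: sum.permute[where g = "g t", unfolded comp_def])
    also have "\<dots> = perm_avg E \<Phi> * (\<Sum>a\<in>E. g t a)" by (rule perm_avg_multc)
    finally have "perm_avg E (\<lambda>p. \<Phi> p * g t (p t)) \<le> perm_avg E \<Phi> * ((\<Sum>a\<in>E. g t a) / card E)"
      using Epos by (simp add: field_simps)
    also have "\<dots> \<le> (\<Prod>e\<in>T. (\<Sum>a\<in>E. g e a) / card E) * ((\<Sum>a\<in>E. g t a) / card E)"
    proof (rule mult_right_mono)
      show "perm_avg E \<Phi> \<le> (\<Prod>e\<in>T. (\<Sum>a\<in>E. g e a) / card E)"
        unfolding \<Phi>_def using T insert.prems by (intro insert.IH) auto
      show "0 \<le> (\<Sum>a\<in>E. g t a) / card E"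
        using insert.prems(2) by (intro divide_nonneg_nonneg sum_nonneg) auto
    qed
    finally show ?case using insert(1,2) by (simp add: \<Phi>_def mult.commute)
  qed
qed

section \<open>Exponential inequalities and moment generating functions\<close>

lemma exp_le_one_plus_square:
  fixes u :: real
  assumes "u \<le> 1"
  shows "exp u \<le> 1 + u + u\<^sup>2"
proof (cases "0 \<le> u")
  case True
  then show ?thesis using assms by (rule exp_bound)
next
  case False
  have deriv: "((\<lambda>x. 1 + x + x\<^sup>2 - exp x) has_real_derivative (1 + 2 * x - exp x)) (at x)" for x :: real
    by (auto intro!: derivative_eq_intros simp: power2_eq_square)
  have "1 + u + u\<^sup>2 - exp u \<ge> 1 + 0 + 0\<^sup>2 - exp (0::real)"
  proof (rule DERIV_nonpos_imp_nonincreasing[of u 0])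
    show "u \<le> 0" using False by simp
    fix x :: real assume "u \<le> x" "x \<le> 0"
    have "1 + 2 * x \<le> 1 + x" using \<open>x \<le> 0\<close> by simp
    also have "\<dots> \<le> exp x" by (rule exp_ge_add_one_self)
    finally show "\<exists>y. ((\<lambda>x. 1 + x + x\<^sup>2 - exp x) has_real_derivative y) (at x) \<and> y \<le> 0"
      using deriv[of x] by (intro exI[of _ "1 + 2 * x - exp x"]) auto
  qed
  then show ?thesis by simp
qed

lemma exp_minus_le:
  fixes u :: real
  assumes "0 \<le> u"
  shows "exp (- u) \<le> 1 - u + u\<^sup>2 / 2"
proof -
  have deriv: "((\<lambda>x. 1 - x + x\<^sup>2 / 2 - exp (- x)) has_real_derivative (- 1 + x + exp (- x))) (at x)" for x :: real
    by (auto intro!: derivative_eq_intros simp: power2_eq_square)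
  have "1 - 0 + 0\<^sup>2 / 2 - exp (- (0::real)) \<le> 1 - u + u\<^sup>2 / 2 - exp (- u)"
  proof (rule DERIV_nonneg_imp_nondecreasing[OF assms])
    fix x :: real
    have "0 \<le> - 1 + x + exp (- x)" using exp_ge_add_one_self[of "-x"] by simp
    then show "\<exists>y. ((\<lambda>x. 1 - x + x\<^sup>2 / 2 - exp (- x)) has_real_derivative y) (at x) \<and> 0 \<le> y"
      using deriv[of x] by blast
  qed
  then show ?thesis by simp
qed

text \<open>There is no restriction on \<open>u\<close>. Averaged over a centred family the linear
  term disappears, which leaves a subgaussian bound for every parameter \<open>t\<close>.\<close>

lemma exp_le_self_plus_exp_square: "exp u \<le> u + exp (u\<^sup>2)" for u :: real
proof (cases "u \<le> 1")
  case True
  then show ?thesis using exp_le_one_plus_square[OF True] exp_ge_add_one_self[of "u\<^sup>2"] by linarith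
next
  case False
  then have "u \<le> u\<^sup>2" by (simp add: power2_eq_square)
  then have "exp u \<le> exp (u\<^sup>2)" by simp
  then show ?thesis using False by linarith
qed

lemma avg_exp_le:
  fixes x :: "'a \<Rightarrow> real"
  assumes "finite E" "E \<noteq> {}" "(\<Sum>e\<in>E. x e) = 0" "\<And>e. e \<in> E \<Longrightarrow> \<bar>x e\<bar> \<le> K"
  shows "(\<Sum>e\<in>E. exp (t * x e)) / card E \<le> exp (t\<^sup>2 * K\<^sup>2)"
proof -
  have "(\<Sum>e\<in>E. exp (t * x e)) \<le> (\<Sum>e\<in>E. t * x e + exp (t\<^sup>2 * K\<^sup>2))"
  proof (rule sum_mono)
    fix e assume "e \<in> E"
    then have "(x e)\<^sup>2 \<le> K\<^sup>2" using assms(4) by (metis abs_le_square_iff abs_of_nonneg abs_ge_zero order_trans)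
    then have "(t * x e)\<^sup>2 \<le> t\<^sup>2 * K\<^sup>2" by (simp add: power_mult_distrib mult_left_mono)
    then show "exp (t * x e) \<le> t * x e + exp (t\<^sup>2 * K\<^sup>2)"
      using exp_le_self_plus_exp_square[of "t * x e"] by (smt (verit) exp_le_cancel_iff)
  qed
  also have "\<dots> = card E * exp (t\<^sup>2 * K\<^sup>2)"
    by (simp add: sum.distrib sum_distrib_left[symmetric] assms(3))
  finally show ?thesis using assms(1,2) by (simp add: divide_le_eq card_gt_0_iff field_simps)
qed

text \<open>Coefficients of one sign make all factors \<open>exp (c e * x a)\<close> monotone in
  \<open>x a\<close> in the same direction, as negative association requires.\<close>

lemma perm_avg_exp_le_nonneg:
  fixes x :: "'a \<Rightarrow> real"
  assumes fin: "finite E" and sum0: "(\<Sum>e\<in>E. x e) = 0" and bd: "\<And>e. e \<in> E \<Longrightarrow> \<bar>x e\<bar> \<le> K"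
    and T: "T \<subseteq> E" and s: "s = 1 \<or> s = -1" and c: "\<And>e. e \<in> T \<Longrightarrow> 0 \<le> s * c e"
  shows "perm_avg E (\<lambda>p. exp (\<Sum>e\<in>T. c e * x (p e))) \<le> exp (K\<^sup>2 * (\<Sum>e\<in>T. (c e)\<^sup>2))"
proof (cases "E = {}")
  case True
  then have "T = {}" using T by auto
  then show ?thesis using perm_avg_const[OF fin, of "1::real"] by simp
next
  case False
  have finT: "finite T" using T fin by (rule finite_subset)
  have "perm_avg E (\<lambda>p. exp (\<Sum>e\<in>T. c e * x (p e))) = perm_avg E (\<lambda>p. \<Prod>e\<in>T. exp (c e * x (p e)))"
    by (simp add: exp_sum[OF finT])
  also have "\<dots> \<le> (\<Prod>e\<in>T. (\<Sum>a\<in>E. exp (c e * x a)) / card E)"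
  proof (rule perm_avg_prod_le[OF fin T])
    fix e e' a b assume *: "e \<in> T" "e' \<in> T" "a \<in> E" "b \<in> E"
    show "0 \<le> (exp (c e * x a) - exp (c e * x b)) * (exp (c e' * x a) - exp (c e' * x b))"
    proof -
      have split: "c e * x a - c e * x b = (s * c e) * (s * (x a - x b))" for e
        using s by (auto simp: algebra_simps)
      have "0 \<le> (c e * x a - c e * x b) \<and> 0 \<le> (c e' * x a - c e' * x b) \<or>
         (c e * x a - c e * x b) \<le> 0 \<and> (c e' * x a - c e' * x b) \<le> 0"
        unfolding split using c[OF *(1)] c[OF *(2)]
        by (cases "0 \<le> s * (x a - x b)")
           (blast intro: mult_nonneg_nonneg, meson linear mult_nonneg_nonpos)
      then consider "c e * x b \<le> c e * x a" "c e' * x b \<le> c e' * x a"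
        | "c e * x a \<le> c e * x b" "c e' * x a \<le> c e' * x b"
        by auto
      then show ?thesis
        by cases (rule mult_nonneg_nonneg mult_nonpos_nonpos; simp)+
    qed
  qed auto
  also have "\<dots> \<le> (\<Prod>e\<in>T. exp ((c e)\<^sup>2 * K\<^sup>2))"
    by (intro prod_mono conjI avg_exp_le[OF fin False sum0 bd] divide_nonneg_nonneg sum_nonneg) auto
  also have "\<dots> = exp (K\<^sup>2 * (\<Sum>e\<in>T. (c e)\<^sup>2))"
    by (simp add: exp_sum[OF finT, symmetric] sum_distrib_left mult.commute)
  finally show ?thesis .
qed

text \<open>Positive and negative coefficients are separated by
  \<open>2 * exp a * exp b \<le> exp (2 * a) + exp (2 * b)\<close>. Doubling the coefficients is
  what turns the factor 1 in the exponent into 4.\<close>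

lemma perm_avg_exp_le:
  fixes x c :: "'a \<Rightarrow> real"
  assumes fin: "finite E" and sum0: "(\<Sum>e\<in>E. x e) = 0" and bd: "\<And>e. e \<in> E \<Longrightarrow> \<bar>x e\<bar> \<le> K"
    and T: "T \<subseteq> E"
  shows "perm_avg E (\<lambda>p. exp (\<Sum>e\<in>T. c e * x (p e))) \<le> exp (4 * K\<^sup>2 * (\<Sum>e\<in>T. (c e)\<^sup>2))"
proof -
  define c1 where "c1 e = 2 * max (c e) 0" for e
  define c2 where "c2 e = 2 * min (c e) 0" for e
  have "perm_avg E (\<lambda>p. exp (\<Sum>e\<in>T. c e * x (p e)))
     \<le> perm_avg E (\<lambda>p. (1/2) * (exp (\<Sum>e\<in>T. c1 e * x (p e)) + exp (\<Sum>e\<in>T. c2 e * x (p e))))"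
  proof (rule perm_avg_mono)
    fix p
    define a where "a = (\<Sum>e\<in>T. c1 e * x (p e)) / 2"
    define b where "b = (\<Sum>e\<in>T. c2 e * x (p e)) / 2"
    have "c e = (c1 e + c2 e) / 2" for e unfolding c1_def c2_def by (auto simp: max_def min_def)
    then have "(\<Sum>e\<in>T. c e * x (p e)) = (\<Sum>e\<in>T. (c1 e + c2 e) / 2 * x (p e))"
      by (intro sum.cong refl arg_cong2[where f = "(*)"])
    also have "\<dots> = a + b"
      unfolding a_def b_def sum_divide_distrib sum.distrib[symmetric]
      by (intro sum.cong refl) (simp add: add_divide_distrib distrib_right)
    finally have eq: "(\<Sum>e\<in>T. c e * x (p e)) = a + b" .
    have dbl: "exp (2 * r) = (exp r)\<^sup>2" for r :: real
      by (simp add: exp_double)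
    have "2 * exp a * exp b \<le> (exp a)\<^sup>2 + (exp b)\<^sup>2" by (rule sum_squares_bound)
    then have "exp (a + b) \<le> (1/2) * (exp (2*a) + exp (2*b))"
      unfolding dbl exp_add by simp
    then show "exp (\<Sum>e\<in>T. c e * x (p e)) \<le>
      (1/2) * (exp (\<Sum>e\<in>T. c1 e * x (p e)) + exp (\<Sum>e\<in>T. c2 e * x (p e)))"
      unfolding eq by (simp add: a_def b_def)
  qed
  also have "\<dots> = (1/2) * (perm_avg E (\<lambda>p. exp (\<Sum>e\<in>T. c1 e * x (p e))) + perm_avg E (\<lambda>p. exp (\<Sum>e\<in>T. c2 e * x (p e))))"
    by (simp only: perm_avg_cmult perm_avg_add)
  also have "\<dots> \<le> (1/2) * (exp (K\<^sup>2 * (\<Sum>e\<in>T. (c1 e)\<^sup>2)) + exp (K\<^sup>2 * (\<Sum>e\<in>T. (c2 e)\<^sup>2)))"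
  proof -
    have "perm_avg E (\<lambda>p. exp (\<Sum>e\<in>T. c1 e * x (p e))) \<le> exp (K\<^sup>2 * (\<Sum>e\<in>T. (c1 e)\<^sup>2))"
      by (rule perm_avg_exp_le_nonneg[OF fin sum0 bd T, where s = 1]) (auto simp: c1_def)
    moreover have "perm_avg E (\<lambda>p. exp (\<Sum>e\<in>T. c2 e * x (p e))) \<le> exp (K\<^sup>2 * (\<Sum>e\<in>T. (c2 e)\<^sup>2))"
      by (rule perm_avg_exp_le_nonneg[OF fin sum0 bd T, where s = "-1"]) (auto simp: c2_def min_def)
    ultimately show ?thesis by simp
  qed
  also have "\<dots> \<le> (1/2) * (exp (4 * K\<^sup>2 * (\<Sum>e\<in>T. (c e)\<^sup>2)) + exp (4 * K\<^sup>2 * (\<Sum>e\<in>T. (c e)\<^sup>2)))"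
  proof -
    have "(c1 e)\<^sup>2 \<le> 4 * (c e)\<^sup>2" "(c2 e)\<^sup>2 \<le> 4 * (c e)\<^sup>2" for e
      unfolding c1_def c2_def by (auto simp: max_def min_def power_mult_distrib)
    then have "(\<Sum>e\<in>T. (c1 e)\<^sup>2) \<le> 4 * (\<Sum>e\<in>T. (c e)\<^sup>2)" "(\<Sum>e\<in>T. (c2 e)\<^sup>2) \<le> 4 * (\<Sum>e\<in>T. (c e)\<^sup>2)"
      by (simp_all add: sum_distrib_left sum_mono)
    then have "K\<^sup>2 * (\<Sum>e\<in>T. (c1 e)\<^sup>2) \<le> K\<^sup>2 * (4 * (\<Sum>e\<in>T. (c e)\<^sup>2))" "K\<^sup>2 * (\<Sum>e\<in>T. (c2 e)\<^sup>2) \<le> K\<^sup>2 * (4 * (\<Sum>e\<in>T. (c e)\<^sup>2))"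
      by (simp_all add: mult_left_mono)
    then show ?thesis by (intro mult_left_mono add_mono) auto
  qed
  finally show ?thesis by simp
qed

section \<open>Exchangeability of unrevealed slots\<close>

lemma sum_pairwise_diff_squares:
  fixes f :: "'a \<Rightarrow> real"
  shows "(\<Sum>u\<in>U. \<Sum>v\<in>U. (f u - f v)\<^sup>2) = 2 * (card U * (\<Sum>u\<in>U. (f u)\<^sup>2) - (\<Sum>u\<in>U. f u)\<^sup>2)"
proof -
  have "(\<Sum>u\<in>U. \<Sum>v\<in>U. (f u - f v)\<^sup>2)
      = (\<Sum>u\<in>U. \<Sum>v\<in>U. (f u)\<^sup>2 + (f v)\<^sup>2 - 2 * (f u * f v))"
    by (simp add: power2_diff algebra_simps)
  also have "\<dots> = (\<Sum>u\<in>U. \<Sum>v\<in>U. (f u)\<^sup>2) + (\<Sum>u\<in>U. \<Sum>v\<in>U. (f v)\<^sup>2) - 2 * (\<Sum>u\<in>U. \<Sum>v\<in>U. f u * f v)"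
    by (simp only: sum_subtractf sum.distrib sum_distrib_left)
  also have "(\<Sum>u\<in>U. \<Sum>v\<in>U. f u * f v) = (\<Sum>u\<in>U. f u)\<^sup>2"
    by (simp add: power2_eq_square sum_product)
  also have "(\<Sum>u\<in>U. \<Sum>v\<in>U. (f u)\<^sup>2) = card U * (\<Sum>u\<in>U. (f u)\<^sup>2)"
    by (simp add: sum_distrib_left)
  finally show ?thesis by simp
qed

text \<open>Double transitivity of the symmetric group: one transposition moves \<open>u\<close> to
  \<open>v\<close>, a second one corrects the image \<open>w\<close> of \<open>u'\<close> and fixes
  \<open>v\<close>, because \<open>w\<close> and \<open>v'\<close> both differ from
  \<open>v\<close>.\<close>

lemma pair_transport:
  assumes "u \<in> U" "u' \<in> U" "u \<noteq> u'" "v \<in> U" "v' \<in> U" "v \<noteq> v'"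
  obtains \<tau> where "\<tau> permutes U" "\<tau> u = v" "\<tau> u' = v'"
proof -
  define w where "w = Transposition.transpose u v u'"
  have w: "w \<in> U" "w \<noteq> v" using assms by (auto simp: w_def Transposition.transpose_def)
  have "Transposition.transpose w v' \<circ> Transposition.transpose u v permutes U"
    by (intro permutes_compose permutes_swap_id assms w)
  moreover have "(Transposition.transpose w v' \<circ> Transposition.transpose u v) u = v"
    using w assms by (auto simp: Transposition.transpose_def)
  moreover have "(Transposition.transpose w v' \<circ> Transposition.transpose u v) u' = v'"
    using w_def by (simp add: Transposition.transpose_def)
  ultimately show ?thesis by (rule that)
qed

text \<open>A weight that is invariant under rearrangements of \<open>U\<close> cannot tell one pair
  of distinct slots in \<open>U\<close> from another.\<close>

lemma perm_avg_pair_exchange: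
  assumes "U \<subseteq> E" "u \<in> U" "u' \<in> U" "u \<noteq> u'" "v \<in> U" "v' \<in> U" "v \<noteq> v'"
    and inv: "\<And>p \<tau>. p permutes E \<Longrightarrow> \<tau> permutes U \<Longrightarrow> \<Phi> (p \<circ> \<tau>) = \<Phi> p"
  shows "perm_avg E (\<lambda>p. \<Phi> p * f (p u) (p u')) = perm_avg E (\<lambda>p. \<Phi> p * f (p v) (p v'))"
proof -
  obtain \<tau> where \<tau>: "\<tau> permutes U" "\<tau> u = v" "\<tau> u' = v'"
    using pair_transport[OF assms(2-7)] .
  have \<tau>E: "\<tau> permutes E" using \<tau>(1) assms(1) by (rule permutes_subset)
  have "perm_avg E (\<lambda>p. \<Phi> p * f (p u) (p u')) = perm_avg E (\<lambda>p. \<Phi> (p \<circ> \<tau>) * f ((p \<circ> \<tau>) u) ((p \<circ> \<tau>) u'))"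
    using perm_avg_compose[OF \<tau>E, of "\<lambda>p. \<Phi> p * f (p u) (p u')"] by simp
  also have "\<dots> = perm_avg E (\<lambda>p. \<Phi> p * f (p v) (p v'))"
    by (rule perm_avg_cong) (simp add: inv[OF _ \<tau>(1)] \<tau>)
  finally show ?thesis .
qed

text \<open>As long as the revealed entries carry at most a fixed share of the variance, the unrevealed ones
  are deterministically spread out.\<close>

lemma perm_avg_diff_square_ge:
  fixes y :: "'a \<Rightarrow> real" and V :: real and \<Phi> :: "('a \<Rightarrow> 'a) \<Rightarrow> real"
  assumes fin: "finite E" and sum0: "(\<Sum>e\<in>E. y e) = 0" and var: "(\<Sum>e\<in>E. (y e)\<^sup>2) = V * card E"
    and T: "T \<subseteq> E" "4 * card T \<le> card E"
    and \<Phi>nn: "\<And>p. p permutes E \<Longrightarrow> 0 \<le> \<Phi> p"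
    and supp: "\<And>p. p permutes E \<Longrightarrow> \<Phi> p \<noteq> 0 \<Longrightarrow> (\<Sum>e\<in>T. (y (p e))\<^sup>2) \<le> 3/8 * (V * card E)"
    and inv: "\<And>p \<tau>. p permutes E \<Longrightarrow> \<tau> permutes (E - T) \<Longrightarrow> \<Phi> (p \<circ> \<tau>) = \<Phi> p"
    and u: "u \<in> E - T" "u' \<in> E - T" "u \<noteq> u'"
  shows "3/4 * V * perm_avg E \<Phi> \<le> perm_avg E (\<lambda>p. \<Phi> p * (y (p u) - y (p u'))\<^sup>2)"
proof -
  define U where "U = E - T"
  define N where "N = real (card E)"
  define c where "c = perm_avg E (\<lambda>p. \<Phi> p * (y (p u) - y (p u'))\<^sup>2)"
  have finU: "finite U" and finT: "finite T" using fin T by (auto simp: U_def intro: finite_subset)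
  have Npos: "N > 0" using u fin by (auto simp: N_def card_gt_0_iff)
  have cardU: "real (card U) = N - card T"
    using card_Diff_subset[OF finT T(1)] card_mono[OF fin T(1)] by (simp add: U_def N_def)
  have "0 \<le> V * N" unfolding N_def var[symmetric] by (intro sum_nonneg) auto
  then have V0: "0 \<le> V" using Npos by (simp add: zero_le_mult_iff)
  have pairsum: "3/4 * V * N\<^sup>2 \<le> (\<Sum>v\<in>U. \<Sum>v'\<in>U. (y (p v) - y (p v'))\<^sup>2)"
    if p: "p permutes E" and nz: "\<Phi> p \<noteq> 0" for p
  proof -
    define Q where "Q = (\<Sum>e\<in>T. (y (p e))\<^sup>2)"
    have Q: "Q \<le> 3/8 * (V * N)" using supp[OF p nz] by (simp add: Q_def N_def)
    have tot: "(\<Sum>e\<in>E. (y (p e))\<^sup>2) = V * N"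
      using sum.permute[OF p, of "\<lambda>e. (y e)\<^sup>2"] var by (simp add: comp_def N_def)
    have tot0: "(\<Sum>e\<in>E. y (p e)) = 0"
      using sum.permute[OF p, of y] sum0 by (simp add: comp_def)
    have s2: "(\<Sum>e\<in>U. (y (p e))\<^sup>2) = V * N - Q"
      using sum.subset_diff[OF T(1) fin, of "\<lambda>e. (y (p e))\<^sup>2"] tot by (simp add: U_def Q_def)
    have s1: "(\<Sum>e\<in>U. y (p e)) = - (\<Sum>e\<in>T. y (p e))"
      using sum.subset_diff[OF T(1) fin, of "\<lambda>e. y (p e)"] tot0 by (simp add: U_def)
    \<comment> \<open>All entries sum to zero, so the sum over unrevealed slots is minus the sum
      over revealed ones, and Cauchy-Schwarz bounds it by the revealed variance.\<close>
    have "(\<Sum>e\<in>U. y (p e))\<^sup>2 = (\<Sum>e\<in>T. 1 * y (p e))\<^sup>2" unfolding s1 by simp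
    also have "\<dots> \<le> (\<Sum>e\<in>T. 1\<^sup>2) * Q"
      unfolding Q_def by (rule Cauchy_Schwarz_ineq_sum)
    finally have cs: "(\<Sum>e\<in>U. y (p e))\<^sup>2 \<le> card T * Q" by simp
    \<comment> \<open>The unrevealed slots are at least 3/4 of all and the revealed variance is at
      most 3/8, so 3/8 remains; the factor 2 of the pairwise identity gives 3/4.\<close>
    have "3/4 * V * N\<^sup>2 \<le> 2 * (N * (V * (N - card T) - Q))"
    proof -
      have "V * (real (card T)) \<le> V * (N / 4)" using T(2) V0 by (intro mult_left_mono) (auto simp: N_def)
      then have "3/8 * (V * N) \<le> V * (N - card T) - Q" using Q by (simp add: algebra_simps)
      then have "N * (3/8 * (V * N)) \<le> N * (V * (N - card T) - Q)" using Npos by (intro mult_left_mono) auto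
      then show ?thesis by (simp add: power2_eq_square algebra_simps)
    qed
    also have "N * (V * (N - card T) - Q) = card U * (V * N - Q) - card T * Q"
      unfolding cardU by (simp add: algebra_simps)
    also have "2 * \<dots> \<le> 2 * (card U * (\<Sum>u\<in>U. (y (p u))\<^sup>2) - (\<Sum>u\<in>U. y (p u))\<^sup>2)"
      unfolding s2 using cs by simp
    also have "\<dots> = (\<Sum>v\<in>U. \<Sum>v'\<in>U. (y (p v) - y (p v'))\<^sup>2)"
      by (rule sum_pairwise_diff_squares[symmetric])
    finally show ?thesis .
  qed
  have c0: "0 \<le> c" unfolding c_def by (intro perm_avg_nonneg mult_nonneg_nonneg \<Phi>nn) auto
  have "3/4 * V * N\<^sup>2 * perm_avg E \<Phi> = perm_avg E (\<lambda>p. (3/4 * V * N\<^sup>2) * \<Phi> p)"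
    by (simp only: perm_avg_cmult)
  also have "\<dots> \<le> perm_avg E (\<lambda>p. \<Phi> p * (\<Sum>v\<in>U. \<Sum>v'\<in>U. (y (p v) - y (p v'))\<^sup>2))"
  proof (rule perm_avg_mono)
    fix p assume p: "p permutes E"
    show "(3/4 * V * N\<^sup>2) * \<Phi> p \<le> \<Phi> p * (\<Sum>v\<in>U. \<Sum>v'\<in>U. (y (p v) - y (p v'))\<^sup>2)"
    proof (cases "\<Phi> p = 0")
      case False
      show ?thesis
        using mult_left_mono[OF pairsum[OF p False] \<Phi>nn[OF p]] by (simp add: mult.commute)
    qed simp
  qed
  also have "\<dots> = (\<Sum>v\<in>U. \<Sum>v'\<in>U. perm_avg E (\<lambda>p. \<Phi> p * (y (p v) - y (p v'))\<^sup>2))"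
    by (simp only: sum_distrib_left perm_avg_sum)
  \<comment> \<open>Pairs of distinct unrevealed slots all contribute \<open>c\<close> by
    exchangeability; the diagonal contributes 0.\<close>
  also have "\<dots> \<le> (\<Sum>v\<in>U. \<Sum>v'\<in>U. c)"
  proof (intro sum_mono)
    fix v v' assume v: "v \<in> U" "v' \<in> U"
    show "perm_avg E (\<lambda>p. \<Phi> p * (y (p v) - y (p v'))\<^sup>2) \<le> c"
    proof (cases "v = v'")
      case True
      then show ?thesis using c0 perm_avg_const[OF fin, of "0::real"] by simp
    next
      case False
      have "perm_avg E (\<lambda>p. \<Phi> p * (y (p v) - y (p v'))\<^sup>2) = c"
        unfolding c_def
        by (rule perm_avg_pair_exchange[where U = U and f = "\<lambda>a b. (y a - y b)\<^sup>2"])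
           (use v False u inv in \<open>auto simp: U_def\<close>)
      then show ?thesis by simp
    qed
  qed
  also have "\<dots> = (card U)\<^sup>2 * c" by (simp add: power2_eq_square)
  also have "\<dots> \<le> N\<^sup>2 * c"
    using c0 cardU by (intro mult_right_mono power_mono) auto
  finally have "N\<^sup>2 * (3/4 * V * perm_avg E \<Phi>) \<le> N\<^sup>2 * c" by (simp add: algebra_simps)
  then show ?thesis using Npos unfolding c_def[symmetric] by (simp only: mult_le_cancel_left_pos zero_less_power)
qed

section \<open>Moments of sums over disjoint swaps\<close>

text \<open>Swapping \<open>e k\<close> with \<open>e' k\<close> reverses the sign of the
  \<open>k\<close>-th term and of no other, so the terms act like independent symmetric variables
  and cross terms average to zero.\<close>

lemma perm_avg_sum_square:
  fixes \<Psi> :: "('a \<Rightarrow> 'a) \<Rightarrow> real" and x :: "'a \<Rightarrow> real"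
  assumes "finite I" and E: "\<And>i. i \<in> I \<Longrightarrow> e i \<in> E \<and> e' i \<in> E"
    and dis: "\<And>i k. i \<in> I \<Longrightarrow> k \<in> I \<Longrightarrow> i \<noteq> k \<Longrightarrow> e i \<noteq> e k \<and> e i \<noteq> e' k \<and> e' i \<noteq> e k \<and> e' i \<noteq> e' k"
    and inv: "\<And>p i. p permutes E \<Longrightarrow> i \<in> I \<Longrightarrow> \<Psi> (p \<circ> Transposition.transpose (e i) (e' i)) = \<Psi> p"
  shows "perm_avg E (\<lambda>p. \<Psi> p * (\<Sum>i\<in>I. y i * (x (p (e i)) - x (p (e' i))))\<^sup>2)
       = perm_avg E (\<lambda>p. \<Psi> p * (\<Sum>i\<in>I. (y i)\<^sup>2 * (x (p (e i)) - x (p (e' i)))\<^sup>2))"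
  using assms
proof (induction I rule: finite_induct)
  case empty
  then show ?case by simp
next
  case (insert k I)
  define S where "S p = (\<Sum>i\<in>I. y i * (x (p (e i)) - x (p (e' i))))" for p
  define t where "t p = y k * (x (p (e k)) - x (p (e' k)))" for p
  have kE: "e k \<in> E" "e' k \<in> E" using insert.prems(1)[of k] by auto
  have fixed: "Transposition.transpose (e k) (e' k) (e i) = e i"
    "Transposition.transpose (e k) (e' k) (e' i) = e' i" if "i \<in> I" for i
    using insert.prems(2)[of i k] insert.hyps(2) that by (auto simp: Transposition.transpose_def)
  have Sinv: "S (p \<circ> Transposition.transpose (e k) (e' k)) = S p" for p
    unfolding S_def by (intro sum.cong refl) (simp add: fixed)
  have tinv: "t (p \<circ> Transposition.transpose (e k) (e' k)) = - t p" for p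
    unfolding t_def by (simp add: algebra_simps)
  have sumeq: "(\<Sum>i\<in>insert k I. y i * (x (p (e i)) - x (p (e' i)))) = t p + S p" for p
    using insert.hyps by (simp add: S_def t_def)
  have cross: "perm_avg E (\<lambda>p. \<Psi> p * (S p * t p)) = 0"
    by (rule perm_avg_swap_antisym[OF kE]) (simp add: Sinv tinv insert.prems(3))
  have "perm_avg E (\<lambda>p. \<Psi> p * (\<Sum>i\<in>insert k I. y i * (x (p (e i)) - x (p (e' i))))\<^sup>2)
     = perm_avg E (\<lambda>p. \<Psi> p * (S p)\<^sup>2 + \<Psi> p * (t p)\<^sup>2 + 2 * (\<Psi> p * (S p * t p)))"
    unfolding sumeq by (intro perm_avg_cong) (simp add: power2_sum algebra_simps)
  also have "\<dots> = perm_avg E (\<lambda>p. \<Psi> p * (S p)\<^sup>2) + perm_avg E (\<lambda>p. \<Psi> p * (t p)\<^sup>2)"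
    by (simp only: perm_avg_add perm_avg_cmult cross)
  also have "perm_avg E (\<lambda>p. \<Psi> p * (S p)\<^sup>2)
      = perm_avg E (\<lambda>p. \<Psi> p * (\<Sum>i\<in>I. (y i)\<^sup>2 * (x (p (e i)) - x (p (e' i)))\<^sup>2))"
    unfolding S_def using insert.prems by (intro insert.IH) auto
  also have "\<dots> + perm_avg E (\<lambda>p. \<Psi> p * (t p)\<^sup>2)
      = perm_avg E (\<lambda>p. \<Psi> p * (\<Sum>i\<in>insert k I. (y i)\<^sup>2 * (x (p (e i)) - x (p (e' i)))\<^sup>2))"
    unfolding perm_avg_add[symmetric] using insert.hyps
    by (intro perm_avg_cong) (simp add: t_def power_mult_distrib distrib_left)
  finally show ?case .
qed

text \<open>Khinchine's inequality for the fourth moment. The constant 3 survives the induction: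
  adding a term \<open>t\<close> contributes \<open>6 * S^2 * t^2 + t^4\<close> on the left and
  \<open>6 * Q * t^2 + 3 * t^4\<close> on the right.\<close>

lemma perm_avg_sum_fourth_power:
  fixes \<Psi> :: "('a \<Rightarrow> 'a) \<Rightarrow> real" and x :: "'a \<Rightarrow> real"
  assumes "finite I" and E: "\<And>i. i \<in> I \<Longrightarrow> e i \<in> E \<and> e' i \<in> E"
    and dis: "\<And>i k. i \<in> I \<Longrightarrow> k \<in> I \<Longrightarrow> i \<noteq> k \<Longrightarrow> e i \<noteq> e k \<and> e i \<noteq> e' k \<and> e' i \<noteq> e k \<and> e' i \<noteq> e' k"
    and inv: "\<And>p i. p permutes E \<Longrightarrow> i \<in> I \<Longrightarrow> \<Psi> (p \<circ> Transposition.transpose (e i) (e' i)) = \<Psi> p"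
    and nn: "\<And>p. p permutes E \<Longrightarrow> 0 \<le> \<Psi> p"
  shows "perm_avg E (\<lambda>p. \<Psi> p * (\<Sum>i\<in>I. y i * (x (p (e i)) - x (p (e' i))))^4)
       \<le> 3 * perm_avg E (\<lambda>p. \<Psi> p * (\<Sum>i\<in>I. (y i)\<^sup>2 * (x (p (e i)) - x (p (e' i)))\<^sup>2)\<^sup>2)"
  using assms
proof (induction I rule: finite_induct)
  case empty
  then show ?case by (simp add: perm_avg_def)
next
  case (insert k I)
  define S where "S p = (\<Sum>i\<in>I. y i * (x (p (e i)) - x (p (e' i))))" for p
  define Q where "Q p = (\<Sum>i\<in>I. (y i)\<^sup>2 * (x (p (e i)) - x (p (e' i)))\<^sup>2)" for p
  define t where "t p = y k * (x (p (e k)) - x (p (e' k)))" for p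
  have kE: "e k \<in> E" "e' k \<in> E" using insert.prems(1)[of k] by auto
  have fixed: "Transposition.transpose (e k) (e' k) (e i) = e i"
    "Transposition.transpose (e k) (e' k) (e' i) = e' i" if "i \<in> I" for i
    using insert.prems(2)[of i k] insert.hyps(2) that by (auto simp: Transposition.transpose_def)
  have fixed': "Transposition.transpose (e i) (e' i) (e k) = e k"
    "Transposition.transpose (e i) (e' i) (e' k) = e' k" if "i \<in> I" for i
    using insert.prems(2)[of k i] insert.hyps(2) that by (auto simp: Transposition.transpose_def)
  have Sinv: "S (p \<circ> Transposition.transpose (e k) (e' k)) = S p" for p
    unfolding S_def by (intro sum.cong refl) (simp add: fixed)
  have tinv: "t (p \<circ> Transposition.transpose (e k) (e' k)) = - t p" for p
    unfolding t_def by (simp add: algebra_simps)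
  have sumeq: "(\<Sum>i\<in>insert k I. y i * (x (p (e i)) - x (p (e' i)))) = t p + S p" for p
    using insert.hyps by (simp add: S_def t_def)
  have cross: "perm_avg E (\<lambda>p. \<Psi> p * (4 * S p ^ 3 * t p + 4 * S p * t p ^ 3)) = 0"
    by (rule perm_avg_swap_antisym[OF kE]) (simp add: Sinv tinv insert.prems(3) algebra_simps)
  \<comment> \<open>The weight \<open>\<Psi> p * (t p)^2\<close> is still invariant under the swaps
    indexed by \<open>I\<close>, so the second moment identity applies to it.\<close>
  have mixed: "perm_avg E (\<lambda>p. (\<Psi> p * (t p)\<^sup>2) * (S p)\<^sup>2) = perm_avg E (\<lambda>p. (\<Psi> p * (t p)\<^sup>2) * Q p)"
    unfolding S_def Q_def
  proof (rule perm_avg_sum_square)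
    fix p i assume i: "p permutes E" "i \<in> I"
    then have \<Psi>: "\<Psi> (p \<circ> Transposition.transpose (e i) (e' i)) = \<Psi> p"
      by (intro insert.prems(3)) auto
    have "t (p \<circ> Transposition.transpose (e i) (e' i)) = t p"
      using i(2) by (simp add: t_def fixed')
    then show "\<Psi> (p \<circ> Transposition.transpose (e i) (e' i)) * (t (p \<circ> Transposition.transpose (e i) (e' i)))\<^sup>2
        = \<Psi> p * (t p)\<^sup>2"
      by (simp only: \<Psi>)
  qed (use insert.prems insert.hyps in auto)
  have "perm_avg E (\<lambda>p. \<Psi> p * (\<Sum>i\<in>insert k I. y i * (x (p (e i)) - x (p (e' i))))^4)
     = perm_avg E (\<lambda>p. \<Psi> p * S p ^ 4 + 6 * ((\<Psi> p * (t p)\<^sup>2) * (S p)\<^sup>2) + \<Psi> p * t p ^ 4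
          + \<Psi> p * (4 * S p ^ 3 * t p + 4 * S p * t p ^ 3))"
    unfolding sumeq by (intro perm_avg_cong)
      (simp add: power4_eq_xxxx power3_eq_cube power2_eq_square algebra_simps)
  also have "\<dots> = perm_avg E (\<lambda>p. \<Psi> p * S p ^ 4) + 6 * perm_avg E (\<lambda>p. (\<Psi> p * (t p)\<^sup>2) * Q p)
      + perm_avg E (\<lambda>p. \<Psi> p * t p ^ 4)"
    by (simp only: perm_avg_add perm_avg_cmult cross mixed)
  also have "\<dots> \<le> 3 * perm_avg E (\<lambda>p. \<Psi> p * (Q p)\<^sup>2) + 6 * perm_avg E (\<lambda>p. (\<Psi> p * (t p)\<^sup>2) * Q p)
      + perm_avg E (\<lambda>p. \<Psi> p * t p ^ 4)"
  proof -
    have "perm_avg E (\<lambda>p. \<Psi> p * S p ^ 4) \<le> 3 * perm_avg E (\<lambda>p. \<Psi> p * (Q p)\<^sup>2)"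
      unfolding S_def Q_def using insert.prems by (intro insert.IH) auto
    then show ?thesis by simp
  qed
  also have "\<dots> = perm_avg E (\<lambda>p. 3 * (\<Psi> p * (Q p)\<^sup>2) + 6 * ((\<Psi> p * (t p)\<^sup>2) * Q p) + \<Psi> p * t p ^ 4)"
    by (simp only: perm_avg_add perm_avg_cmult)
  also have "\<dots> \<le> perm_avg E (\<lambda>p. 3 * (\<Psi> p * (\<Sum>i\<in>insert k I. (y i)\<^sup>2 * (x (p (e i)) - x (p (e' i)))\<^sup>2)\<^sup>2))"
  proof (rule perm_avg_mono)
    fix p assume p: "p permutes E"
    have sumeq: "(\<Sum>i\<in>insert k I. (y i)\<^sup>2 * (x (p (e i)) - x (p (e' i)))\<^sup>2) = Q p + (t p)\<^sup>2"
      using insert.hyps by (simp add: Q_def t_def power_mult_distrib)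
    have "3 * (\<Psi> p * (Q p + (t p)\<^sup>2)\<^sup>2) = 3 * (\<Psi> p * (Q p)\<^sup>2) + 6 * ((\<Psi> p * (t p)\<^sup>2) * Q p) + \<Psi> p * t p ^ 4
        + 2 * (\<Psi> p * t p ^ 4)"
      by (simp add: power2_eq_square power4_eq_xxxx algebra_simps)
    then show "3 * (\<Psi> p * (Q p)\<^sup>2) + 6 * ((\<Psi> p * (t p)\<^sup>2) * Q p) + \<Psi> p * t p ^ 4
      \<le> 3 * (\<Psi> p * (\<Sum>i\<in>insert k I. (y i)\<^sup>2 * (x (p (e i)) - x (p (e' i)))\<^sup>2)\<^sup>2)"
      unfolding sumeq using insert.prems(4)[OF p] by simp
  qed
  finally show ?case by (simp only: perm_avg_cmult)
qed

section \<open>Tails of sums of squares\<close>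

lemma perm_avg_le_exp_moment:
  fixes Z :: "('a \<Rightarrow> 'a) \<Rightarrow> real"
  assumes "\<And>p. p permutes E \<Longrightarrow> A p \<Longrightarrow> 0 \<le> Z p"
  shows "perm_avg E (\<lambda>p. of_bool (A p)) \<le> perm_avg E (\<lambda>p. exp (Z p))"
  by (rule perm_avg_mono) (use assms one_le_exp_iff in auto)

text \<open>A quarter of the slots carries variance at most \<open>V * card E / 4\<close> on
  average, below the threshold 3/8. With \<open>\<mu> = 1 / (4 * \<kappa>^2)\<close> each factor
  grows like \<open>1 + 5/4 * \<mu> * y^2\<close>, so the exponent is
  \<open>5/16 - 3/8 = -1/16\<close> times \<open>\<mu> * V * card E\<close>.\<close>

lemma perm_avg_sum_squares_upper_tail:
  fixes y :: "'a \<Rightarrow> real" and V :: real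
  assumes fin: "finite E" and var: "(\<Sum>e\<in>E. (y e)\<^sup>2) = V * card E"
    and bd: "\<And>e. e \<in> E \<Longrightarrow> \<bar>y e\<bar> \<le> \<kappa>" and \<kappa>: "0 < \<kappa>"
    and T: "T \<subseteq> E" "4 * card T \<le> card E"
  shows "perm_avg E (\<lambda>p. of_bool (3/8 * (V * card E) < (\<Sum>e\<in>T. (y (p e))\<^sup>2)))
     \<le> exp (- (V * card E / (64 * \<kappa>\<^sup>2)))"
proof (cases "E = {}")
  case True
  then show ?thesis using T by (simp add: perm_avg_le_const)
next
  case False
  define N where "N = real (card E)"
  define \<mu> where "\<mu> = 1 / (4 * \<kappa>\<^sup>2)"
  have Npos: "0 < N" using False fin by (simp add: N_def card_gt_0_iff)
  have "0 \<le> V * N" unfolding N_def var[symmetric] by (intro sum_nonneg) auto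
  then have V0: "0 \<le> V" using Npos by (simp add: zero_le_mult_iff)
  have finT: "finite T" using T(1) fin by (rule finite_subset)
  have \<mu>0: "0 < \<mu>" using \<kappa> by (simp add: \<mu>_def)
  have avg: "(\<Sum>a\<in>E. exp (\<mu> * (y a)\<^sup>2)) / N \<le> exp (5/4 * \<mu> * V)"
  proof -
    have "(\<Sum>a\<in>E. exp (\<mu> * (y a)\<^sup>2)) \<le> (\<Sum>a\<in>E. 1 + 5/4 * \<mu> * (y a)\<^sup>2)"
    proof (rule sum_mono)
      fix a assume "a \<in> E"
      then have "(y a)\<^sup>2 \<le> \<kappa>\<^sup>2" using bd by (metis abs_le_square_iff abs_of_pos \<kappa>)
      then have small: "\<mu> * (y a)\<^sup>2 \<le> 1/4" using \<kappa> by (simp add: \<mu>_def field_simps)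
      then have "exp (\<mu> * (y a)\<^sup>2) \<le> 1 + \<mu> * (y a)\<^sup>2 + (\<mu> * (y a)\<^sup>2)\<^sup>2"
        by (intro exp_le_one_plus_square) auto
      also have "(\<mu> * (y a)\<^sup>2)\<^sup>2 \<le> 1/4 * (\<mu> * (y a)\<^sup>2)"
        unfolding power2_eq_square[of "\<mu> * (y a)\<^sup>2"] using small \<mu>0 by (intro mult_right_mono) auto
      finally show "exp (\<mu> * (y a)\<^sup>2) \<le> 1 + 5/4 * \<mu> * (y a)\<^sup>2" by simp
    qed
    also have "\<dots> = N * (1 + 5/4 * \<mu> * V)"
      unfolding sum.distrib sum_distrib_left[symmetric] var by (simp add: N_def algebra_simps)
    finally have "(\<Sum>a\<in>E. exp (\<mu> * (y a)\<^sup>2)) / N \<le> 1 + 5/4 * \<mu> * V"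
      using Npos by (simp add: field_simps)
    also have "\<dots> \<le> exp (5/4 * \<mu> * V)" by (rule exp_ge_add_one_self)
    finally show ?thesis .
  qed
  have "perm_avg E (\<lambda>p. of_bool (3/8 * (V * N) < (\<Sum>e\<in>T. (y (p e))\<^sup>2)))
      \<le> perm_avg E (\<lambda>p. exp (\<mu> * ((\<Sum>e\<in>T. (y (p e))\<^sup>2) - 3/8 * (V * N))))"
    using \<mu>0 by (intro perm_avg_le_exp_moment mult_nonneg_nonneg) auto
  also have "\<dots> = perm_avg E (\<lambda>p. exp (- (\<mu> * (3/8 * (V * N)))) * (\<Prod>e\<in>T. exp (\<mu> * (y (p e))\<^sup>2)))"
    unfolding exp_sum[OF finT, symmetric] sum_distrib_left[symmetric] exp_add[symmetric]
    by (simp add: right_diff_distrib)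
  also have "\<dots> = exp (- (\<mu> * (3/8 * (V * N)))) * perm_avg E (\<lambda>p. \<Prod>e\<in>T. exp (\<mu> * (y (p e))\<^sup>2))"
    by (rule perm_avg_cmult)
  also have "\<dots> \<le> exp (- (\<mu> * (3/8 * (V * N)))) * (\<Prod>e\<in>T. (\<Sum>a\<in>E. exp (\<mu> * (y a)\<^sup>2)) / card E)"
    by (intro mult_left_mono perm_avg_prod_le[OF fin T(1)]) auto
  also have "\<dots> \<le> exp (- (\<mu> * (3/8 * (V * N)))) * (\<Prod>e\<in>T. exp (5/4 * \<mu> * V))"
    using avg by (intro mult_left_mono prod_mono conjI divide_nonneg_nonneg sum_nonneg) (auto simp: N_def)
  also have "\<dots> = exp (card T * (5/4 * \<mu> * V) - \<mu> * (3/8 * (V * N)))"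
    unfolding prod_constant exp_of_nat_mult[symmetric] exp_add[symmetric] by simp
  also have "\<dots> \<le> exp (- (V * N / (64 * \<kappa>\<^sup>2)))"
  proof -
    have "card T * (5/4 * \<mu> * V) \<le> (N / 4) * (5/4 * \<mu> * V)"
      using T(2) \<mu>0 V0 by (intro mult_right_mono) (auto simp: N_def)
    then have "card T * (5/4 * \<mu> * V) - \<mu> * (3/8 * (V * N)) \<le> - (\<mu> * V * N / 16)"
      by (simp add: algebra_simps)
    then show ?thesis by (simp add: \<mu>_def)
  qed
  finally show ?thesis by (simp add: N_def)
qed

text \<open>The factors \<open>exp (- \<mu> * y^2)\<close> all decrease in \<open>y^2\<close>, so
  negative association applies again. Per slot the exponent is
  \<open>\<mu> / 2 - 3/4 * \<mu> = - \<mu> / 4\<close> with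
  \<open>\<mu> = 1 / (2 * \<kappa>^2)\<close>.\<close>

lemma perm_avg_sum_squares_lower_tail:
  fixes y :: "'a \<Rightarrow> real"
  assumes fin: "finite E" and var: "(\<Sum>e\<in>E. (y e)\<^sup>2) = card E"
    and bd: "\<And>e. e \<in> E \<Longrightarrow> \<bar>y e\<bar> \<le> \<kappa>" and \<kappa>: "0 < \<kappa>" and T: "T \<subseteq> E"
  shows "perm_avg E (\<lambda>p. of_bool ((\<Sum>e\<in>T. (y (p e))\<^sup>2) < card T / 2)) \<le> exp (- (card T / (8 * \<kappa>\<^sup>2)))"
proof (cases "E = {}")
  case True
  then show ?thesis using T by (simp add: perm_avg_le_const)
next
  case False
  define N where "N = real (card E)"
  define \<mu> where "\<mu> = 1 / (2 * \<kappa>\<^sup>2)"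
  have Npos: "0 < N" using False fin by (simp add: N_def card_gt_0_iff)
  have finT: "finite T" using T fin by (rule finite_subset)
  have \<mu>0: "0 < \<mu>" using \<kappa> by (simp add: \<mu>_def)
  have avg: "(\<Sum>a\<in>E. exp (- (\<mu> * (y a)\<^sup>2))) / N \<le> exp (- (3/4 * \<mu>))"
  proof -
    have "(\<Sum>a\<in>E. exp (- (\<mu> * (y a)\<^sup>2))) \<le> (\<Sum>a\<in>E. 1 - 3/4 * \<mu> * (y a)\<^sup>2)"
    proof (rule sum_mono)
      fix a assume "a \<in> E"
      then have "(y a)\<^sup>2 \<le> \<kappa>\<^sup>2" using bd by (metis abs_le_square_iff abs_of_pos \<kappa>)
      then have small: "\<mu> * (y a)\<^sup>2 \<le> 1/2" using \<kappa> by (simp add: \<mu>_def field_simps)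
      have "exp (- (\<mu> * (y a)\<^sup>2)) \<le> 1 - \<mu> * (y a)\<^sup>2 + (\<mu> * (y a)\<^sup>2)\<^sup>2 / 2"
        using \<mu>0 by (intro exp_minus_le) auto
      also have "(\<mu> * (y a)\<^sup>2)\<^sup>2 \<le> 1/2 * (\<mu> * (y a)\<^sup>2)"
        unfolding power2_eq_square[of "\<mu> * (y a)\<^sup>2"] using small \<mu>0 by (intro mult_right_mono) auto
      finally show "exp (- (\<mu> * (y a)\<^sup>2)) \<le> 1 - 3/4 * \<mu> * (y a)\<^sup>2" by simp
    qed
    also have "\<dots> = N * (1 - 3/4 * \<mu>)"
      unfolding sum_subtractf sum_distrib_left[symmetric] var by (simp add: N_def algebra_simps)
    finally have "(\<Sum>a\<in>E. exp (- (\<mu> * (y a)\<^sup>2))) / N \<le> 1 - 3/4 * \<mu>"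
      using Npos by (simp add: field_simps)
    also have "\<dots> \<le> exp (- (3/4 * \<mu>))" using exp_ge_add_one_self[of "- (3/4 * \<mu>)"] by simp
    finally show ?thesis .
  qed
  have "perm_avg E (\<lambda>p. of_bool ((\<Sum>e\<in>T. (y (p e))\<^sup>2) < card T / 2))
      \<le> perm_avg E (\<lambda>p. exp (\<mu> * (card T / 2 - (\<Sum>e\<in>T. (y (p e))\<^sup>2))))"
    using \<mu>0 by (intro perm_avg_le_exp_moment mult_nonneg_nonneg) auto
  also have "\<dots> = perm_avg E (\<lambda>p. exp (\<mu> * (card T / 2)) * (\<Prod>e\<in>T. exp (- (\<mu> * (y (p e))\<^sup>2))))"
    unfolding exp_sum[OF finT, symmetric] sum_negf sum_distrib_left[symmetric] exp_add[symmetric]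
    by (simp add: right_diff_distrib)
  also have "\<dots> = exp (\<mu> * (card T / 2)) * perm_avg E (\<lambda>p. \<Prod>e\<in>T. exp (- (\<mu> * (y (p e))\<^sup>2)))"
    by (rule perm_avg_cmult)
  also have "\<dots> \<le> exp (\<mu> * (card T / 2)) * (\<Prod>e\<in>T. (\<Sum>a\<in>E. exp (- (\<mu> * (y a)\<^sup>2))) / card E)"
    by (intro mult_left_mono perm_avg_prod_le[OF fin T]) auto
  also have "\<dots> \<le> exp (\<mu> * (card T / 2)) * (\<Prod>e\<in>T. exp (- (3/4 * \<mu>)))"
    using avg by (intro mult_left_mono prod_mono conjI divide_nonneg_nonneg sum_nonneg) (auto simp: N_def)
  also have "\<dots> = exp (\<mu> * (card T / 2) + card T * (- (3/4 * \<mu>)))"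
    unfolding prod_constant exp_of_nat_mult[symmetric] exp_add[symmetric] ..
  also have "\<mu> * (card T / 2) + card T * (- (3/4 * \<mu>)) = - (card T / (8 * \<kappa>\<^sup>2))"
    by (simp add: \<mu>_def field_simps)
  finally show ?thesis .
qed

section \<open>A fixed vector is rarely mapped to a short one\<close>

text \<open>Eliminates the uncontrolled shift \<open>c\<close>: the right side depends on the
  difference of the two translates only.\<close>

lemma exp_two_translates_le:
  fixes c h h' :: complex
  assumes "0 \<le> \<nu>"
  shows "exp (- \<nu> * (cmod (c + h))\<^sup>2) + exp (- \<nu> * (cmod (c + h'))\<^sup>2)
    \<le> 1 + exp (- (\<nu> / 4) * (cmod (h - h'))\<^sup>2)"
proof -
  have "cmod (h - h') \<le> cmod (c + h) + cmod (c + h')"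
    using norm_triangle_ineq4[of "c + h" "c + h'"] by simp
  then consider "cmod (h - h') / 2 \<le> cmod (c + h)" | "cmod (h - h') / 2 \<le> cmod (c + h')" by linarith
  then show ?thesis
  proof cases
    case 1
    then have "(cmod (h - h') / 2)\<^sup>2 \<le> (cmod (c + h))\<^sup>2" by (intro power_mono) auto
    then have "\<nu> * (cmod (h - h') / 2)\<^sup>2 \<le> \<nu> * (cmod (c + h))\<^sup>2" using assms by (rule mult_left_mono)
    then have "exp (- \<nu> * (cmod (c + h))\<^sup>2) \<le> exp (- (\<nu> / 4) * (cmod (h - h'))\<^sup>2)"
      by (simp add: power_divide)
    moreover have "exp (- \<nu> * (cmod (c + h'))\<^sup>2) \<le> 1" using assms by simp
    ultimately show ?thesis by linarith
  next
    case 2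
    then have "(cmod (h - h') / 2)\<^sup>2 \<le> (cmod (c + h'))\<^sup>2" by (intro power_mono) auto
    then have "\<nu> * (cmod (h - h') / 2)\<^sup>2 \<le> \<nu> * (cmod (c + h'))\<^sup>2" using assms by (rule mult_left_mono)
    then have "exp (- \<nu> * (cmod (c + h'))\<^sup>2) \<le> exp (- (\<nu> / 4) * (cmod (h - h'))\<^sup>2)"
      by (simp add: power_divide)
    moreover have "exp (- \<nu> * (cmod (c + h))\<^sup>2) \<le> 1" using assms by simp
    ultimately show ?thesis by linarith
  qed
qed

lemma permutes_swap_lines:
  assumes "j \<in> L" "j' \<in> L"
  shows "(\<lambda>e. if e \<in> I \<times> L then (fst e, Transposition.transpose j j' (snd e)) else e) permutes (I \<times> L)"
    (is "?\<omega> permutes _")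
proof (rule bij_imp_permutes)
  have map: "?\<omega> e \<in> I \<times> L" if "e \<in> I \<times> L" for e
    using that assms by (auto simp: Transposition.transpose_def)
  show "bij_betw ?\<omega> (I \<times> L) (I \<times> L)"
    by (rule bij_betw_byWitness[where f' = ?\<omega>]) (use map assms in \<open>auto simp: Transposition.transpose_def\<close>)
qed auto

lemma abs_diff_square_le:
  fixes a b K :: real
  assumes "\<bar>a\<bar> \<le> K" "\<bar>b\<bar> \<le> K"
  shows "(a - b)\<^sup>2 \<le> 4 * K\<^sup>2"
proof -
  have "\<bar>a - b\<bar> \<le> 2 * K" using assms by linarith
  then have "\<bar>a - b\<bar>\<^sup>2 \<le> (2 * K)\<^sup>2" by (intro power_mono) auto
  then show ?thesis by (simp add: power_mult_distrib)
qed

context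
  fixes I :: "'i set" and x :: "'i \<times> 'i \<Rightarrow> real" and K :: real
  assumes finI: "finite I" and sum0: "(\<Sum>e\<in>I \<times> I. x e) = 0"
    and var: "(\<Sum>e\<in>I \<times> I. (x e)\<^sup>2) = card (I \<times> I)"
    and bd: "\<And>e. e \<in> I \<times> I \<Longrightarrow> \<bar>x e\<bar> \<le> K" and K: "1 \<le> K"
begin

text \<open>The pairs \<open>(i, j)\<close>, \<open>(i, j')\<close> are disjoint and unrevealed, so
  each can be swapped by itself. Coefficients are real; the line step uses the lemma once for real
  and once for imaginary parts.\<close>

lemma line_difference_moments:
  fixes a :: "'i \<Rightarrow> real" and \<Phi> :: "('i \<times> 'i \<Rightarrow> 'i \<times> 'i) \<Rightarrow> real"
  assumes J: "J \<subseteq> I" "4 * card J \<le> card I"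
    and j: "j \<in> I - J" "j' \<in> I - J" "j \<noteq> j'"
    and \<Phi>nn: "\<And>p. p permutes (I \<times> I) \<Longrightarrow> 0 \<le> \<Phi> p"
    and supp: "\<And>p. p permutes (I \<times> I) \<Longrightarrow> \<Phi> p \<noteq> 0 \<Longrightarrow>
      (\<Sum>e\<in>I \<times> J. (x (p e))\<^sup>2) \<le> 3/8 * card (I \<times> I)"
    and inv: "\<And>p \<tau>. p permutes (I \<times> I) \<Longrightarrow> \<tau> permutes (I \<times> I - I \<times> J) \<Longrightarrow> \<Phi> (p \<circ> \<tau>) = \<Phi> p"
  defines "S \<equiv> \<lambda>p. \<Sum>i\<in>I. a i * (x (p (i, j)) - x (p (i, j')))"
    and "Q \<equiv> \<lambda>p. \<Sum>i\<in>I. (a i)\<^sup>2 * (x (p (i, j)) - x (p (i, j')))\<^sup>2"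
  shows "perm_avg (I \<times> I) (\<lambda>p. \<Phi> p * (S p)\<^sup>2) = perm_avg (I \<times> I) (\<lambda>p. \<Phi> p * Q p)"
    and "perm_avg (I \<times> I) (\<lambda>p. \<Phi> p * S p ^ 4) \<le> 3 * perm_avg (I \<times> I) (\<lambda>p. \<Phi> p * (Q p)\<^sup>2)"
    and "3/4 * (\<Sum>i\<in>I. (a i)\<^sup>2) * perm_avg (I \<times> I) \<Phi> \<le> perm_avg (I \<times> I) (\<lambda>p. \<Phi> p * Q p)"
proof -
  let ?E = "I \<times> I"
  have finE: "finite ?E" using finI by simp
  have swap_inv: "\<Phi> (p \<circ> Transposition.transpose (i, j) (i, j')) = \<Phi> p" if "p permutes ?E" "i \<in> I" for p i
    using that j by (intro inv permutes_swap_id) auto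
  show "perm_avg ?E (\<lambda>p. \<Phi> p * (S p)\<^sup>2) = perm_avg ?E (\<lambda>p. \<Phi> p * Q p)"
    unfolding S_def Q_def using j
    by (intro perm_avg_sum_square[where e = "\<lambda>i. (i, j)" and e' = "\<lambda>i. (i, j')"] finI swap_inv) auto
  show "perm_avg ?E (\<lambda>p. \<Phi> p * S p ^ 4) \<le> 3 * perm_avg ?E (\<lambda>p. \<Phi> p * (Q p)\<^sup>2)"
    unfolding S_def Q_def using j
    by (intro perm_avg_sum_fourth_power[where e = "\<lambda>i. (i, j)" and e' = "\<lambda>i. (i, j')"] finI swap_inv \<Phi>nn) auto
  have each: "3/4 * 1 * perm_avg ?E \<Phi> \<le> perm_avg ?E (\<lambda>p. \<Phi> p * (x (p (i, j)) - x (p (i, j')))\<^sup>2)"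
    if i: "i \<in> I" for i
    by (rule perm_avg_diff_square_ge[where T = "I \<times> J"])
       (use finE sum0 var J j i \<Phi>nn inv supp in \<open>auto simp: card_cartesian_product\<close>)
  have "3/4 * (\<Sum>i\<in>I. (a i)\<^sup>2) * perm_avg ?E \<Phi> = (\<Sum>i\<in>I. (a i)\<^sup>2 * (3/4 * 1 * perm_avg ?E \<Phi>))"
    by (simp add: sum_distrib_right sum_distrib_left mult_ac)
  also have "\<dots> \<le> (\<Sum>i\<in>I. (a i)\<^sup>2 * perm_avg ?E (\<lambda>p. \<Phi> p * (x (p (i, j)) - x (p (i, j')))\<^sup>2))"
    by (intro sum_mono mult_left_mono each) auto
  also have "\<dots> = perm_avg ?E (\<lambda>p. \<Phi> p * Q p)"
    unfolding Q_def sum_distrib_left perm_avg_sum perm_avg_cmult[symmetric]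
    by (intro sum.cong refl perm_avg_cong) (simp add: mult_ac)
  finally show "3/4 * (\<Sum>i\<in>I. (a i)\<^sup>2) * perm_avg ?E \<Phi> \<le> perm_avg ?E (\<lambda>p. \<Phi> p * Q p)" .
qed

text \<open>The whole line \<open>j\<close> is swapped with the unrevealed line \<open>j'\<close>. One of the two translates of \<open>c\<close> is at
  least half the distance of the two inner products, and the moments of that distance come from
  swapping single entries of the two lines.\<close>

lemma perm_avg_line_step:
  fixes y :: "'i \<Rightarrow> complex" and c :: complex and \<Phi> :: "('i \<times> 'i \<Rightarrow> 'i \<times> 'i) \<Rightarrow> real"
  assumes J: "J \<subseteq> I" "4 * card J \<le> card I"
    and j: "j \<in> I - J" "j' \<in> I - J" "j \<noteq> j'"
    and \<Phi>nn: "\<And>p. p permutes (I \<times> I) \<Longrightarrow> 0 \<le> \<Phi> p"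
    and supp: "\<And>p. p permutes (I \<times> I) \<Longrightarrow> \<Phi> p \<noteq> 0 \<Longrightarrow>
      (\<Sum>e\<in>I \<times> J. (x (p e))\<^sup>2) \<le> 3/8 * card (I \<times> I)"
    and inv: "\<And>p \<tau>. p permutes (I \<times> I) \<Longrightarrow> \<tau> permutes (I \<times> I - I \<times> J) \<Longrightarrow> \<Phi> (p \<circ> \<tau>) = \<Phi> p"
    and y: "1/4 \<le> (\<Sum>i\<in>I. (cmod (y i))\<^sup>2)" "(\<Sum>i\<in>I. (cmod (y i))\<^sup>2) \<le> 4"
  shows "perm_avg (I \<times> I) (\<lambda>p. \<Phi> p * exp (- (1 / (24 * K\<^sup>2)) * (cmod (c + (\<Sum>i\<in>I. y i * x (p (i, j)))))\<^sup>2))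
    \<le> (1 - 1 / (2048 * K\<^sup>2)) * perm_avg (I \<times> I) \<Phi>"
proof -
  let ?E = "I \<times> I"
  \<comment> \<open>Chosen so that the quadratic term of the expansion below is half the linear one:
    \<open>\<nu>^2 / 32 * (96 * K^2) = \<nu> / 8\<close>.\<close>
  define \<nu> where "\<nu> = 1 / (24 * K\<^sup>2)"
  have \<nu>0: "0 < \<nu>" using K by (simp add: \<nu>_def)
  define h where "h p k = (\<Sum>i\<in>I. y i * complex_of_real (x (p (i, k))))" for p :: "'i \<times> 'i \<Rightarrow> 'i \<times> 'i" and k
  define A where "A p = (\<Sum>i\<in>I. Re (y i) * (x (p (i, j)) - x (p (i, j'))))" for p
  define B where "B p = (\<Sum>i\<in>I. Im (y i) * (x (p (i, j)) - x (p (i, j'))))" for p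
  define QA where "QA p = (\<Sum>i\<in>I. (Re (y i))\<^sup>2 * (x (p (i, j)) - x (p (i, j')))\<^sup>2)" for p
  define QB where "QB p = (\<Sum>i\<in>I. (Im (y i))\<^sup>2 * (x (p (i, j)) - x (p (i, j')))\<^sup>2)" for p
  define R where "R p = (cmod (h p j - h p j'))\<^sup>2" for p
  have momA: "perm_avg ?E (\<lambda>p. \<Phi> p * (A p)\<^sup>2) = perm_avg ?E (\<lambda>p. \<Phi> p * QA p)"
    "perm_avg ?E (\<lambda>p. \<Phi> p * A p ^ 4) \<le> 3 * perm_avg ?E (\<lambda>p. \<Phi> p * (QA p)\<^sup>2)"
    "3/4 * (\<Sum>i\<in>I. (Re (y i))\<^sup>2) * perm_avg ?E \<Phi> \<le> perm_avg ?E (\<lambda>p. \<Phi> p * QA p)"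
    unfolding A_def QA_def
    by (rule line_difference_moments[where J = J and \<Phi> = \<Phi>, OF J j \<Phi>nn supp inv]; assumption)+
  have momB: "perm_avg ?E (\<lambda>p. \<Phi> p * (B p)\<^sup>2) = perm_avg ?E (\<lambda>p. \<Phi> p * QB p)"
    "perm_avg ?E (\<lambda>p. \<Phi> p * B p ^ 4) \<le> 3 * perm_avg ?E (\<lambda>p. \<Phi> p * (QB p)\<^sup>2)"
    "3/4 * (\<Sum>i\<in>I. (Im (y i))\<^sup>2) * perm_avg ?E \<Phi> \<le> perm_avg ?E (\<lambda>p. \<Phi> p * QB p)"
    unfolding B_def QB_def
    by (rule line_difference_moments[where J = J and \<Phi> = \<Phi>, OF J j \<Phi>nn supp inv]; assumption)+
  have R: "R p = (A p)\<^sup>2 + (B p)\<^sup>2" for p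
    unfolding R_def cmod_power2 h_def A_def B_def sum_subtractf[symmetric]
    by (simp add: Re_sum Im_sum right_diff_distrib)
  have QAB: "QA p + QB p = (\<Sum>i\<in>I. (cmod (y i))\<^sup>2 * (x (p (i, j)) - x (p (i, j')))\<^sup>2)" for p
    unfolding QA_def QB_def sum.distrib[symmetric] cmod_power2 by (simp add: distrib_right)
  have Qnn: "0 \<le> QA p" "0 \<le> QB p" for p unfolding QA_def QB_def by (auto intro: sum_nonneg)
  have Qle: "QA p + QB p \<le> 16 * K\<^sup>2" if p: "p permutes ?E" for p
  proof -
    have "(\<Sum>i\<in>I. (cmod (y i))\<^sup>2 * (x (p (i, j)) - x (p (i, j')))\<^sup>2) \<le> (\<Sum>i\<in>I. (cmod (y i))\<^sup>2 * (4 * K\<^sup>2))"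
      using j permutes_in_image[OF p] by (intro sum_mono mult_left_mono abs_diff_square_le bd) auto
    also have "\<dots> \<le> 4 * (4 * K\<^sup>2)"
      unfolding sum_distrib_right[symmetric] using y by (intro mult_right_mono) auto
    finally show ?thesis unfolding QAB by simp
  qed
  define \<Gamma> where "\<Gamma> = perm_avg ?E (\<lambda>p. \<Phi> p * (QA p + QB p))"
  have ER: "perm_avg ?E (\<lambda>p. \<Phi> p * R p) = \<Gamma>"
    by (simp only: R \<Gamma>_def distrib_left perm_avg_add momA(1) momB(1))
  have ER2: "perm_avg ?E (\<lambda>p. \<Phi> p * (R p)\<^sup>2) \<le> 96 * K\<^sup>2 * \<Gamma>"
  proof -
    have "perm_avg ?E (\<lambda>p. \<Phi> p * (R p)\<^sup>2) \<le> perm_avg ?E (\<lambda>p. 2 * (\<Phi> p * A p ^ 4) + 2 * (\<Phi> p * B p ^ 4))"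
    proof (rule perm_avg_mono)
      fix p assume p: "p permutes ?E"
      have "(R p)\<^sup>2 \<le> 2 * A p ^ 4 + 2 * B p ^ 4"
      proof -
        have "0 \<le> ((A p)\<^sup>2 - (B p)\<^sup>2)\<^sup>2" by simp
        then show ?thesis unfolding R by (simp add: power2_eq_square power4_eq_xxxx algebra_simps)
      qed
      then have "\<Phi> p * (R p)\<^sup>2 \<le> \<Phi> p * (2 * A p ^ 4 + 2 * B p ^ 4)" using \<Phi>nn[OF p] by (rule mult_left_mono)
      then show "\<Phi> p * (R p)\<^sup>2 \<le> 2 * (\<Phi> p * A p ^ 4) + 2 * (\<Phi> p * B p ^ 4)" by (simp add: algebra_simps)
    qed
    also have "\<dots> = 2 * perm_avg ?E (\<lambda>p. \<Phi> p * A p ^ 4) + 2 * perm_avg ?E (\<lambda>p. \<Phi> p * B p ^ 4)"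
      by (simp only: perm_avg_add perm_avg_cmult)
    also have "\<dots> \<le> 2 * (3 * perm_avg ?E (\<lambda>p. \<Phi> p * (QA p)\<^sup>2)) + 2 * (3 * perm_avg ?E (\<lambda>p. \<Phi> p * (QB p)\<^sup>2))"
      using momA(2) momB(2) by linarith
    also have "\<dots> = perm_avg ?E (\<lambda>p. 6 * (\<Phi> p * (QA p)\<^sup>2) + 6 * (\<Phi> p * (QB p)\<^sup>2))"
      by (simp only: perm_avg_add perm_avg_cmult)
    also have "\<dots> \<le> perm_avg ?E (\<lambda>p. 96 * K\<^sup>2 * (\<Phi> p * (QA p + QB p)))"
    proof (rule perm_avg_mono)
      fix p assume p: "p permutes ?E"
      have "(QA p)\<^sup>2 + (QB p)\<^sup>2 \<le> (QA p + QB p)\<^sup>2" using Qnn[of p] by (simp add: power2_sum)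
      also have "\<dots> \<le> (16 * K\<^sup>2) * (QA p + QB p)"
        unfolding power2_eq_square[of "QA p + QB p"] using Qle[OF p] Qnn[of p] by (intro mult_right_mono) auto
      finally have "6 * \<Phi> p * ((QA p)\<^sup>2 + (QB p)\<^sup>2) \<le> 6 * \<Phi> p * ((16 * K\<^sup>2) * (QA p + QB p))"
        using \<Phi>nn[OF p] by (intro mult_left_mono) auto
      then show "6 * (\<Phi> p * (QA p)\<^sup>2) + 6 * (\<Phi> p * (QB p)\<^sup>2) \<le> 96 * K\<^sup>2 * (\<Phi> p * (QA p + QB p))"
        by (simp add: algebra_simps)
    qed
    finally show ?thesis by (simp only: perm_avg_cmult \<Gamma>_def)
  qed
  have \<Gamma>_ge: "3/16 * perm_avg ?E \<Phi> \<le> \<Gamma>"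
  proof -
    have "3/16 * perm_avg ?E \<Phi> \<le> 3/4 * (\<Sum>i\<in>I. (cmod (y i))\<^sup>2) * perm_avg ?E \<Phi>"
      using y(1) by (intro mult_right_mono perm_avg_nonneg \<Phi>nn) auto
    also have "\<dots> = 3/4 * (\<Sum>i\<in>I. (Re (y i))\<^sup>2) * perm_avg ?E \<Phi> + 3/4 * (\<Sum>i\<in>I. (Im (y i))\<^sup>2) * perm_avg ?E \<Phi>"
      unfolding cmod_power2 sum.distrib by (simp add: algebra_simps)
    also have "\<dots> \<le> \<Gamma>"
      unfolding \<Gamma>_def distrib_left perm_avg_add by (rule add_mono[OF momA(3) momB(3)])
    finally show ?thesis .
  qed
  define \<omega> where "\<omega> = (\<lambda>e. if e \<in> I \<times> (I - J) then (fst e, Transposition.transpose j j' (snd e)) else e)"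
  have \<omega>: "\<omega> permutes (I \<times> I - I \<times> J)"
    using permutes_swap_lines[of j "I - J" j' I] j
    by (simp add: \<omega>_def Times_Diff_distrib1 Sigma_Diff_distrib2)
  have \<omega>E: "\<omega> permutes ?E" using \<omega> by (rule permutes_subset) auto
  define F where "F k p = \<Phi> p * exp (- \<nu> * (cmod (c + h p k))\<^sup>2)" for k p
  have "perm_avg ?E (F j) = perm_avg ?E (F j')"
  proof -
    have "h (p \<circ> \<omega>) j = h p j'" for p
      unfolding h_def by (intro sum.cong refl) (use j in \<open>auto simp: \<omega>_def\<close>)
    then have "perm_avg ?E (\<lambda>p. F j (p \<circ> \<omega>)) = perm_avg ?E (F j')"
      by (intro perm_avg_cong) (simp add: F_def inv[OF _ \<omega>])
    then show ?thesis by (simp add: perm_avg_compose[OF \<omega>E])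
  qed
  then have "2 * perm_avg ?E (F j) = perm_avg ?E (\<lambda>p. F j p + F j' p)"
    by (simp add: perm_avg_add)
  also have "\<dots> \<le> perm_avg ?E (\<lambda>p. 2 * \<Phi> p - (\<nu>/4) * (\<Phi> p * R p) + (\<nu>\<^sup>2 / 32) * (\<Phi> p * (R p)\<^sup>2))"
  proof (rule perm_avg_mono)
    fix p assume p: "p permutes ?E"
    have "exp (- \<nu> * (cmod (c + h p j))\<^sup>2) + exp (- \<nu> * (cmod (c + h p j'))\<^sup>2)
        \<le> 1 + exp (- (\<nu> / 4) * R p)"
      unfolding R_def using \<nu>0 by (intro exp_two_translates_le) simp
    also have "exp (- (\<nu> / 4) * R p) \<le> 1 - (\<nu> / 4) * R p + ((\<nu> / 4) * R p)\<^sup>2 / 2"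
      using exp_minus_le[of "(\<nu> / 4) * R p"] \<nu>0 by (simp add: R_def)
    finally have "exp (- \<nu> * (cmod (c + h p j))\<^sup>2) + exp (- \<nu> * (cmod (c + h p j'))\<^sup>2)
        \<le> 2 - (\<nu> / 4) * R p + (\<nu>\<^sup>2 / 32) * (R p)\<^sup>2"
      by (simp add: power_mult_distrib power_divide)
    then have "\<Phi> p * (exp (- \<nu> * (cmod (c + h p j))\<^sup>2) + exp (- \<nu> * (cmod (c + h p j'))\<^sup>2))
       \<le> \<Phi> p * (2 - (\<nu> / 4) * R p + (\<nu>\<^sup>2 / 32) * (R p)\<^sup>2)"
      using \<Phi>nn[OF p] by (rule mult_left_mono)
    then show "F j p + F j' p \<le> 2 * \<Phi> p - (\<nu>/4) * (\<Phi> p * R p) + (\<nu>\<^sup>2 / 32) * (\<Phi> p * (R p)\<^sup>2)"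
      by (simp add: F_def algebra_simps)
  qed
  also have "\<dots> = 2 * perm_avg ?E \<Phi> - (\<nu>/4) * \<Gamma> + (\<nu>\<^sup>2 / 32) * perm_avg ?E (\<lambda>p. \<Phi> p * (R p)\<^sup>2)"
    by (simp only: perm_avg_add perm_avg_diff perm_avg_cmult ER)
  also have "\<dots> \<le> 2 * perm_avg ?E \<Phi> - (\<nu>/4) * \<Gamma> + (\<nu>\<^sup>2 / 32) * (96 * K\<^sup>2 * \<Gamma>)"
    using ER2 by (intro add_left_mono mult_left_mono) auto
  also have "(\<nu>\<^sup>2 / 32) * (96 * K\<^sup>2 * \<Gamma>) = (\<nu> / 8) * \<Gamma>"
    using K by (simp add: \<nu>_def power2_eq_square)
  also have "2 * perm_avg ?E \<Phi> - (\<nu>/4) * \<Gamma> + (\<nu>/8) * \<Gamma> = 2 * perm_avg ?E \<Phi> - (\<nu>/8) * \<Gamma>" by simp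
  also have "\<dots> \<le> 2 * perm_avg ?E \<Phi> - (\<nu>/8) * (3/16 * perm_avg ?E \<Phi>)"
    using \<Gamma>_ge \<nu>0 by (intro diff_left_mono mult_left_mono) auto
  \<comment> \<open>Half of \<open>\<nu> / 8 * 3/16\<close> equals \<open>1 / (2048 * K^2)\<close>;
    the factor 3/16 is 3/4 from the unrevealed variance times 1/4 from the norm of
    \<open>y\<close>.\<close>
  also have "\<dots> = 2 * ((1 - 1 / (2048 * K\<^sup>2)) * perm_avg ?E \<Phi>)"
    by (simp add: \<nu>_def left_diff_distrib)
  finally show ?thesis unfolding F_def h_def \<nu>_def by simp
qed

text \<open>Lines are revealed one at a time. The variance indicator for more lines is at most the
  one for fewer, so it passes to the lines already revealed, where it supplies the support condition
  of the line step. As \<open>J\<close> is at most a quarter of \<open>I\<close>, a partner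
  \<open>j'\<close> is always left. The free shifts \<open>c j\<close> will absorb the diagonal
  term.\<close>

lemma perm_avg_exp_lines_le:
  fixes y c :: "'i \<Rightarrow> complex"
  assumes J: "J \<subseteq> I" "4 * card J \<le> card I"
    and y: "1/4 \<le> (\<Sum>i\<in>I. (cmod (y i))\<^sup>2)" "(\<Sum>i\<in>I. (cmod (y i))\<^sup>2) \<le> 4"
  shows "perm_avg (I \<times> I) (\<lambda>p. of_bool ((\<Sum>e\<in>I \<times> J. (x (p e))\<^sup>2) \<le> 3/8 * card (I \<times> I)) *
      exp (- (1 / (24 * K\<^sup>2)) * (\<Sum>j\<in>J. (cmod (c j + (\<Sum>i\<in>I. y i * x (p (i, j)))))\<^sup>2)))
    \<le> (1 - 1 / (2048 * K\<^sup>2)) ^ card J"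
proof -
  have "finite J" using J finI by (auto intro: finite_subset)
  then show ?thesis using J
  proof (induction J rule: finite_induct)
    case empty
    then show ?case using finI by (intro perm_avg_le_const) auto
  next
    case (insert j J)
    let ?E = "I \<times> I"
    define \<Phi> where "\<Phi> p = of_bool ((\<Sum>e\<in>I \<times> J. (x (p e))\<^sup>2) \<le> 3/8 * card ?E) *
      exp (- (1 / (24 * K\<^sup>2)) * (\<Sum>j\<in>J. (cmod (c j + (\<Sum>i\<in>I. y i * x (p (i, j)))))\<^sup>2))" for p
    have fin: "finite J" "j \<notin> J" by fact+
    have card: "card (insert j J) = Suc (card J)" using fin by simp
    have "card (insert j J) < card I" using insert.prems(2) card by linarith
    then obtain j' where j': "j' \<in> I - insert j J"
      by (metis card_mono DiffI finI fin(1) finite_insert not_less subsetI)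
    have "perm_avg ?E (\<lambda>p. of_bool ((\<Sum>e\<in>I \<times> insert j J. (x (p e))\<^sup>2) \<le> 3/8 * card ?E) *
      exp (- (1 / (24 * K\<^sup>2)) * (\<Sum>j\<in>insert j J. (cmod (c j + (\<Sum>i\<in>I. y i * x (p (i, j)))))\<^sup>2)))
      \<le> perm_avg ?E (\<lambda>p. \<Phi> p * exp (- (1 / (24 * K\<^sup>2)) * (cmod (c j + (\<Sum>i\<in>I. y i * x (p (i, j)))))\<^sup>2))"
    proof (rule perm_avg_mono)
      fix p
      have "(\<Sum>e\<in>I \<times> J. (x (p e))\<^sup>2) \<le> (\<Sum>e\<in>I \<times> insert j J. (x (p e))\<^sup>2)"
        using fin finI by (intro sum_mono2) auto
      then show "of_bool ((\<Sum>e\<in>I \<times> insert j J. (x (p e))\<^sup>2) \<le> 3/8 * card ?E) *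
        exp (- (1 / (24 * K\<^sup>2)) * (\<Sum>j\<in>insert j J. (cmod (c j + (\<Sum>i\<in>I. y i * x (p (i, j)))))\<^sup>2))
        \<le> \<Phi> p * exp (- (1 / (24 * K\<^sup>2)) * (cmod (c j + (\<Sum>i\<in>I. y i * x (p (i, j)))))\<^sup>2)"
        using fin by (auto simp: \<Phi>_def exp_add[symmetric] algebra_simps)
    qed
    also have "\<dots> \<le> (1 - 1 / (2048 * K\<^sup>2)) * perm_avg ?E \<Phi>"
    proof (rule perm_avg_line_step[where J = J and j' = j'])
      fix p \<tau> assume "p permutes ?E" and \<tau>: "\<tau> permutes (?E - I \<times> J)"
      have fixed: "\<tau> e = e" if "e \<in> I \<times> J" for e using \<tau> that by (auto intro: permutes_not_in)
      show "\<Phi> (p \<circ> \<tau>) = \<Phi> p" unfolding \<Phi>_def using fixed by simp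
    qed (use insert.prems insert.hyps j' y card in \<open>auto simp: \<Phi>_def split: if_splits\<close>)
    also have "\<dots> \<le> (1 - 1 / (2048 * K\<^sup>2)) * (1 - 1 / (2048 * K\<^sup>2)) ^ card J"
    proof (rule mult_left_mono)
      show "perm_avg ?E \<Phi> \<le> (1 - 1 / (2048 * K\<^sup>2)) ^ card J"
        unfolding \<Phi>_def using insert.prems card by (intro insert.IH) auto
      have "1 \<le> K\<^sup>2" using K by simp
      then show "0 \<le> 1 - 1 / (2048 * K\<^sup>2)" by (simp add: divide_le_eq)
    qed
    finally show ?case using card by simp
  qed
qed

lemma perm_avg_small_lines_le:
  fixes y c :: "'i \<Rightarrow> complex"
  assumes J: "J \<subseteq> I" "4 * card J \<le> card I"
    and y: "1/4 \<le> (\<Sum>i\<in>I. (cmod (y i))\<^sup>2)" "(\<Sum>i\<in>I. (cmod (y i))\<^sup>2) \<le> 4"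
  shows "perm_avg (I \<times> I) (\<lambda>p. of_bool ((\<Sum>e\<in>I \<times> J. (x (p e))\<^sup>2) \<le> 3/8 * card (I \<times> I) \<and>
      (\<Sum>j\<in>J. (cmod (c j + (\<Sum>i\<in>I. y i * x (p (i, j)))))\<^sup>2) \<le> card J / 180))
    \<le> exp (- (card J / (4000 * K\<^sup>2)))"
proof -
  let ?E = "I \<times> I"
  define \<nu> where "\<nu> = 1 / (24 * K\<^sup>2)"
  define m where "m = real (card J)"
  define G where "G p \<longleftrightarrow> (\<Sum>e\<in>I \<times> J. (x (p e))\<^sup>2) \<le> 3/8 * card ?E" for p
  define Z where "Z p = (\<Sum>j\<in>J. (cmod (c j + (\<Sum>i\<in>I. y i * x (p (i, j)))))\<^sup>2)" for p
  have K2: "1 \<le> K\<^sup>2" using K by simp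
  have "perm_avg ?E (\<lambda>p. of_bool (G p \<and> Z p \<le> m / 180))
      \<le> perm_avg ?E (\<lambda>p. exp (\<nu> * (m / 180)) * (of_bool (G p) * exp (- \<nu> * Z p)))"
  proof (rule perm_avg_mono)
    fix p
    have "1 \<le> exp (\<nu> * (m / 180)) * exp (- \<nu> * Z p)" if "Z p \<le> m / 180"
    proof -
      have "\<nu> * Z p \<le> \<nu> * (m / 180)" using that by (intro mult_left_mono) (auto simp: \<nu>_def)
      then show ?thesis unfolding exp_add[symmetric] by simp
    qed
    then show "of_bool (G p \<and> Z p \<le> m / 180) \<le> exp (\<nu> * (m / 180)) * (of_bool (G p) * exp (- \<nu> * Z p))"
      by auto
  qed
  also have "\<dots> = exp (\<nu> * (m / 180)) * perm_avg ?E (\<lambda>p. of_bool (G p) * exp (- \<nu> * Z p))"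
    by (rule perm_avg_cmult)
  also have "\<dots> \<le> exp (\<nu> * (m / 180)) * (1 - 1 / (2048 * K\<^sup>2)) ^ card J"
    unfolding G_def Z_def \<nu>_def by (intro mult_left_mono perm_avg_exp_lines_le J y) auto
  also have "\<dots> \<le> exp (\<nu> * (m / 180)) * (exp (- (1 / (2048 * K\<^sup>2)))) ^ card J"
  proof (intro mult_left_mono power_mono)
    show "1 - 1 / (2048 * K\<^sup>2) \<le> exp (- (1 / (2048 * K\<^sup>2)))"
      using exp_ge_add_one_self[of "- (1 / (2048 * K\<^sup>2))"] by simp
  qed (use K2 in \<open>auto simp: divide_le_eq\<close>)
  also have "\<dots> = exp (\<nu> * (m / 180) + m * (- (1 / (2048 * K\<^sup>2))))"
    unfolding exp_of_nat_mult[symmetric] exp_add[symmetric] m_def ..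
  also have "\<dots> \<le> exp (- (m / (4000 * K\<^sup>2)))"
  proof -
    \<comment> \<open>The threshold 180 makes the loss \<open>\<nu> / 180 = 1 / (4320 * K^2)\<close>
      small enough for the gain \<open>1 / (2048 * K^2)\<close> to exceed it by
      \<open>1 / (4000 * K^2)\<close>.\<close>
    have "\<nu> * (m / 180) + m * (- (1 / (2048 * K\<^sup>2))) = (m / K\<^sup>2) * (1 / 4320 - 1 / 2048)"
      using K by (simp add: \<nu>_def field_simps)
    also have "\<dots> \<le> (m / K\<^sup>2) * (- (1 / 4000))" by (intro mult_left_mono) (auto simp: m_def)
    finally show ?thesis by simp
  qed
  finally show ?thesis unfolding G_def Z_def m_def .
qed

end

section \<open>The operator norm\<close>

text \<open>For positive integers the square dominates the integer itself, which leaves a geometric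
  series on each side of 0. The bound is uniform in \<open>B\<close>, so box sizes never enter the
  counts.\<close>

lemma sum_exp_neg_square_le:
  fixes t :: real and B :: int
  assumes t: "0 < t"
  shows "(\<Sum>k\<in>{-B..B}. exp (- t * (real_of_int k)\<^sup>2)) \<le> 1 + 2 / t"
proof -
  have geo: "(\<Sum>k<n. exp (- t * real (Suc k))) \<le> 1 / t" for n
  proof -
    define q where "q = exp (- t)"
    have q: "0 < q" "q < 1" using t by (auto simp: q_def)
    have "(\<Sum>k<n. exp (- t * real (Suc k))) = q * (\<Sum>k<n. q ^ k)"
      unfolding sum_distrib_left q_def exp_of_nat_mult[symmetric] exp_add[symmetric]
      by (intro sum.cong refl) (simp add: algebra_simps)
    also have "(\<Sum>k<n. q ^ k) = (1 - q ^ n) / (1 - q)" using q by (simp add: sum_gp_strict)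
    also have "q * \<dots> \<le> q * (1 / (1 - q))" using q by (intro mult_left_mono divide_right_mono) auto
    also have "\<dots> \<le> 1 / t"
    proof -
      have "q * exp t = 1" by (simp add: q_def exp_minus)
      then have "q * (1 + t) \<le> 1"
        using mult_left_mono[OF exp_ge_add_one_self[of t], of q] q by simp
      then show ?thesis using q t by (simp add: field_simps)
    qed
    finally show ?thesis .
  qed
  show ?thesis
  proof (cases "0 \<le> B")
    case False
    then show ?thesis using t by simp
  next
    case True
    define n where "n = nat B"
    have B: "B = int n" using True by (simp add: n_def)
    define f where "f k = exp (- t * (real_of_int k)\<^sup>2)" for k :: int
    have pos: "(\<Sum>k\<in>{1..B}. f k) \<le> 1 / t"
    proof -
      have "(\<Sum>k\<in>{1..B}. f k) = (\<Sum>k<n. f (int (Suc k)))"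
        by (rule sum.reindex_bij_witness[of _ "\<lambda>k. int (Suc k)" "\<lambda>k. nat (k - 1)"]) (auto simp: B)
      also have "\<dots> \<le> (\<Sum>k<n. exp (- t * real (Suc k)))"
      proof (rule sum_mono)
        fix k
        have "real (Suc k) \<le> (real (Suc k))\<^sup>2" by (simp add: power2_eq_square)
        then have "t * real (Suc k) \<le> t * (real (Suc k))\<^sup>2" using t by (intro mult_left_mono) auto
        then show "f (int (Suc k)) \<le> exp (- t * real (Suc k))" by (simp add: f_def)
      qed
      also have "\<dots> \<le> 1 / t" by (rule geo)
      finally show ?thesis .
    qed
    have neg: "(\<Sum>k\<in>{-B..-1}. f k) = (\<Sum>k\<in>{1..B}. f k)"
      by (rule sum.reindex_bij_witness[of _ uminus uminus]) (auto simp: f_def)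
    have "{-B..B} = {-B..-1} \<union> insert 0 {1..B}" using True by auto
    then have "(\<Sum>k\<in>{-B..B}. f k) = (\<Sum>k\<in>{-B..-1}. f k) + (\<Sum>k\<in>insert 0 {1..B}. f k)"
      by (simp add: sum.union_disjoint del: sum.insert)
    also have "\<dots> = f 0 + 2 * (\<Sum>k\<in>{1..B}. f k)" unfolding neg by simp
    also have "\<dots> \<le> 1 + 2 / t" using pos by (simp add: f_def)
    finally show ?thesis by (simp add: f_def)
  qed
qed

text \<open>Lattice points are counted with a product weight, whose sum over the box factorizes.\<close>

lemma card_le_prod_weight:
  fixes w :: "'i \<Rightarrow> 'b \<Rightarrow> real"
  assumes "finite I" "finite A" "F \<subseteq> I \<rightarrow>\<^sub>E A"
    and "\<And>i a. i \<in> I \<Longrightarrow> a \<in> A \<Longrightarrow> 0 \<le> w i a"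
    and "\<And>k. k \<in> F \<Longrightarrow> 1 \<le> C * (\<Prod>i\<in>I. w i (k i))"
    and "\<And>i. i \<in> I \<Longrightarrow> (\<Sum>a\<in>A. w i a) \<le> b" and "0 \<le> C"
  shows "real (card F) \<le> C * b ^ card I"
proof -
  have fin: "finite (I \<rightarrow>\<^sub>E A)" using assms(1,2) by (intro finite_PiE) auto
  have finF: "finite F" using assms(3) fin by (rule finite_subset)
  have "real (card F) = (\<Sum>k\<in>F. 1)" by simp
  also have "\<dots> \<le> (\<Sum>k\<in>F. C * (\<Prod>i\<in>I. w i (k i)))" by (intro sum_mono assms(5))
  also have "\<dots> \<le> (\<Sum>k\<in>I \<rightarrow>\<^sub>E A. C * (\<Prod>i\<in>I. w i (k i)))"
    using assms(3,7) by (intro sum_mono2 fin mult_nonneg_nonneg prod_nonneg ballI assms(4)) (auto dest: PiE_mem)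
  also have "\<dots> = C * (\<Prod>i\<in>I. \<Sum>a\<in>A. w i a)"
    by (simp add: sum_distrib_left[symmetric] prod_sum_PiE assms(1,2))
  also have "\<dots> \<le> C * (\<Prod>i\<in>I. b)"
    using assms by (intro mult_left_mono prod_mono conjI sum_nonneg) auto
  finally show ?thesis by simp
qed

text \<open>With weight \<open>exp (- k^2)\<close> the radius costs \<open>exp (4 * card I)\<close>
  and each coordinate sums to at most 3, which is below exp (3/2); 11/2 is 4 + 3/2.\<close>

lemma card_lattice_ball_le:
  fixes B :: int
  assumes "finite I"
  shows "real (card {k \<in> I \<rightarrow>\<^sub>E {-B..B}. (\<Sum>i\<in>I. (real_of_int (k i))\<^sup>2) \<le> 4 * card I}) \<le> exp (11/2 * card I)"
proof -
  have "real (card {k \<in> I \<rightarrow>\<^sub>E {-B..B}. (\<Sum>i\<in>I. (real_of_int (k i))\<^sup>2) \<le> 4 * card I})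
     \<le> exp (4 * card I) * 3 ^ card I"
  proof (rule card_le_prod_weight[where w = "\<lambda>i k. exp (- 1 * (real_of_int k)\<^sup>2)", OF assms])
    show "(\<Sum>a\<in>{-B..B}. exp (- 1 * (real_of_int a)\<^sup>2)) \<le> 3"
      using sum_exp_neg_square_le[of 1 B] by simp
    fix k assume "k \<in> {k \<in> I \<rightarrow>\<^sub>E {-B..B}. (\<Sum>i\<in>I. (real_of_int (k i))\<^sup>2) \<le> 4 * card I}"
    then show "1 \<le> exp (4 * card I) * (\<Prod>i\<in>I. exp (- 1 * (real_of_int (k i))\<^sup>2))"
      unfolding exp_sum[OF assms, symmetric] exp_add[symmetric] by (simp add: sum_negf)
  qed auto
  also have "(3::real) ^ card I \<le> exp (3/2) ^ card I"
  proof (rule power_mono)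
    have "(7/4) * (7/4) \<le> exp (3/4) * exp (3/4::real)"
      using exp_ge_add_one_self[of "3/4::real"] by (intro mult_mono) auto
    then show "3 \<le> exp (3/2::real)" unfolding exp_add[symmetric] by simp
  qed simp
  then have "exp (4 * card I) * (3::real) ^ card I \<le> exp (4 * card I) * exp (3/2) ^ card I" by simp
  also have "\<dots> = exp (11/2 * card I)"
    unfolding exp_of_nat_mult[symmetric] exp_add[symmetric] by (simp add: algebra_simps)
  finally show ?thesis .
qed

text \<open>Rounding every coordinate in the direction favoured by the linear functional \<open>c\<close> does not decrease it.\<close>

lemma lattice_rounding:
  fixes u c :: "'i \<Rightarrow> real"
  assumes fin: "finite I" and u: "(\<Sum>i\<in>I. (u i)\<^sup>2) \<le> 1"
  obtains k where "k \<in> I \<rightarrow>\<^sub>E {- int (4 * card I)..int (4 * card I)}"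
    "(\<Sum>i\<in>I. (real_of_int (k i))\<^sup>2) \<le> 4 * card I"
    "sqrt (card I) * (\<Sum>i\<in>I. u i * c i) \<le> (\<Sum>i\<in>I. real_of_int (k i) * c i)"
proof -
  define n where "n = card I"
  define f where "f i = (if 0 \<le> c i then \<lceil>sqrt n * u i\<rceil> else \<lfloor>sqrt n * u i\<rfloor>)" for i
  define k where "k = restrict f I"
  have sq: "(\<Sum>i\<in>I. (real_of_int (f i))\<^sup>2) \<le> 4 * n"
  proof -
    have "(\<Sum>i\<in>I. (real_of_int (f i))\<^sup>2) \<le> (\<Sum>i\<in>I. 2 * (n * (u i)\<^sup>2) + 2)"
    proof (rule sum_mono)
      fix i
      define d where "d = real_of_int (f i) - sqrt n * u i"
      have d: "\<bar>d\<bar> \<le> 1" unfolding d_def f_def by (auto; linarith)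
      then have "d\<^sup>2 \<le> 1" by (simp add: abs_square_le_1)
      moreover have "0 \<le> (sqrt n * u i - d)\<^sup>2" by simp
      moreover have "real_of_int (f i) = sqrt n * u i + d" by (simp add: d_def)
      moreover have "(sqrt n * u i)\<^sup>2 = n * (u i)\<^sup>2" by (simp add: power_mult_distrib)
      ultimately show "(real_of_int (f i))\<^sup>2 \<le> 2 * (n * (u i)\<^sup>2) + 2"
        by (simp add: power2_sum power2_diff)
    qed
    also have "\<dots> = 2 * (n * (\<Sum>i\<in>I. (u i)\<^sup>2)) + 2 * n"
      by (simp add: sum.distrib sum_distrib_left n_def)
    also have "\<dots> \<le> 2 * (real n * 1) + real (2 * n)"
      using u by (intro add_right_mono mult_left_mono) auto
    finally show ?thesis by simp
  qed
  \<comment> \<open>An integer is at most its square in modulus, so the ball bound already confines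
    every coordinate to the box.\<close>
  have "\<bar>f i\<bar> \<le> int (4 * n)" if i: "i \<in> I" for i
  proof -
    have "(real_of_int (f i))\<^sup>2 \<le> (\<Sum>i\<in>I. (real_of_int (f i))\<^sup>2)"
      by (rule member_le_sum[OF i]) (auto simp: fin)
    then have "real_of_int ((f i)\<^sup>2) \<le> real_of_int (int (4 * n))" using sq by simp
    then have "(f i)\<^sup>2 \<le> int (4 * n)" by (simp only: of_int_le_iff)
    moreover have "\<bar>f i\<bar> \<le> (f i)\<^sup>2"
      by (metis abs_ge_zero abs_le_square_iff int_one_le_iff_zero_less linorder_not_le mult_left_le_one_le
          mult_le_cancel_left1 order.order_iff_strict power2_abs power2_eq_square zero_less_abs_iff)
    ultimately show ?thesis by linarith
  qed
  then have "k \<in> I \<rightarrow>\<^sub>E {- int (4 * n)..int (4 * n)}" unfolding k_def by (force simp: abs_le_iff)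
  moreover have "(\<Sum>i\<in>I. (real_of_int (k i))\<^sup>2) \<le> 4 * n" using sq by (simp add: k_def)
  moreover have "sqrt n * (\<Sum>i\<in>I. u i * c i) \<le> (\<Sum>i\<in>I. real_of_int (k i) * c i)"
    unfolding sum_distrib_left
  proof (rule sum_mono)
    fix i assume "i \<in> I"
    have "sqrt n * u i * c i \<le> real_of_int (f i) * c i"
      unfolding f_def by (cases "0 \<le> c i") (auto intro: mult_right_mono mult_right_mono_neg)
    then show "sqrt n * (u i * c i) \<le> real_of_int (k i) * c i" using \<open>i \<in> I\<close> by (simp add: k_def)
  qed
  ultimately show ?thesis using that by (simp add: n_def)
qed

lemma perm_avg_bex_le:
  fixes P :: "'k \<Rightarrow> ('a \<Rightarrow> 'a) \<Rightarrow> bool"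
  assumes "finite L"
  shows "perm_avg E (\<lambda>p. of_bool (\<exists>k\<in>L. P k p)) \<le> (\<Sum>k\<in>L. perm_avg E (\<lambda>p. of_bool (P k p) :: real))"
  unfolding perm_avg_sum[symmetric]
proof (rule perm_avg_mono)
  fix p
  show "of_bool (\<exists>k\<in>L. P k p) \<le> (\<Sum>k\<in>L. of_bool (P k p) :: real)"
  proof (cases "\<exists>k\<in>L. P k p")
    case True
    then obtain k where k: "k \<in> L" "P k p" by auto
    then have "(1::real) \<le> (\<Sum>k\<in>L. of_bool (P k p))"
      using member_le_sum[OF k(1), of "\<lambda>k. of_bool (P k p) :: real"] assms by simp
    then show ?thesis using True by simp
  qed (simp add: sum_nonneg)
qed

definition bilinear_bound :: "'i set \<Rightarrow> ('i \<times> 'i \<Rightarrow> real) \<Rightarrow> real \<Rightarrow> bool" where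
  "bilinear_bound I X H \<longleftrightarrow> (\<forall>u v. (\<Sum>i\<in>I. (u i)\<^sup>2) \<le> 1 \<longrightarrow> (\<Sum>j\<in>I. (v j)\<^sup>2) \<le> 1 \<longrightarrow>
     (\<Sum>i\<in>I. \<Sum>j\<in>I. u i * v j * X (i, j)) \<le> H)"

text \<open>First \<open>u\<close> is rounded with \<open>v\<close> fixed, then \<open>v\<close>
  against the rounded \<open>u\<close>. Rounding never decreases the form, so no approximation error
  arises and each step contributes a factor \<open>sqrt (card I)\<close>.\<close>

lemma bilinear_bound_lattice:
  fixes H :: real
  assumes fin: "finite I" and "\<not> bilinear_bound I X H"
  obtains k l where
    "k \<in> {k \<in> I \<rightarrow>\<^sub>E {- int (4 * card I)..int (4 * card I)}. (\<Sum>i\<in>I. (real_of_int (k i))\<^sup>2) \<le> 4 * card I}"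
    "l \<in> {k \<in> I \<rightarrow>\<^sub>E {- int (4 * card I)..int (4 * card I)}. (\<Sum>i\<in>I. (real_of_int (k i))\<^sup>2) \<le> 4 * card I}"
    "card I * H \<le> (\<Sum>i\<in>I. \<Sum>j\<in>I. real_of_int (k i) * real_of_int (l j) * X (i, j))"
proof -
  obtain u v where u: "(\<Sum>i\<in>I. (u i)\<^sup>2) \<le> 1" and v: "(\<Sum>j\<in>I. (v j)\<^sup>2) \<le> 1"
    and H: "H \<le> (\<Sum>i\<in>I. \<Sum>j\<in>I. u i * v j * X (i, j))"
    using assms(2) unfolding bilinear_bound_def by (auto simp: not_le intro: less_imp_le)
  obtain k where k: "k \<in> I \<rightarrow>\<^sub>E {- int (4 * card I)..int (4 * card I)}"
    "(\<Sum>i\<in>I. (real_of_int (k i))\<^sup>2) \<le> 4 * card I"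
    "sqrt (card I) * (\<Sum>i\<in>I. u i * (\<Sum>j\<in>I. v j * X (i, j))) \<le> (\<Sum>i\<in>I. real_of_int (k i) * (\<Sum>j\<in>I. v j * X (i, j)))"
    using lattice_rounding[OF fin u, of "\<lambda>i. \<Sum>j\<in>I. v j * X (i, j)"] .
  obtain l where l: "l \<in> I \<rightarrow>\<^sub>E {- int (4 * card I)..int (4 * card I)}"
    "(\<Sum>i\<in>I. (real_of_int (l i))\<^sup>2) \<le> 4 * card I"
    "sqrt (card I) * (\<Sum>j\<in>I. v j * (\<Sum>i\<in>I. real_of_int (k i) * X (i, j)))
      \<le> (\<Sum>j\<in>I. real_of_int (l j) * (\<Sum>i\<in>I. real_of_int (k i) * X (i, j)))"
    using lattice_rounding[OF fin v, of "\<lambda>j. \<Sum>i\<in>I. real_of_int (k i) * X (i, j)"] .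
  have swap: "(\<Sum>j\<in>I. b j * (\<Sum>i\<in>I. a i * X (i, j))) = (\<Sum>i\<in>I. a i * (\<Sum>j\<in>I. b j * X (i, j)))"
    for a b :: "'a \<Rightarrow> real"
    unfolding sum_distrib_left by (subst sum.swap) (simp add: mult_ac)
  have flat: "(\<Sum>i\<in>I. a i * (\<Sum>j\<in>I. b j * X (i, j))) = (\<Sum>i\<in>I. \<Sum>j\<in>I. a i * b j * X (i, j))"
    for a b :: "'a \<Rightarrow> real"
    by (simp add: sum_distrib_left mult.assoc)
  have "card I * H = sqrt (card I) * (sqrt (card I) * H)"
    by (simp add: mult.assoc[symmetric])
  also have "\<dots> \<le> sqrt (card I) * (sqrt (card I) * (\<Sum>i\<in>I. u i * (\<Sum>j\<in>I. v j * X (i, j))))"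
    using H unfolding flat by (intro mult_left_mono) auto
  also have "\<dots> \<le> sqrt (card I) * (\<Sum>i\<in>I. real_of_int (k i) * (\<Sum>j\<in>I. v j * X (i, j)))"
    using k(3) by (intro mult_left_mono) auto
  also have "\<dots> \<le> (\<Sum>j\<in>I. real_of_int (l j) * (\<Sum>i\<in>I. real_of_int (k i) * X (i, j)))"
    using l(3) unfolding swap .
  also have "\<dots> = (\<Sum>i\<in>I. \<Sum>j\<in>I. real_of_int (k i) * real_of_int (l j) * X (i, j))"
    unfolding swap flat ..
  finally show ?thesis using that[of k l] k l by simp
qed

text \<open>Exponents in units of \<open>n\<close>: the threshold 56 yields -28, the moment
  generating function +16, the pairs of lattice points 11/2 + 11/2, which leaves -1.\<close>

lemma bilinear_bound_prob:
  fixes I :: "'i set" and x :: "'i \<times> 'i \<Rightarrow> real"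
  assumes finI: "finite I" and sum0: "(\<Sum>e\<in>I \<times> I. x e) = 0"
    and bd: "\<And>e. e \<in> I \<times> I \<Longrightarrow> \<bar>x e\<bar> \<le> K" and K: "0 < K"
  shows "perm_avg (I \<times> I) (\<lambda>p. of_bool (\<not> bilinear_bound I (\<lambda>e. x (p e)) (56 * K * sqrt (card I))))
    \<le> exp (- real (card I))"
proof (cases "I = {}")
  case True
  then show ?thesis by (simp add: perm_avg_le_const)
next
  case False
  let ?E = "I \<times> I"
  define n where "n = card I"
  have n: "0 < n" using False finI by (simp add: n_def card_gt_0_iff)
  define \<Lambda> where "\<Lambda> = {k \<in> I \<rightarrow>\<^sub>E {- int (4 * n)..int (4 * n)}. (\<Sum>i\<in>I. (real_of_int (k i))\<^sup>2) \<le> 4 * n}"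
  define \<mu> where "\<mu> = 1 / (2 * K * sqrt n)"
  have \<mu>: "0 < \<mu>" using K n by (simp add: \<mu>_def)
  have fin\<Lambda>: "finite \<Lambda>" unfolding \<Lambda>_def using finI by (auto intro!: finite_PiE)
  have card\<Lambda>: "real (card \<Lambda>) \<le> exp (11/2 * n)"
    unfolding \<Lambda>_def n_def by (rule card_lattice_ball_le[OF finI])
  define H where "H = 56 * K * sqrt n"
  define Z where "Z kl p = (\<Sum>e\<in>?E. (real_of_int (fst kl (fst e)) * real_of_int (snd kl (snd e))) * x (p e))"
    for kl :: "('i \<Rightarrow> int) \<times> ('i \<Rightarrow> int)" and p :: "'i \<times> 'i \<Rightarrow> 'i \<times> 'i"
  have "perm_avg ?E (\<lambda>p. of_bool (\<not> bilinear_bound I (\<lambda>e. x (p e)) H))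
     \<le> perm_avg ?E (\<lambda>p. of_bool (\<exists>kl\<in>\<Lambda> \<times> \<Lambda>. n * H \<le> Z kl p) :: real)"
  proof (rule perm_avg_mono)
    fix p
    have "\<exists>kl\<in>\<Lambda> \<times> \<Lambda>. n * H \<le> Z kl p" if nb: "\<not> bilinear_bound I (\<lambda>e. x (p e)) H"
    proof -
      obtain k l where "k \<in> \<Lambda>" "l \<in> \<Lambda>"
        "n * H \<le> (\<Sum>i\<in>I. \<Sum>j\<in>I. real_of_int (k i) * real_of_int (l j) * x (p (i, j)))"
        using bilinear_bound_lattice[OF finI nb] unfolding \<Lambda>_def n_def by blast
      then show ?thesis
        by (intro bexI[of _ "(k, l)"]) (auto simp: Z_def sum.cartesian_product case_prod_beta)
    qed
    then show "of_bool (\<not> bilinear_bound I (\<lambda>e. x (p e)) H) \<le> (of_bool (\<exists>kl\<in>\<Lambda> \<times> \<Lambda>. n * H \<le> Z kl p) :: real)"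
      by simp
  qed
  also have "\<dots> \<le> (\<Sum>kl\<in>\<Lambda> \<times> \<Lambda>. perm_avg ?E (\<lambda>p. of_bool (n * H \<le> Z kl p)))"
    using fin\<Lambda> by (intro perm_avg_bex_le) auto
  also have "\<dots> \<le> (\<Sum>kl\<in>\<Lambda> \<times> \<Lambda>. exp (- (12 * real n)))"
  proof (rule sum_mono)
    fix kl assume kl: "kl \<in> \<Lambda> \<times> \<Lambda>"
    define c where "c e = \<mu> * (real_of_int (fst kl (fst e)) * real_of_int (snd kl (snd e)))" for e
    have "perm_avg ?E (\<lambda>p. of_bool (n * H \<le> Z kl p)) \<le> perm_avg ?E (\<lambda>p. exp (\<mu> * (Z kl p - n * H)))"
      using \<mu> by (intro perm_avg_le_exp_moment mult_nonneg_nonneg) auto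
    also have "\<dots> = perm_avg ?E (\<lambda>p. exp (- (\<mu> * (n * H))) * exp (\<Sum>e\<in>?E. c e * x (p e)))"
      unfolding exp_add[symmetric] Z_def c_def by (simp add: right_diff_distrib sum_distrib_left mult.assoc)
    also have "\<dots> = exp (- (\<mu> * (n * H))) * perm_avg ?E (\<lambda>p. exp (\<Sum>e\<in>?E. c e * x (p e)))"
      by (rule perm_avg_cmult)
    also have "\<dots> \<le> exp (- (\<mu> * (n * H))) * exp (4 * K\<^sup>2 * (\<Sum>e\<in>?E. (c e)\<^sup>2))"
      using finI sum0 bd by (intro mult_left_mono perm_avg_exp_le) auto
    also have "\<dots> \<le> exp (- (12 * real n))"
    proof -
      have sq: "(\<Sum>i\<in>I. (real_of_int (fst kl i))\<^sup>2) \<le> 4 * real n" "(\<Sum>i\<in>I. (real_of_int (snd kl i))\<^sup>2) \<le> 4 * real n"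
        using kl by (auto simp: \<Lambda>_def)
      have "(\<Sum>e\<in>?E. (c e)\<^sup>2) = \<mu>\<^sup>2 * ((\<Sum>i\<in>I. (real_of_int (fst kl i))\<^sup>2) * (\<Sum>i\<in>I. (real_of_int (snd kl i))\<^sup>2))"
        unfolding c_def power_mult_distrib sum_product sum.cartesian_product
        by (simp add: case_prod_beta sum_distrib_left)
      also have "\<dots> \<le> \<mu>\<^sup>2 * ((4 * real n) * (4 * real n))"
        using sq by (intro mult_left_mono mult_mono sum_nonneg) auto
      finally have "4 * K\<^sup>2 * (\<Sum>e\<in>?E. (c e)\<^sup>2) \<le> 4 * K\<^sup>2 * (\<mu>\<^sup>2 * ((4 * real n) * (4 * real n)))"
        by (intro mult_left_mono) auto
      also have "\<dots> = 16 * real n" using K n by (simp add: \<mu>_def power_mult_distrib power_divide field_simps power2_eq_square)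
      finally have "4 * K\<^sup>2 * (\<Sum>e\<in>?E. (c e)\<^sup>2) \<le> 16 * real n" .
      moreover have "\<mu> * (n * H) = 28 * real n" using K n by (simp add: \<mu>_def H_def)
      ultimately show ?thesis unfolding exp_add[symmetric] exp_le_cancel_iff by linarith
    qed
    finally show "perm_avg ?E (\<lambda>p. of_bool (n * H \<le> Z kl p)) \<le> exp (- (12 * real n))" .
  qed
  also have "\<dots> = real (card \<Lambda>) * real (card \<Lambda>) * exp (- (12 * real n))"
    by (simp add: card_cartesian_product)
  also have "\<dots> \<le> exp (11/2 * n) * exp (11/2 * n) * exp (- (12 * real n))"
    using card\<Lambda> by (intro mult_right_mono mult_mono) auto
  also have "\<dots> = exp (- real n)" unfolding exp_add[symmetric] by (simp add: algebra_simps)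
  finally show ?thesis by (simp add: n_def H_def)
qed

section \<open>A net for nearly constant vectors\<close>

text \<open>Duality: the normalized image \<open>b\<close> of the vector \<open>a\<close> is the
  test vector that realizes its norm.\<close>

lemma bilinear_bound_real:
  fixes X :: "'i \<times> 'i \<Rightarrow> real"
  assumes fin: "finite I" and bb: "bilinear_bound I X H" and H: "0 \<le> H"
  shows "(\<Sum>j\<in>I. (\<Sum>i\<in>I. a i * X (i, j))\<^sup>2) \<le> H\<^sup>2 * (\<Sum>i\<in>I. (a i)\<^sup>2)"
proof -
  define b where "b j = (\<Sum>i\<in>I. a i * X (i, j))" for j
  define s where "s = sqrt (\<Sum>i\<in>I. (a i)\<^sup>2)"
  define t where "t = sqrt (\<Sum>j\<in>I. (b j)\<^sup>2)"
  have s2: "(\<Sum>i\<in>I. (a i)\<^sup>2) = s\<^sup>2" and t2: "(\<Sum>j\<in>I. (b j)\<^sup>2) = t\<^sup>2"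
    by (simp_all add: s_def t_def sum_nonneg)
  have s0: "0 \<le> s" and t0: "0 \<le> t" by (simp_all add: s_def t_def sum_nonneg)
  have "t \<le> H * s"
  proof (cases "s = 0 \<or> t = 0")
    case True
    have "t = 0" if "s = 0"
    proof -
      have "(\<Sum>i\<in>I. (a i)\<^sup>2) = 0" using s2 that by simp
      then have "a i = 0" if "i \<in> I" for i using that fin by (simp add: sum_nonneg_eq_0_iff)
      then show ?thesis by (simp add: t_def b_def)
    qed
    then have "t = 0" using True by auto
    then show ?thesis using s0 H by simp
  next
    case False
    then have pos: "0 < s" "0 < t" using s0 t0 by auto
    have "(\<Sum>i\<in>I. \<Sum>j\<in>I. (a i / s) * (b j / t) * X (i, j)) \<le> H"
    proof -
      have "(\<Sum>i\<in>I. (a i / s)\<^sup>2) \<le> 1" "(\<Sum>j\<in>I. (b j / t)\<^sup>2) \<le> 1"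
        using pos by (simp_all add: power_divide sum_divide_distrib[symmetric] s2 t2)
      then show ?thesis
        using bb[unfolded bilinear_bound_def, rule_format, of "\<lambda>i. a i / s" "\<lambda>j. b j / t"] by simp
    qed
    also have "(\<Sum>i\<in>I. \<Sum>j\<in>I. (a i / s) * (b j / t) * X (i, j)) = (\<Sum>j\<in>I. (b j)\<^sup>2) / (s * t)"
    proof -
      have "(\<Sum>i\<in>I. \<Sum>j\<in>I. (a i / s) * (b j / t) * X (i, j)) = (\<Sum>j\<in>I. \<Sum>i\<in>I. (b j / (s * t)) * (a i * X (i, j)))"
        by (subst sum.swap) (simp add: mult_ac divide_inverse)
      also have "\<dots> = (\<Sum>j\<in>I. (b j / (s * t)) * b j)"
        by (simp only: sum_distrib_left b_def)
      finally show ?thesis by (simp add: sum_divide_distrib power2_eq_square)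
    qed
    also have "\<dots> = t / s" unfolding t2 using pos by (simp add: power2_eq_square)
    finally show ?thesis using pos by (simp add: divide_le_eq mult.commute)
  qed
  then have "t\<^sup>2 \<le> (H * s)\<^sup>2" using t0 by (rule power_mono)
  then show ?thesis unfolding s2 power_mult_distrib t2[symmetric] b_def .
qed

text \<open>A real matrix acts on real and imaginary parts separately, and the squared norms add
  without loss.\<close>

lemma bilinear_bound_complex:
  fixes X :: "'i \<times> 'i \<Rightarrow> real" and d :: "'i \<Rightarrow> complex"
  assumes fin: "finite I" and bb: "bilinear_bound I X H" and H: "0 \<le> H"
  shows "L2_set (\<lambda>j. cmod (\<Sum>i\<in>I. d i * X (i, j))) I \<le> H * L2_set (\<lambda>i. cmod (d i)) I"
proof -
  have "(\<Sum>j\<in>I. (cmod (\<Sum>i\<in>I. d i * X (i, j)))\<^sup>2)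
     = (\<Sum>j\<in>I. (\<Sum>i\<in>I. Re (d i) * X (i, j))\<^sup>2) + (\<Sum>j\<in>I. (\<Sum>i\<in>I. Im (d i) * X (i, j))\<^sup>2)"
    unfolding cmod_power2 sum.distrib by simp
  also have "\<dots> \<le> H\<^sup>2 * (\<Sum>i\<in>I. (Re (d i))\<^sup>2) + H\<^sup>2 * (\<Sum>i\<in>I. (Im (d i))\<^sup>2)"
    by (intro add_mono bilinear_bound_real[OF fin bb H])
  also have "\<dots> = H\<^sup>2 * (\<Sum>i\<in>I. (cmod (d i))\<^sup>2)"
    by (simp add: cmod_power2 sum.distrib distrib_left)
  finally have "sqrt (\<Sum>j\<in>I. (cmod (\<Sum>i\<in>I. d i * X (i, j)))\<^sup>2) \<le> sqrt (H\<^sup>2 * (\<Sum>i\<in>I. (cmod (d i))\<^sup>2))"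
    by (rule real_sqrt_le_mono)
  then show ?thesis using H by (simp add: L2_set_def real_sqrt_mult)
qed

text \<open>The bound \<open>m\<close> is a real number since it will be a quotient. It may lie
  below 1; then \<open>S\<close> is empty and only closeness to a constant remains.\<close>

definition nearly_constant :: "'i set \<Rightarrow> real \<Rightarrow> real \<Rightarrow> ('i \<Rightarrow> complex) \<Rightarrow> bool" where
  "nearly_constant I m \<rho> v \<longleftrightarrow>
    (\<exists>\<alpha> S. S \<subseteq> I \<and> real (card S) \<le> m \<and> (\<Sum>i\<in>I - S. (cmod (v i - \<alpha>))\<^sup>2) \<le> \<rho>\<^sup>2)"

section \<open>Grids and the number of sparse lattice vectors\<close>

definition grid_point :: "real \<Rightarrow> int \<times> int \<Rightarrow> complex" where
  "grid_point h k = Complex (h * real_of_int (fst k)) (h * real_of_int (snd k))"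

definition grid_index :: "real \<Rightarrow> complex \<Rightarrow> int \<times> int" where
  "grid_index h z = (\<lfloor>Re z / h\<rfloor>, \<lfloor>Im z / h\<rfloor>)"

lemma grid_point_0 [simp]: "grid_point h (0, 0) = 0"
  by (simp add: grid_point_def complex_eq_iff)

lemma grid_index_error:
  assumes "0 < h"
  shows "(cmod (z - grid_point h (grid_index h z)))\<^sup>2 \<le> 2 * h\<^sup>2"
proof -
  have *: "(r - h * \<lfloor>r / h\<rfloor>)\<^sup>2 \<le> h\<^sup>2" for r
  proof -
    have "r - h * \<lfloor>r / h\<rfloor> = h * frac (r / h)" using assms by (simp add: frac_def right_diff_distrib)
    also have "\<dots>\<^sup>2 \<le> (h * 1)\<^sup>2"
      using assms frac_lt_1[of "r / h"] by (intro power_mono mult_left_mono) auto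
    finally show ?thesis by simp
  qed
  show ?thesis using *[of "Re z"] *[of "Im z"] by (simp add: cmod_power2 grid_point_def grid_index_def)
qed

lemma grid_index_square_le:
  assumes "0 < h"
  shows "(real_of_int (fst (grid_index h z)))\<^sup>2 + (real_of_int (snd (grid_index h z)))\<^sup>2 \<le> 2 * (cmod z)\<^sup>2 / h\<^sup>2 + 4"
proof -
  have *: "(real_of_int \<lfloor>w\<rfloor>)\<^sup>2 \<le> 2 * w\<^sup>2 + 2" for w :: real
  proof -
    have "(frac w)\<^sup>2 \<le> 1" using frac_lt_1[of w] by (simp add: power_le_one)
    moreover have "real_of_int \<lfloor>w\<rfloor> = w - frac w" by (simp add: frac_def)
    moreover have "0 \<le> (w + frac w)\<^sup>2" by simp
    ultimately show ?thesis by (simp add: power2_sum power2_diff)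
  qed
  show ?thesis using *[of "Re z / h"] *[of "Im z / h"]
    by (simp add: grid_index_def cmod_power2 power_divide add_divide_distrib)
qed

text \<open>Besides the Gaussian weight each nonzero coordinate pays a penalty \<open>s\<close>.
  Undoing the weights costs \<open>s * m + 9 * m\<close>, and the product over all coordinates is at
  most \<open>(1 + 9 * m / n)^n\<close>, which costs another \<open>9 * m\<close>; together
  18.\<close>

lemma card_sparse_lattice_le:
  fixes B :: int and m \<rho> :: real
  assumes fin: "finite I" "I \<noteq> {}" and m: "0 < m" "m \<le> card I" and \<rho>: "0 < \<rho>" "\<rho> \<le> 1"
  shows "real (card {k \<in> I \<rightarrow>\<^sub>E {-B..B} \<times> {-B..B}. real (card {i\<in>I. k i \<noteq> (0, 0)}) \<le> m \<and>
      (\<Sum>i\<in>I. (real_of_int (fst (k i)))\<^sup>2 + (real_of_int (snd (k i)))\<^sup>2) \<le> 9 * m / \<rho>\<^sup>2})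
    \<le> exp (m * (ln (card I / m) + 4 * ln (1 / \<rho>) + 18))"
    (is "real (card ?F) \<le> _")
proof -
  define n where "n = real (card I)"
  have n: "0 < n" using fin by (simp add: n_def card_gt_0_iff)
  \<comment> \<open>Solves \<open>exp (- s) * (3 / \<rho>^2)^2 = 9 * m / n\<close>, where
    \<open>3 / \<rho>^2\<close> bounds the Gaussian sum in each of the two integer
    directions.\<close>
  define s where "s = ln (n / m) + 4 * ln (1 / \<rho>)"
  have s0: "0 \<le> s" unfolding s_def using m \<rho> n by (intro add_nonneg_nonneg mult_nonneg_nonneg) (auto simp: n_def)
  have exps: "exp (- s) = m / n * \<rho> ^ 4"
  proof -
    have "exp (4 * ln \<rho>) = \<rho> ^ 4"
      using \<rho> exp_of_nat_mult[of 4 "ln \<rho>"] by simp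
    moreover have "- s = ln (m / n) + 4 * ln \<rho>"
      using m n \<rho> by (simp add: s_def ln_div)
    ultimately show ?thesis using m n by (simp add: exp_add)
  qed
  define w where "w k = exp (- (s * of_bool (k \<noteq> (0, 0)) + \<rho>\<^sup>2 * ((real_of_int (fst k))\<^sup>2 + (real_of_int (snd k))\<^sup>2)))"
    for k :: "int \<times> int"
  have "real (card ?F) \<le> exp (s * m + 9 * m) * (1 + 9 * m / n) ^ card I"
  proof (rule card_le_prod_weight[where w = "\<lambda>i. w", OF fin(1)])
    fix k assume k: "k \<in> ?F"
    have "(\<Sum>i\<in>I. s * of_bool (k i \<noteq> (0, 0)) + \<rho>\<^sup>2 * ((real_of_int (fst (k i)))\<^sup>2 + (real_of_int (snd (k i)))\<^sup>2))
       = s * (\<Sum>i\<in>I. of_bool (k i \<noteq> (0, 0))) + \<rho>\<^sup>2 * (\<Sum>i\<in>I. (real_of_int (fst (k i)))\<^sup>2 + (real_of_int (snd (k i)))\<^sup>2)"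
      by (subst sum.distrib) (simp only: sum_distrib_left)
    also have "(\<Sum>i\<in>I. of_bool (k i \<noteq> (0, 0))) = real (card {i\<in>I. k i \<noteq> (0, 0)})"
    proof -
      have "I \<inter> {i. k i \<noteq> (0, 0)} = {i\<in>I. k i \<noteq> (0, 0)}" by auto
      then show ?thesis using fin(1) by (simp del: not_False_eq_True)
    qed
    also have "s * real (card {i\<in>I. k i \<noteq> (0, 0)}) + \<rho>\<^sup>2 * (\<Sum>i\<in>I. (real_of_int (fst (k i)))\<^sup>2 + (real_of_int (snd (k i)))\<^sup>2)
      \<le> s * m + \<rho>\<^sup>2 * (9 * m / \<rho>\<^sup>2)"
      using k s0 by (intro add_mono mult_left_mono) auto
    also have "\<dots> = s * m + 9 * m" using \<rho> by simp
    finally have "0 \<le> (s * m + 9 * m) + - (\<Sum>i\<in>I. s * of_bool (k i \<noteq> (0, 0)) + \<rho>\<^sup>2 * ((real_of_int (fst (k i)))\<^sup>2 + (real_of_int (snd (k i)))\<^sup>2))"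
      by simp
    then show "1 \<le> exp (s * m + 9 * m) * (\<Prod>i\<in>I. w (k i))"
      unfolding w_def exp_sum[OF fin(1), symmetric] exp_add[symmetric] sum_negf one_le_exp_iff .
  next
    define g where "g a = exp (- \<rho>\<^sup>2 * (real_of_int a)\<^sup>2)" for a :: int
    define C where "C = (\<Sum>a\<in>{-B..B}. g a)"
    have C: "0 \<le> C" "C \<le> 3 / \<rho>\<^sup>2"
    proof -
      show "0 \<le> C" unfolding C_def g_def by (intro sum_nonneg) auto
      have "C \<le> 1 + 2 / \<rho>\<^sup>2" unfolding C_def g_def using \<rho> by (intro sum_exp_neg_square_le) auto
      also have "1 + 2 / \<rho>\<^sup>2 \<le> 3 / \<rho>\<^sup>2"
      proof -
        have "1 \<le> 1 / \<rho>\<^sup>2" using \<rho> by (simp add: le_divide_eq power_le_one)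
        moreover have "3 / \<rho>\<^sup>2 = 1 / \<rho>\<^sup>2 + 2 / \<rho>\<^sup>2" by (simp add: add_divide_distrib[symmetric])
        ultimately show ?thesis by linarith
      qed
      finally show "C \<le> 3 / \<rho>\<^sup>2" .
    qed
    have "(\<Sum>k\<in>{-B..B} \<times> {-B..B}. w k) \<le> (\<Sum>k\<in>{-B..B} \<times> {-B..B}. of_bool (k = (0, 0)) + exp (- s) * (g (fst k) * g (snd k)))"
    proof (rule sum_mono)
      fix k :: "int \<times> int"
      show "w k \<le> of_bool (k = (0, 0)) + exp (- s) * (g (fst k) * g (snd k))"
      proof (cases "k = (0, 0)")
        case True
        then show ?thesis by (simp add: w_def g_def)
      next
        case False
        then have "w k = exp (- s) * (g (fst k) * g (snd k))"
          unfolding w_def g_def exp_add[symmetric] by (simp add: algebra_simps)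
        then show ?thesis by simp
      qed
    qed
    also have "\<dots> \<le> 1 + exp (- s) * (C * C)"
    proof -
      have "(\<Sum>k\<in>{-B..B} \<times> {-B..B}. of_bool (k = (0, 0)) :: real) \<le> 1"
      proof -
        have "card ({-B..B} \<times> {-B..B} \<inter> {k. k = (0, 0)}) \<le> card {(0::int, 0::int)}" by (intro card_mono) auto
        then show ?thesis by simp
      qed
      moreover have "(\<Sum>k\<in>{-B..B} \<times> {-B..B}. g (fst k) * g (snd k)) = C * C"
        unfolding C_def sum_product sum.cartesian_product by (simp add: case_prod_beta)
      ultimately show ?thesis unfolding sum.distrib sum_distrib_left[symmetric] by simp
    qed
    also have "exp (- s) * (C * C) \<le> exp (- s) * ((3 / \<rho>\<^sup>2) * (3 / \<rho>\<^sup>2))"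
      using C \<rho> by (intro mult_left_mono mult_mono) auto
    also have "\<dots> = 9 * m / n" unfolding exps using \<rho> by (simp add: field_simps power2_eq_square power4_eq_xxxx)
    finally show "(\<Sum>k\<in>{-B..B} \<times> {-B..B}. w k) \<le> 1 + 9 * m / n" by simp
  qed (auto simp: w_def)
  also have "\<dots> \<le> exp (s * m + 9 * m) * exp (9 * m / n) ^ card I"
    using m n exp_ge_add_one_self[of "9 * m / n"] by (intro mult_left_mono power_mono) auto
  also have "\<dots> = exp (s * m + 9 * m + n * (9 * m / n))"
    unfolding exp_of_nat_mult[symmetric] exp_add[symmetric] n_def ..
  also have "\<dots> = exp (m * (ln (n / m) + 4 * ln (1 / \<rho>) + 18))"
    using n by (simp add: s_def algebra_simps)
  finally show ?thesis by (simp add: n_def)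
qed

lemma cmod_add_square_le: "(cmod (a + b))\<^sup>2 \<le> 2 * (cmod a)\<^sup>2 + 2 * (cmod b)\<^sup>2"
proof -
  have "(cmod (a + b))\<^sup>2 \<le> (cmod a + cmod b)\<^sup>2" by (intro power_mono norm_triangle_ineq) auto
  also have "\<dots> \<le> 2 * (cmod a)\<^sup>2 + 2 * (cmod b)\<^sup>2"
    using sum_squares_bound[of "cmod a" "cmod b"] by (simp add: power2_sum)
  finally show ?thesis .
qed

text \<open>Two meshes are used. The constant enters every coordinate and is rounded to
  \<open>\<rho> / sqrt (card I)\<close>; the sparse part has at most \<open>m\<close> coordinates
  and is rounded to the coarser \<open>\<rho> / sqrt m\<close>. Both errors are of order
  \<open>\<rho>\<close> in norm.\<close>

lemma nearly_constant_approx: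
  fixes v :: "'i \<Rightarrow> complex" and m \<rho> :: real
  assumes fin: "finite I" "I \<noteq> {}" and m: "0 < m" "4 * m \<le> card I" and \<rho>: "0 < \<rho>" "\<rho> \<le> 1/8"
    and v: "(\<Sum>i\<in>I. (cmod (v i))\<^sup>2) = 1" and nc: "nearly_constant I m \<rho> v"
  obtains a k where "a \<in> {-\<lfloor>2/\<rho>\<rfloor>..\<lfloor>2/\<rho>\<rfloor>} \<times> {-\<lfloor>2/\<rho>\<rfloor>..\<lfloor>2/\<rho>\<rfloor>}"
    "k \<in> I \<rightarrow>\<^sub>E {-\<lceil>9 * m / \<rho>\<^sup>2\<rceil>..\<lceil>9 * m / \<rho>\<^sup>2\<rceil>} \<times> {-\<lceil>9 * m / \<rho>\<^sup>2\<rceil>..\<lceil>9 * m / \<rho>\<^sup>2\<rceil>}"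
    "real (card {i\<in>I. k i \<noteq> (0, 0)}) \<le> m"
    "(\<Sum>i\<in>I. (real_of_int (fst (k i)))\<^sup>2 + (real_of_int (snd (k i)))\<^sup>2) \<le> 9 * m / \<rho>\<^sup>2"
    "(\<Sum>i\<in>I. (cmod (v i - (grid_point (\<rho> / sqrt (card I)) a + grid_point (\<rho> / sqrt m) (k i))))\<^sup>2) \<le> 16 * \<rho>\<^sup>2"
proof -
  define n where "n = real (card I)"
  have n: "0 < n" using fin by (simp add: n_def card_gt_0_iff)
  obtain \<alpha> S where S: "S \<subseteq> I" "real (card S) \<le> m" and dist: "(\<Sum>i\<in>I - S. (cmod (v i - \<alpha>))\<^sup>2) \<le> \<rho>\<^sup>2"
    using nc unfolding nearly_constant_def by auto
  have finS: "finite S" using S fin by (auto intro: finite_subset)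
  define h0 where "h0 = \<rho> / sqrt n"
  define h where "h = \<rho> / sqrt m"
  have h0: "0 < h0" and h: "0 < h" using n m \<rho> by (simp_all add: h0_def h_def)
  have h0sq: "h0\<^sup>2 = \<rho>\<^sup>2 / n" and hsq: "h\<^sup>2 = \<rho>\<^sup>2 / m" using n m by (simp_all add: h0_def h_def power_divide)
  define a where "a = grid_index h0 \<alpha>"
  define k where "k = (\<lambda>i\<in>I. if i \<in> S then grid_index h (v i - \<alpha>) else (0, 0))"
  have kS: "k i = grid_index h (v i - \<alpha>)" if "i \<in> S" for i using that S(1) by (auto simp: k_def)
  have kIS: "k i = (0, 0)" if "i \<in> I - S" for i using that by (simp add: k_def)
  have \<rho>2: "\<rho>\<^sup>2 \<le> 1/64"
  proof -
    have "\<rho>\<^sup>2 \<le> (1/8)\<^sup>2" using \<rho> by (intro power_mono) auto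
    then show ?thesis by (simp add: power2_eq_square)
  qed
  have split: "(\<Sum>i\<in>I. f i) = (\<Sum>i\<in>I - S. f i) + (\<Sum>i\<in>S. f i)" for f :: "'i \<Rightarrow> real"
    by (rule sum.subset_diff[OF S(1) fin(1)])
  have vS: "(\<Sum>i\<in>S. (cmod (v i))\<^sup>2) \<le> 1" "(\<Sum>i\<in>I - S. (cmod (v i))\<^sup>2) \<le> 1"
    using split[of "\<lambda>i. (cmod (v i))\<^sup>2"] v sum_nonneg[of S "\<lambda>i. (cmod (v i))\<^sup>2"]
      sum_nonneg[of "I - S" "\<lambda>i. (cmod (v i))\<^sup>2"] by auto
  have cardIS: "real (card (I - S)) = n - card S"
    using card_Diff_subset[OF finS S(1)] card_mono[OF fin(1) S(1)] by (simp add: n_def)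
  \<comment> \<open>At least 3/4 of the coordinates lie close to \<open>\<alpha>\<close> while
    \<open>v\<close> has norm 1, so \<open>\<alpha>\<close> is of order
    \<open>1 / sqrt n\<close>.\<close>
  have \<alpha>n: "(cmod \<alpha>)\<^sup>2 * n \<le> 3"
  proof -
    have "(cmod \<alpha>)\<^sup>2 \<le> 2 * (cmod (v i))\<^sup>2 + 2 * (cmod (v i - \<alpha>))\<^sup>2" for i
      using cmod_add_square_le[of "v i" "\<alpha> - v i"] by (simp add: norm_minus_commute)
    then have "(\<Sum>i\<in>I - S. (cmod \<alpha>)\<^sup>2) \<le> (\<Sum>i\<in>I - S. 2 * (cmod (v i))\<^sup>2 + 2 * (cmod (v i - \<alpha>))\<^sup>2)"
      by (intro sum_mono)
    also have "\<dots> = 2 * (\<Sum>i\<in>I - S. (cmod (v i))\<^sup>2) + 2 * (\<Sum>i\<in>I - S. (cmod (v i - \<alpha>))\<^sup>2)"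
      by (simp only: sum.distrib sum_distrib_left)
    also have "\<dots> \<le> 2 * 1 + 2 * (1/64)" using vS dist \<rho>2 by (intro add_mono mult_left_mono) auto
    finally have le: "(n - card S) * (cmod \<alpha>)\<^sup>2 \<le> 65/32" by (simp add: cardIS)
    have "(3/4 * n) * (cmod \<alpha>)\<^sup>2 \<le> (n - card S) * (cmod \<alpha>)\<^sup>2"
      using S m by (intro mult_right_mono) (auto simp: n_def)
    then show ?thesis using le by (simp add: algebra_simps)
  qed
  have U: "(\<Sum>i\<in>S. (cmod (v i - \<alpha>))\<^sup>2) \<le> 7/2"
  proof -
    have "(\<Sum>i\<in>S. (cmod (v i - \<alpha>))\<^sup>2) \<le> (\<Sum>i\<in>S. 2 * (cmod (v i))\<^sup>2 + 2 * (cmod \<alpha>)\<^sup>2)"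
      using cmod_add_square_le[of "v _" "- \<alpha>"] by (intro sum_mono) simp
    also have "\<dots> = 2 * (\<Sum>i\<in>S. (cmod (v i))\<^sup>2) + 2 * (card S * (cmod \<alpha>)\<^sup>2)"
      by (simp add: sum.distrib sum_distrib_left)
    also have "\<dots> \<le> 2 * 1 + 2 * ((n / 4) * (cmod \<alpha>)\<^sup>2)"
      using vS S m by (intro add_mono mult_left_mono mult_right_mono) (auto simp: n_def)
    also have "\<dots> \<le> 7/2" using \<alpha>n by (simp add: mult.commute)
    finally show ?thesis .
  qed
  have supp: "real (card {i\<in>I. k i \<noteq> (0, 0)}) \<le> m"
  proof -
    have "{i\<in>I. k i \<noteq> (0, 0)} \<subseteq> S" by (auto simp: k_def)
    then have "card {i\<in>I. k i \<noteq> (0, 0)} \<le> card S" using finS by (rule card_mono[rotated])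
    then show ?thesis using S(2) by simp
  qed
  have ksq: "(\<Sum>i\<in>I. (real_of_int (fst (k i)))\<^sup>2 + (real_of_int (snd (k i)))\<^sup>2) \<le> 9 * m / \<rho>\<^sup>2"
  proof -
    have "(\<Sum>i\<in>I. (real_of_int (fst (k i)))\<^sup>2 + (real_of_int (snd (k i)))\<^sup>2)
      = (\<Sum>i\<in>S. (real_of_int (fst (grid_index h (v i - \<alpha>))))\<^sup>2 + (real_of_int (snd (grid_index h (v i - \<alpha>))))\<^sup>2)"
      unfolding split by (simp add: kS kIS)
    also have "\<dots> \<le> (\<Sum>i\<in>S. 2 * (cmod (v i - \<alpha>))\<^sup>2 / h\<^sup>2 + 4)"
      by (intro sum_mono grid_index_square_le h)
    also have "\<dots> = 2 * (\<Sum>i\<in>S. (cmod (v i - \<alpha>))\<^sup>2) / h\<^sup>2 + 4 * card S"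
      by (simp add: sum.distrib sum_distrib_left sum_divide_distrib)
    also have "\<dots> \<le> 2 * (7/2) / h\<^sup>2 + 4 * m"
      using U S by (intro add_mono divide_right_mono mult_left_mono) auto
    also have "\<dots> = (7 + 4 * \<rho>\<^sup>2) * m / \<rho>\<^sup>2" unfolding hsq using \<rho> m by (simp add: field_simps)
    also have "\<dots> \<le> 9 * m / \<rho>\<^sup>2" using \<rho>2 m by (intro divide_right_mono mult_right_mono) auto
    finally show ?thesis .
  qed
  have kbox: "k i \<in> {-\<lceil>9 * m / \<rho>\<^sup>2\<rceil>..\<lceil>9 * m / \<rho>\<^sup>2\<rceil>} \<times> {-\<lceil>9 * m / \<rho>\<^sup>2\<rceil>..\<lceil>9 * m / \<rho>\<^sup>2\<rceil>}" if i: "i \<in> I" for i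
  proof -
    have abs_le: "\<bar>b\<bar> \<le> \<lceil>9 * m / \<rho>\<^sup>2\<rceil>" if "(real_of_int b)\<^sup>2 \<le> 9 * m / \<rho>\<^sup>2" for b
    proof -
      have "\<bar>b\<bar> \<le> b\<^sup>2"
        by (cases "b = 0") (use mult_right_mono[of 1 "\<bar>b\<bar>" "\<bar>b\<bar>"] in \<open>auto simp: power2_eq_square abs_mult[symmetric]\<close>)
      then have "real_of_int \<bar>b\<bar> \<le> (real_of_int b)\<^sup>2" by (metis of_int_le_iff of_int_power)
      then show ?thesis using that by (simp add: le_ceiling_iff; linarith)
    qed
    have "(real_of_int (fst (k i)))\<^sup>2 + (real_of_int (snd (k i)))\<^sup>2
       \<le> (\<Sum>i\<in>I. (real_of_int (fst (k i)))\<^sup>2 + (real_of_int (snd (k i)))\<^sup>2)"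
      by (rule member_le_sum[OF i]) (auto simp: fin)
    then have "(real_of_int (fst (k i)))\<^sup>2 + (real_of_int (snd (k i)))\<^sup>2 \<le> 9 * m / \<rho>\<^sup>2" using ksq by linarith
    then have "\<bar>fst (k i)\<bar> \<le> \<lceil>9 * m / \<rho>\<^sup>2\<rceil>" "\<bar>snd (k i)\<bar> \<le> \<lceil>9 * m / \<rho>\<^sup>2\<rceil>"
      by (intro abs_le; smt (verit) zero_le_power2)+
    then show ?thesis by (cases "k i") (auto simp: abs_le_iff)
  qed
  have abox: "a \<in> {-\<lfloor>2/\<rho>\<rfloor>..\<lfloor>2/\<rho>\<rfloor>} \<times> {-\<lfloor>2/\<rho>\<rfloor>..\<lfloor>2/\<rho>\<rfloor>}"
  proof -
    have "\<bar>\<lfloor>r / h0\<rfloor>\<bar> \<le> \<lfloor>2 / \<rho>\<rfloor>" if r: "\<bar>r\<bar> \<le> cmod \<alpha>" for r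
    proof -
      have "(cmod \<alpha> * sqrt n)\<^sup>2 = (cmod \<alpha>)\<^sup>2 * n" using n by (simp add: power_mult_distrib)
      also have "\<dots> \<le> (7/4)\<^sup>2" using \<alpha>n by (simp add: power_divide)
      finally have "cmod \<alpha> * sqrt n \<le> 7/4" by (rule power2_le_imp_le) simp
      moreover have "\<bar>r\<bar> * sqrt n \<le> cmod \<alpha> * sqrt n" using r n by (intro mult_right_mono) auto
      ultimately have "\<bar>r\<bar> * sqrt n / \<rho> \<le> (7/4) / \<rho>" using \<rho> by (intro divide_right_mono) auto
      moreover have "\<bar>r / h0\<bar> = \<bar>r\<bar> * sqrt n / \<rho>" using n \<rho> by (simp add: h0_def abs_mult)
      moreover have "(7/4) / \<rho> + 1 \<le> 2 / \<rho>" using \<rho> by (simp add: field_simps)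
      ultimately have "\<bar>r / h0\<bar> + 1 \<le> 2 / \<rho>" by linarith
      moreover have "\<bar>real_of_int \<lfloor>r / h0\<rfloor>\<bar> \<le> \<bar>r / h0\<bar> + 1" by linarith
      ultimately have "real_of_int \<bar>\<lfloor>r / h0\<rfloor>\<bar> \<le> 2 / \<rho>" by simp
      then show ?thesis by (simp only: le_floor_iff)
    qed
    from this[OF abs_Re_le_cmod] this[OF abs_Im_le_cmod] show ?thesis
      unfolding a_def grid_index_def mem_Times_iff fst_conv snd_conv atLeastAtMost_iff by linarith
  qed
  have err: "(\<Sum>i\<in>I. (cmod (v i - (grid_point h0 a + grid_point h (k i))))\<^sup>2) \<le> 16 * \<rho>\<^sup>2"
  proof -
    have "(\<Sum>i\<in>I. (cmod (v i - (grid_point h0 a + grid_point h (k i))))\<^sup>2)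
      \<le> (\<Sum>i\<in>I. 2 * (cmod (\<alpha> - grid_point h0 a))\<^sup>2 + 2 * (cmod (v i - \<alpha> - grid_point h (k i)))\<^sup>2)"
    proof (rule sum_mono)
      fix i
      show "(cmod (v i - (grid_point h0 a + grid_point h (k i))))\<^sup>2
        \<le> 2 * (cmod (\<alpha> - grid_point h0 a))\<^sup>2 + 2 * (cmod (v i - \<alpha> - grid_point h (k i)))\<^sup>2"
        using cmod_add_square_le[of "\<alpha> - grid_point h0 a" "v i - \<alpha> - grid_point h (k i)"]
        by (simp add: algebra_simps)
    qed
    also have "\<dots> = 2 * (n * (cmod (\<alpha> - grid_point h0 a))\<^sup>2) + 2 * (\<Sum>i\<in>I. (cmod (v i - \<alpha> - grid_point h (k i)))\<^sup>2)"
      by (simp add: sum.distrib sum_distrib_left n_def)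
    also have "\<dots> \<le> 2 * (n * (2 * h0\<^sup>2)) + 2 * (\<rho>\<^sup>2 + m * (2 * h\<^sup>2))"
    proof (intro add_mono mult_left_mono)
      show "(cmod (\<alpha> - grid_point h0 a))\<^sup>2 \<le> 2 * h0\<^sup>2" unfolding a_def by (rule grid_index_error[OF h0])
      have "(\<Sum>i\<in>I - S. (cmod (v i - \<alpha> - grid_point h (k i)))\<^sup>2) \<le> \<rho>\<^sup>2"
        using dist by (simp add: k_def)
      moreover have "(\<Sum>i\<in>S. (cmod (v i - \<alpha> - grid_point h (k i)))\<^sup>2) \<le> m * (2 * h\<^sup>2)"
      proof -
        have "(\<Sum>i\<in>S. (cmod (v i - \<alpha> - grid_point h (k i)))\<^sup>2) \<le> (\<Sum>i\<in>S. 2 * h\<^sup>2)"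
          using S(1) grid_index_error[OF h] by (intro sum_mono) (auto simp: k_def)
        also have "\<dots> \<le> m * (2 * h\<^sup>2)" using S(2) by (simp add: mult_right_mono)
        finally show ?thesis .
      qed
      ultimately show "(\<Sum>i\<in>I. (cmod (v i - \<alpha> - grid_point h (k i)))\<^sup>2) \<le> \<rho>\<^sup>2 + m * (2 * h\<^sup>2)"
        unfolding split by (rule add_mono)
    qed (use n in auto)
    \<comment> \<open>The bound \<open>10 * \<rho>^2\<close> is then enlarged to a perfect square,
      so that the distance to the net is at most \<open>4 * \<rho>\<close>.\<close>
    also have "\<dots> = 10 * \<rho>\<^sup>2" unfolding h0sq hsq using n m by simp
    also have "\<dots> \<le> 16 * \<rho>\<^sup>2" by (intro mult_right_mono) auto
    finally show ?thesis .
  qed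
  show ?thesis
  proof (rule that[OF abox _ supp ksq])
    show "k \<in> I \<rightarrow>\<^sub>E {-\<lceil>9 * m / \<rho>\<^sup>2\<rceil>..\<lceil>9 * m / \<rho>\<^sup>2\<rceil>} \<times> {-\<lceil>9 * m / \<rho>\<^sup>2\<rceil>..\<lceil>9 * m / \<rho>\<^sup>2\<rceil>}"
      using kbox by (intro PiE_I) (auto simp: k_def)
  qed (use err in \<open>simp add: h0_def h_def n_def\<close>)
qed

lemma nearly_constant_net:
  fixes I :: "'i set" and m \<rho> :: real
  assumes fin: "finite I" "I \<noteq> {}" and m: "0 < m" "4 * m \<le> card I" and \<rho>: "0 < \<rho>" "\<rho> \<le> 1/8"
  obtains \<Lambda> :: "('i \<Rightarrow> complex) set" where "finite \<Lambda>"
    "real (card \<Lambda>) \<le> 25 / \<rho>\<^sup>2 * exp (m * (ln (card I / m) + 4 * ln (1 / \<rho>) + 18))"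
    "\<And>v. (\<Sum>i\<in>I. (cmod (v i))\<^sup>2) = 1 \<Longrightarrow> nearly_constant I m \<rho> v \<Longrightarrow>
      \<exists>y\<in>\<Lambda>. (\<Sum>i\<in>I. (cmod (v i - y i))\<^sup>2) \<le> 16 * \<rho>\<^sup>2"
proof -
  define A where "A = {-\<lfloor>2/\<rho>\<rfloor>..\<lfloor>2/\<rho>\<rfloor>} \<times> {-\<lfloor>2/\<rho>\<rfloor>..\<lfloor>2/\<rho>\<rfloor>}"
  define F where "F = {k \<in> I \<rightarrow>\<^sub>E {-\<lceil>9 * m / \<rho>\<^sup>2\<rceil>..\<lceil>9 * m / \<rho>\<^sup>2\<rceil>} \<times> {-\<lceil>9 * m / \<rho>\<^sup>2\<rceil>..\<lceil>9 * m / \<rho>\<^sup>2\<rceil>}.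
      real (card {i\<in>I. k i \<noteq> (0, 0)}) \<le> m \<and>
      (\<Sum>i\<in>I. (real_of_int (fst (k i)))\<^sup>2 + (real_of_int (snd (k i)))\<^sup>2) \<le> 9 * m / \<rho>\<^sup>2}"
  define pt where "pt ak i = grid_point (\<rho> / sqrt (card I)) (fst ak) + grid_point (\<rho> / sqrt m) (snd ak i)"
    for ak :: "(int \<times> int) \<times> ('i \<Rightarrow> int \<times> int)" and i
  have "finite (I \<rightarrow>\<^sub>E {-\<lceil>9 * m / \<rho>\<^sup>2\<rceil>..\<lceil>9 * m / \<rho>\<^sup>2\<rceil>} \<times> {-\<lceil>9 * m / \<rho>\<^sup>2\<rceil>..\<lceil>9 * m / \<rho>\<^sup>2\<rceil>})"
    using fin by (intro finite_PiE) auto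
  then have finF: "finite F" by (rule finite_subset[rotated]) (auto simp: F_def)
  have finA: "finite A" by (simp add: A_def)
  have cardA: "real (card A) \<le> 25 / \<rho>\<^sup>2"
  proof -
    have fl: "0 \<le> \<lfloor>2 / \<rho>\<rfloor>" using \<rho> by simp
    have "real (card {-\<lfloor>2/\<rho>\<rfloor>..\<lfloor>2/\<rho>\<rfloor>}) = 2 * real_of_int \<lfloor>2 / \<rho>\<rfloor> + 1" using fl by simp
    also have "\<dots> \<le> 2 * (2 / \<rho>) + 1" by (intro add_right_mono mult_left_mono) auto
    also have "\<dots> \<le> 5 / \<rho>" using \<rho> by (simp add: field_simps)
    finally have "real (card {-\<lfloor>2/\<rho>\<rfloor>..\<lfloor>2/\<rho>\<rfloor>}) \<le> 5 / \<rho>" .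
    then have "real (card {-\<lfloor>2/\<rho>\<rfloor>..\<lfloor>2/\<rho>\<rfloor>}) * real (card {-\<lfloor>2/\<rho>\<rfloor>..\<lfloor>2/\<rho>\<rfloor>}) \<le> (5 / \<rho>) * (5 / \<rho>)"
      using \<rho> by (intro mult_mono) auto
    then show ?thesis unfolding A_def card_cartesian_product of_nat_mult by (simp add: power2_eq_square)
  qed
  have cardF: "real (card F) \<le> exp (m * (ln (card I / m) + 4 * ln (1 / \<rho>) + 18))"
    unfolding F_def using m \<rho> by (intro card_sparse_lattice_le fin) auto
  show ?thesis
  proof (rule that[of "pt ` (A \<times> F)"])
    show "finite (pt ` (A \<times> F))" using finA finF by simp
    have "real (card (pt ` (A \<times> F))) \<le> real (card (A \<times> F))"
      using finA finF by (intro of_nat_mono card_image_le) auto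
    also have "\<dots> = real (card A) * real (card F)" by (simp add: card_cartesian_product)
    also have "\<dots> \<le> 25 / \<rho>\<^sup>2 * exp (m * (ln (card I / m) + 4 * ln (1 / \<rho>) + 18))"
      using cardA cardF by (intro mult_mono) auto
    finally show "real (card (pt ` (A \<times> F))) \<le> 25 / \<rho>\<^sup>2 * exp (m * (ln (card I / m) + 4 * ln (1 / \<rho>) + 18))" .
  next
    fix v assume "(\<Sum>i\<in>I. (cmod (v i))\<^sup>2) = 1" "nearly_constant I m \<rho> v"
    then obtain a k where "a \<in> A" "k \<in> F"
      "(\<Sum>i\<in>I. (cmod (v i - (grid_point (\<rho> / sqrt (card I)) a + grid_point (\<rho> / sqrt m) (k i))))\<^sup>2) \<le> 16 * \<rho>\<^sup>2"
      by (rule nearly_constant_approx[OF fin m \<rho>]) (auto simp: A_def F_def)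
    then show "\<exists>y\<in>pt ` (A \<times> F). (\<Sum>i\<in>I. (cmod (v i - y i))\<^sup>2) \<le> 16 * \<rho>\<^sup>2"
      by (intro bexI[of _ "pt (a, k)"]) (auto simp: pt_def)
  qed
qed

section \<open>Union bound over the net\<close>

lemma L2_set_cmod_add_le:
  fixes a b :: "'i \<Rightarrow> complex"
  shows "L2_set (\<lambda>i. cmod (a i + b i)) A \<le> L2_set (\<lambda>i. cmod (a i)) A + L2_set (\<lambda>i. cmod (b i)) A"
proof -
  have "L2_set (\<lambda>i. cmod (a i + b i)) A \<le> L2_set (\<lambda>i. cmod (a i) + cmod (b i)) A"
    by (intro L2_set_mono norm_triangle_ineq) auto
  also have "\<dots> \<le> L2_set (\<lambda>i. cmod (a i)) A + L2_set (\<lambda>i. cmod (b i)) A"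
    by (rule L2_set_triangle_ineq)
  finally show ?thesis .
qed

lemma L2_set_cmod_mult: "L2_set (\<lambda>i. cmod (w * b i)) A = cmod w * L2_set (\<lambda>i. cmod (b i)) A"
  by (simp add: norm_mult L2_set_right_distrib)

lemma L2_set_subset_mono:
  "finite B \<Longrightarrow> A \<subseteq> B \<Longrightarrow> L2_set f A \<le> L2_set f B"
  unfolding L2_set_def by (intro real_sqrt_le_mono sum_mono2) auto

lemma sum_squares_le_iff_L2_set:
  assumes "0 \<le> c"
  shows "(\<Sum>i\<in>A. (f i)\<^sup>2) \<le> c\<^sup>2 \<longleftrightarrow> L2_set f A \<le> c"
  unfolding L2_set_def by (rule real_sqrt_le_iff[symmetric, THEN trans]) (use assms in simp)

text \<open>Only the equations with index in \<open>J\<close> are recorded, for two reasons: the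
  lines outside \<open>J\<close> serve as swap partners, and the normal to all rows but one
  satisfies no equation for the omitted row.\<close>

definition almost_null :: "'i set \<Rightarrow> ('i \<times> 'i \<Rightarrow> real) \<Rightarrow> 'i set \<Rightarrow> real \<Rightarrow> real \<Rightarrow> complex \<Rightarrow> bool" where
  "almost_null I X J m \<rho> w \<longleftrightarrow> (\<exists>v :: 'i \<Rightarrow> complex. (\<Sum>i\<in>I. (cmod (v i))\<^sup>2) = 1 \<and> nearly_constant I m \<rho> v \<and>
      L2_set (\<lambda>j. cmod ((\<Sum>i\<in>I. v i * X (i, j)) - w * v j)) J \<le> sqrt (card I) / 60)"

text \<open>Replacing a nearly constant unit vector by its neighbour in the net costs at most the operator norm
  times the mesh; this is where \<open>small\<close> is needed.\<close>

lemma nearly_constant_prob: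
  fixes I :: "'i set" and x :: "'i \<times> 'i \<Rightarrow> real" and m \<rho> K H :: real and w :: complex
  assumes finI: "finite I" "I \<noteq> {}" and sum0: "(\<Sum>e\<in>I \<times> I. x e) = 0"
    and var: "(\<Sum>e\<in>I \<times> I. (x e)\<^sup>2) = card (I \<times> I)"
    and bd: "\<And>e. e \<in> I \<times> I \<Longrightarrow> \<bar>x e\<bar> \<le> K" and K: "1 \<le> K"
    and J: "J \<subseteq> I" "4 * card J \<le> card I" "card I \<le> 5 * card J"
    and m: "0 < m" "4 * m \<le> card I" and \<rho>: "0 < \<rho>" "\<rho> \<le> 1/8"
    and H: "0 \<le> H" and small: "4 * \<rho> * (H + cmod w) \<le> sqrt (card I) / 60"
  shows "perm_avg (I \<times> I) (\<lambda>p. of_bool (bilinear_bound I (\<lambda>e. x (p e)) H \<and>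
        (\<Sum>e\<in>I \<times> J. (x (p e))\<^sup>2) \<le> 3/8 * card (I \<times> I) \<and>
        almost_null I (\<lambda>e. x (p e)) J m \<rho> w))
    \<le> 25 / \<rho>\<^sup>2 * exp (m * (ln (card I / m) + 4 * ln (1 / \<rho>) + 18) - card I / (20000 * K\<^sup>2))"
proof -
  let ?E = "I \<times> I"
  obtain \<Lambda> :: "('i \<Rightarrow> complex) set" where \<Lambda>: "finite \<Lambda>"
    "real (card \<Lambda>) \<le> 25 / \<rho>\<^sup>2 * exp (m * (ln (card I / m) + 4 * ln (1 / \<rho>) + 18))"
    and net: "\<And>v. (\<Sum>i\<in>I. (cmod (v i))\<^sup>2) = 1 \<Longrightarrow> nearly_constant I m \<rho> v \<Longrightarrow>
      \<exists>y\<in>\<Lambda>. (\<Sum>i\<in>I. (cmod (v i - y i))\<^sup>2) \<le> 16 * \<rho>\<^sup>2"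
    by (rule nearly_constant_net[OF finI m \<rho>]) blast
  \<comment> \<open>Net points within \<open>4 * \<rho> \<le> 1/2\<close> of a unit vector have norm
    between 1/2 and 2; only these satisfy the norm conditions of the bound for a fixed
    vector.\<close>
  define \<Lambda>' where "\<Lambda>' = {y\<in>\<Lambda>. 1/4 \<le> (\<Sum>i\<in>I. (cmod (y i))\<^sup>2) \<and> (\<Sum>i\<in>I. (cmod (y i))\<^sup>2) \<le> 4}"
  define bad where "bad y p \<longleftrightarrow> (\<Sum>e\<in>I \<times> J. (x (p e))\<^sup>2) \<le> 3/8 * card ?E \<and>
      (\<Sum>j\<in>J. (cmod (- w * y j + (\<Sum>i\<in>I. y i * x (p (i, j)))))\<^sup>2) \<le> card J / 180"
    for y :: "'i \<Rightarrow> complex" and p :: "'i \<times> 'i \<Rightarrow> 'i \<times> 'i"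
  define B where "B = exp (- (card I / (20000 * K\<^sup>2)))"
  have approx: "\<exists>y\<in>\<Lambda>'. bad y p"
    if bb: "bilinear_bound I (\<lambda>e. x (p e)) H" and Q: "(\<Sum>e\<in>I \<times> J. (x (p e))\<^sup>2) \<le> 3/8 * card ?E"
      and v: "(\<Sum>i\<in>I. (cmod (v i))\<^sup>2) = 1" "nearly_constant I m \<rho> v"
      and vA: "L2_set (\<lambda>j. cmod ((\<Sum>i\<in>I. v i * x (p (i, j))) - w * v j)) J \<le> sqrt (card I) / 60"
    for p and v :: "'i \<Rightarrow> complex"
  proof -
    obtain y where y: "y \<in> \<Lambda>" "(\<Sum>i\<in>I. (cmod (v i - y i))\<^sup>2) \<le> 16 * \<rho>\<^sup>2" using net[OF v] by auto
    define d where "d i = y i - v i" for i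
    have d: "L2_set (\<lambda>i. cmod (d i)) I \<le> 4 * \<rho>"
      using y(2) \<rho> sum_squares_le_iff_L2_set[of "4 * \<rho>" "\<lambda>i. cmod (d i)" I]
      by (simp add: d_def norm_minus_commute power_mult_distrib)
    have v1: "L2_set (\<lambda>i. cmod (v i)) I = 1" using v by (simp add: L2_set_def)
    have "L2_set (\<lambda>i. cmod (y i)) I \<le> 1 + 4 * \<rho>"
      using L2_set_cmod_add_le[of v d I] d v1 by (simp add: d_def)
    then have up: "(\<Sum>i\<in>I. (cmod (y i))\<^sup>2) \<le> 4"
      using \<rho> sum_squares_le_iff_L2_set[of 2 "\<lambda>i. cmod (y i)" I] by simp
    have "1 \<le> L2_set (\<lambda>i. cmod (y i)) I + 4 * \<rho>"
      using L2_set_cmod_add_le[of y "\<lambda>i. - d i" I] d v1 by (simp add: d_def norm_minus_commute)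
    then have "1/2 \<le> L2_set (\<lambda>i. cmod (y i)) I" using \<rho> by simp
    then have "(1/2)\<^sup>2 \<le> (L2_set (\<lambda>i. cmod (y i)) I)\<^sup>2" by (intro power_mono) auto
    then have low: "1/4 \<le> (\<Sum>i\<in>I. (cmod (y i))\<^sup>2)"
      by (simp add: L2_set_def sum_nonneg power2_eq_square)
    have dX: "L2_set (\<lambda>j. cmod (\<Sum>i\<in>I. d i * x (p (i, j)))) J \<le> H * (4 * \<rho>)"
    proof -
      have "L2_set (\<lambda>j. cmod (\<Sum>i\<in>I. d i * x (p (i, j)))) J \<le> L2_set (\<lambda>j. cmod (\<Sum>i\<in>I. d i * x (p (i, j)))) I"
        by (rule L2_set_subset_mono[OF finI(1) J(1)])
      also have "\<dots> \<le> H * L2_set (\<lambda>i. cmod (d i)) I"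
        using bilinear_bound_complex[OF finI(1) bb H, of d] by simp
      also have "\<dots> \<le> H * (4 * \<rho>)" using d H by (rule mult_left_mono)
      finally show ?thesis .
    qed
    have dw: "L2_set (\<lambda>j. cmod (- w * d j)) J \<le> cmod w * (4 * \<rho>)"
    proof -
      have "L2_set (\<lambda>j. cmod (- w * d j)) J = cmod w * L2_set (\<lambda>j. cmod (d j)) J"
        using L2_set_cmod_mult[of "- w" d J] by simp
      also have "\<dots> \<le> cmod w * L2_set (\<lambda>j. cmod (d j)) I"
        by (intro mult_left_mono L2_set_subset_mono finI J) auto
      also have "\<dots> \<le> cmod w * (4 * \<rho>)" using d by (intro mult_left_mono) auto
      finally show ?thesis .
    qed
    have "L2_set (\<lambda>j. cmod (- w * y j + (\<Sum>i\<in>I. y i * x (p (i, j))))) J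
      = L2_set (\<lambda>j. cmod (((\<Sum>i\<in>I. v i * x (p (i, j))) - w * v j) + ((\<Sum>i\<in>I. d i * x (p (i, j))) + - w * d j))) J"
      by (intro L2_set_cong refl arg_cong[where f = cmod]) (simp add: d_def algebra_simps sum_subtractf)
    also have "\<dots> \<le> sqrt (card I) / 60 + (H * (4 * \<rho>) + cmod w * (4 * \<rho>))"
      by (intro order_trans[OF L2_set_cmod_add_le] add_mono vA dX dw)
    also have "\<dots> \<le> sqrt (card I) / 30" using small by (simp add: algebra_simps)
    finally have "(\<Sum>j\<in>J. (cmod (- w * y j + (\<Sum>i\<in>I. y i * x (p (i, j)))))\<^sup>2) \<le> (sqrt (card I) / 30)\<^sup>2"
      by (subst sum_squares_le_iff_L2_set) auto
    \<comment> \<open>The defect 1/60 and an equal net error give 1/30; then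
      \<open>card I / 900 \<le> 5 * card J / 900\<close>.\<close>
    also have "\<dots> \<le> card J / 180" using J(3) by (simp add: power_divide)
    finally have "bad y p" using Q by (simp add: bad_def)
    then show ?thesis using y(1) up low by (auto simp: \<Lambda>'_def)
  qed
  have "perm_avg ?E (\<lambda>p. of_bool (bilinear_bound I (\<lambda>e. x (p e)) H \<and>
        (\<Sum>e\<in>I \<times> J. (x (p e))\<^sup>2) \<le> 3/8 * card (I \<times> I) \<and>
        almost_null I (\<lambda>e. x (p e)) J m \<rho> w))
    \<le> perm_avg ?E (\<lambda>p. of_bool (\<exists>y\<in>\<Lambda>'. bad y p) :: real)"
    unfolding almost_null_def using approx by (intro perm_avg_mono) (auto simp del: of_bool_eq_iff)
  also have "\<dots> \<le> (\<Sum>y\<in>\<Lambda>'. perm_avg ?E (\<lambda>p. of_bool (bad y p)))"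
    using \<Lambda>(1) by (intro perm_avg_bex_le) (auto simp: \<Lambda>'_def)
  also have "\<dots> \<le> (\<Sum>y\<in>\<Lambda>'. B)"
  proof (rule sum_mono)
    fix y assume "y \<in> \<Lambda>'"
    then have "perm_avg ?E (\<lambda>p. of_bool (bad y p)) \<le> exp (- (card J / (4000 * K\<^sup>2)))"
      unfolding bad_def using J
      by (intro perm_avg_small_lines_le[OF finI(1) sum0 var bd K]) (auto simp: \<Lambda>'_def)
    also have "\<dots> \<le> B"
    proof -
      have "(card I / 5) / (4000 * K\<^sup>2) \<le> card J / (4000 * K\<^sup>2)"
        using J(3) K by (intro divide_right_mono) auto
      then show ?thesis by (simp add: B_def)
    qed
    finally show "perm_avg ?E (\<lambda>p. of_bool (bad y p)) \<le> B" .
  qed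
  also have "\<dots> = real (card \<Lambda>') * B" by simp
  also have "\<dots> \<le> real (card \<Lambda>) * B"
    using \<Lambda>(1) by (intro mult_right_mono of_nat_mono card_mono) (auto simp: \<Lambda>'_def B_def)
  also have "\<dots> \<le> 25 / \<rho>\<^sup>2 * exp (m * (ln (card I / m) + 4 * ln (1 / \<rho>) + 18)) * B"
    using \<Lambda>(2) by (intro mult_right_mono) (auto simp: B_def)
  also have "\<dots> = 25 / \<rho>\<^sup>2 * exp (m * (ln (card I / m) + 4 * ln (1 / \<rho>) + 18) - card I / (20000 * K\<^sup>2))"
    unfolding B_def mult.assoc exp_add[symmetric] by simp
  finally show ?thesis .
qed

section \<open>Small balls for permutation sums\<close>

lemma cos_ge_one_minus: "1 - x\<^sup>2 / 2 \<le> cos x" for x :: real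
proof -
  have "\<bar>sin (x / 2)\<bar>\<^sup>2 \<le> \<bar>x / 2\<bar>\<^sup>2" by (intro power_mono abs_sin_x_le_abs_x) auto
  moreover have "cos x = 1 - 2 * (sin (x / 2))\<^sup>2" using cos_double_sin[of "x / 2"] by simp
  ultimately show ?thesis by (simp add: power_divide)
qed

lemma cos_ge_half: "\<bar>x\<bar> \<le> 1 \<Longrightarrow> 1 / 2 \<le> cos x" for x :: real
  using cos_ge_one_minus[of x] abs_square_le_1[of x] by simp

lemma abs_cos_le:
  fixes x :: real
  assumes "\<bar>x\<bar> \<le> 1"
  shows "\<bar>cos x\<bar> \<le> 1 - x\<^sup>2 / 4"
proof -
  have sin: "y / 2 \<le> sin y" if y: "0 \<le> y" "y \<le> 1" for y :: real
  proof -
    have "sin 0 - 0 / 2 \<le> sin y - y / 2"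
    proof (rule DERIV_nonneg_imp_nondecreasing[OF y(1)])
      fix z assume z: "0 \<le> z" "z \<le> y"
      have "((\<lambda>w. sin w - w / 2) has_real_derivative (cos z - 1/2)) (at z)"
        by (auto intro!: derivative_eq_intros)
      moreover have "0 \<le> cos z - 1/2" using cos_ge_half[of z] z y by simp
      ultimately show "\<exists>d. ((\<lambda>w. sin w - w / 2) has_real_derivative d) (at z) \<and> 0 \<le> d" by blast
    qed
    then show ?thesis by simp
  qed
  have cos: "cos y \<le> 1 - y\<^sup>2 / 4" if y: "0 \<le> y" "y \<le> 1" for y :: real
  proof -
    have "1 - 0\<^sup>2 / 4 - cos 0 \<le> 1 - y\<^sup>2 / 4 - cos y"
    proof (rule DERIV_nonneg_imp_nondecreasing[OF y(1)])
      fix z assume z: "0 \<le> z" "z \<le> y"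
      have "((\<lambda>w. 1 - w\<^sup>2 / 4 - cos w) has_real_derivative (sin z - z / 2)) (at z)"
        by (auto intro!: derivative_eq_intros)
      moreover have "0 \<le> sin z - z / 2" using sin[of z] z y by simp
      ultimately show "\<exists>d. ((\<lambda>w. 1 - w\<^sup>2 / 4 - cos w) has_real_derivative d) (at z) \<and> 0 \<le> d" by blast
    qed
    then show ?thesis by simp
  qed
  show ?thesis
    using cos[of "\<bar>x\<bar>"] cos_ge_half[OF assms] assms by simp
qed

section \<open>Esseen's inequality\<close>

text \<open>The cosine transform of the triangle \<open>1 - t * s\<close> is the Fejer kernel
  \<open>t * (1 - cos (x / t)) / x^2\<close>. It is nonnegative everywhere and, because the cosine
  stays above 1/2, at least \<open>1 / (4 * t)\<close> for \<open>\<bar>x\<bar> \<le> t\<close>;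
  hence it dominates the indicator.\<close>

lemma fejer_has_integral:
  fixes t x :: real
  assumes t: "0 < t"
  obtains F where "((\<lambda>s. (1 - t * s) * cos (s * x)) has_integral F) {0..1 / t}"
    "of_bool (\<bar>x\<bar> \<le> t) \<le> 4 * t * F"
proof (cases "\<bar>x\<bar> \<le> t")
  case True
  have "continuous_on {0..1/t} (\<lambda>s. (1 - t * s) * cos (s * x))" by (intro continuous_intros)
  then have "(\<lambda>s. (1 - t * s) * cos (s * x)) integrable_on {0..1/t}" by (rule integrable_continuous_real)
  then obtain F where F: "((\<lambda>s. (1 - t * s) * cos (s * x)) has_integral F) {0..1 / t}" by blast
  have low: "((\<lambda>s. (1 - t * s) / 2) has_integral ((1 / t) / 2 - t * (1 / t)\<^sup>2 / 4 - (0 / 2 - t * 0\<^sup>2 / 4))) {0..1 / t}"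
  proof (rule fundamental_theorem_of_calculus[where f = "\<lambda>s. s / 2 - t * s\<^sup>2 / 4"])
    show "0 \<le> 1 / t" using t by simp
    fix s
    have "((\<lambda>s. s / 2 - t * s\<^sup>2 / 4) has_real_derivative ((1 - t * s) / 2)) (at s within {0..1 / t})"
      by (auto intro!: derivative_eq_intros simp: field_simps)
    then show "((\<lambda>s. s / 2 - t * s\<^sup>2 / 4) has_vector_derivative ((1 - t * s) / 2)) (at s within {0..1 / t})"
      by (simp add: has_real_derivative_iff_has_vector_derivative)
  qed
  have "(1 / t) / 2 - t * (1 / t)\<^sup>2 / 4 - (0 / 2 - t * 0\<^sup>2 / 4) \<le> F"
  proof (rule has_integral_le[OF low F])
    fix s assume s: "s \<in> {0..1 / t}"
    then have ts: "t * s \<le> 1" using t by (simp add: field_simps)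
    have "\<bar>s * x\<bar> \<le> s * t" using True s by (simp add: abs_mult mult_left_mono)
    then have "1 / 2 \<le> cos (s * x)" using ts by (intro cos_ge_half) (simp add: mult.commute)
    then have "(1 - t * s) * (1 / 2) \<le> (1 - t * s) * cos (s * x)" using ts by (intro mult_left_mono) auto
    then show "(1 - t * s) / 2 \<le> (1 - t * s) * cos (s * x)" by simp
  qed
  then have "1 / (4 * t) \<le> F" using t by (simp add: power2_eq_square field_simps)
  then have "1 \<le> 4 * t * F" using t by (simp add: divide_le_eq mult.commute)
  then show ?thesis using True by (intro that[OF F]) simp
next
  case False
  then have x: "x \<noteq> 0" using t by auto
  define F where "F s = (1 - t * s) * sin (s * x) / x - t * cos (s * x) / x\<^sup>2" for s
  have "((\<lambda>s. (1 - t * s) * cos (s * x)) has_integral (F (1 / t) - F 0)) {0..1 / t}"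
  proof (rule fundamental_theorem_of_calculus)
    show "0 \<le> 1 / t" using t by simp
    fix s
    have "(F has_real_derivative ((1 - t * s) * cos (s * x))) (at s within {0..1 / t})"
      unfolding F_def using x by (auto intro!: derivative_eq_intros simp: field_simps power2_eq_square)
    then show "(F has_vector_derivative ((1 - t * s) * cos (s * x))) (at s within {0..1 / t})"
      by (simp add: has_real_derivative_iff_has_vector_derivative)
  qed
  moreover have "F (1 / t) - F 0 = t * (1 - cos (x / t)) / x\<^sup>2"
    unfolding F_def using t x by (simp add: field_simps)
  moreover have "0 \<le> t * (1 - cos (x / t)) / x\<^sup>2" using t by (intro divide_nonneg_nonneg mult_nonneg_nonneg) auto
  ultimately show ?thesis using that[of "F (1 / t) - F 0"] False t by simp
qed

text \<open>Replaces the Gaussian integral: \<open>exp (- u) \<le> 1 / (1 + u)\<close> for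
  nonnegative \<open>u\<close>, and the right side has an arctangent as antiderivative.\<close>

lemma inverse_quadratic_has_integral:
  fixes q T :: real
  assumes q: "0 < q" and T: "0 \<le> T"
  obtains G where "((\<lambda>s. 1 / (1 + q * s\<^sup>2)) has_integral G) {0..T}" "G \<le> 2 / sqrt q"
proof -
  define F where "F s = arctan (sqrt q * s) / sqrt q" for s
  have "((\<lambda>s. 1 / (1 + q * s\<^sup>2)) has_integral (F T - F 0)) {0..T}"
  proof (rule fundamental_theorem_of_calculus[OF T])
    fix s
    have "(F has_real_derivative (inverse (1 + (sqrt q * s)\<^sup>2) * sqrt q / sqrt q)) (at s within {0..T})"
      unfolding F_def using q by (auto intro!: derivative_eq_intros simp: mult.assoc)
    moreover have "inverse (1 + (sqrt q * s)\<^sup>2) * sqrt q / sqrt q = 1 / (1 + q * s\<^sup>2)"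
      using q by (simp add: power_mult_distrib inverse_eq_divide)
    ultimately show "(F has_vector_derivative (1 / (1 + q * s\<^sup>2))) (at s within {0..T})"
      by (simp add: has_real_derivative_iff_has_vector_derivative)
  qed
  moreover have "F T - F 0 \<le> 2 / sqrt q"
  proof -
    have "arctan (sqrt q * T) \<le> 2" using arctan_ubound[of "sqrt q * T"] pi_less_4 by simp
    then show ?thesis unfolding F_def using q by (simp add: divide_right_mono)
  qed
  ultimately show ?thesis by (rule that)
qed

lemma perm_avg_has_integral:
  fixes g :: "('a \<Rightarrow> 'a) \<Rightarrow> real \<Rightarrow> real"
  assumes "finite E" "\<And>p. p permutes E \<Longrightarrow> (g p has_integral G p) A"
  shows "((\<lambda>s. perm_avg E (\<lambda>p. g p s)) has_integral perm_avg E G) A"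
  unfolding perm_avg_def by (intro has_integral_divide has_integral_sum finite_permutations assms) auto

text \<open>The triangular weight is nonnegative and the kernel is even, so an upper bound on the
  cosine average over \<open>[0, 1/t]\<close> suffices, without absolute values. The weight
  \<open>w\<close> will be the indicator of the event that the revealed variance is small.\<close>

lemma perm_avg_esseen:
  fixes S w :: "('a \<Rightarrow> 'a) \<Rightarrow> real"
  assumes fin: "finite E" and t: "0 < t" and q: "0 < q"
    and w: "\<And>p. p permutes E \<Longrightarrow> 0 \<le> w p"
    and char: "\<And>s. 0 \<le> s \<Longrightarrow> s \<le> 1 / t \<Longrightarrow> perm_avg E (\<lambda>p. w p * cos (s * S p)) \<le> exp (- (q * s\<^sup>2))"
  shows "perm_avg E (\<lambda>p. w p * of_bool (\<bar>S p\<bar> \<le> t)) \<le> 8 * t / sqrt q"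
proof -
  have "\<exists>F. ((\<lambda>s. (1 - t * s) * cos (s * x)) has_integral F) {0..1 / t} \<and> of_bool (\<bar>x\<bar> \<le> t) \<le> 4 * t * F" for x
    by (rule fejer_has_integral[OF t, of x]) blast
  then obtain F where F: "\<And>x. ((\<lambda>s. (1 - t * s) * cos (s * x)) has_integral F x) {0..1 / t}"
    "\<And>x. of_bool (\<bar>x\<bar> \<le> t) \<le> 4 * t * F x" by metis
  obtain G where G: "((\<lambda>s. 1 / (1 + q * s\<^sup>2)) has_integral G) {0..1 / t}" "G \<le> 2 / sqrt q"
    by (rule inverse_quadratic_has_integral[OF q, of "1 / t"]) (use t in auto)
  have "perm_avg E (\<lambda>p. w p * of_bool (\<bar>S p\<bar> \<le> t)) \<le> perm_avg E (\<lambda>p. 4 * t * (w p * F (S p)))"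
  proof (rule perm_avg_mono)
    fix p assume p: "p permutes E"
    have eq: "4 * t * (w p * F (S p)) = w p * (4 * t * F (S p))" by simp
    show "w p * of_bool (\<bar>S p\<bar> \<le> t) \<le> 4 * t * (w p * F (S p))"
      unfolding eq by (rule mult_left_mono[OF F(2) w[OF p]])
  qed
  also have "\<dots> = 4 * t * perm_avg E (\<lambda>p. w p * F (S p))" by (rule perm_avg_cmult)
  also have "\<dots> \<le> 4 * t * G"
  proof (rule mult_left_mono)
    have "((\<lambda>s. perm_avg E (\<lambda>p. w p * ((1 - t * s) * cos (s * S p)))) has_integral perm_avg E (\<lambda>p. w p * F (S p))) {0..1 / t}"
      by (intro perm_avg_has_integral fin has_integral_mult_right F)
    then show "perm_avg E (\<lambda>p. w p * F (S p)) \<le> G"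
    proof (rule has_integral_le[OF _ G(1)])
      fix s assume s: "s \<in> {0..1 / t}"
      then have ts: "t * s \<le> 1" "0 \<le> t * s" using t by (simp_all add: field_simps)
      have "perm_avg E (\<lambda>p. w p * ((1 - t * s) * cos (s * S p))) = (1 - t * s) * perm_avg E (\<lambda>p. w p * cos (s * S p))"
        unfolding perm_avg_cmult[symmetric] by (simp add: mult_ac)
      also have "\<dots> \<le> (1 - t * s) * exp (- (q * s\<^sup>2))"
        using char[of s] s ts by (intro mult_left_mono) auto
      also have "\<dots> \<le> 1 * exp (- (q * s\<^sup>2))" using ts by (intro mult_right_mono) auto
      also have "\<dots> \<le> 1 / (1 + q * s\<^sup>2)"
      proof -
        have pos: "0 < 1 + q * s\<^sup>2" using q by (simp add: add_pos_nonneg)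
        then show ?thesis
          using exp_ge_add_one_self[of "q * s\<^sup>2"] by (simp add: exp_minus inverse_eq_divide frac_le)
      qed
      finally show "perm_avg E (\<lambda>p. w p * ((1 - t * s) * cos (s * S p))) \<le> 1 / (1 + q * s\<^sup>2)" .
    qed
  qed (use t in auto)
  also have "\<dots> \<le> 4 * t * (2 / sqrt q)" using G(2) t by (intro mult_left_mono) auto
  finally show ?thesis by simp
qed

section \<open>Characteristic functions and pair swaps\<close>

text \<open>Averaging over one swap turns \<open>cis (A + B)\<close> into
  \<open>(cis (A + B) + cis (A - B)) / 2 = cis A * cos B\<close>. The weight is kept general since
  the induction absorbs the factor of the pair \<open>k\<close> into it while the other pairs are
  treated.\<close>

lemma perm_avg_cis_pairs:
  fixes \<Psi> :: "('a \<Rightarrow> 'a) \<Rightarrow> complex" and y a :: "'a \<Rightarrow> real"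
  assumes "finite P" and E: "\<And>k. k \<in> P \<Longrightarrow> e k \<in> E \<and> e' k \<in> E"
    and dis: "\<And>i k. i \<in> P \<Longrightarrow> k \<in> P \<Longrightarrow> i \<noteq> k \<Longrightarrow> e i \<noteq> e k \<and> e i \<noteq> e' k \<and> e' i \<noteq> e k \<and> e' i \<noteq> e' k"
    and inv: "\<And>p k. p permutes E \<Longrightarrow> k \<in> P \<Longrightarrow> \<Psi> (p \<circ> Transposition.transpose (e k) (e' k)) = \<Psi> p"
  shows "perm_avg E (\<lambda>p. \<Psi> p * (\<Prod>k\<in>P. cis (a (e k) * y (p (e k)) + a (e' k) * y (p (e' k)))))
     = perm_avg E (\<lambda>p. \<Psi> p * (\<Prod>k\<in>P. cis ((a (e k) + a (e' k)) * (y (p (e k)) + y (p (e' k))) / 2)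
         * cos ((a (e k) - a (e' k)) * (y (p (e k)) - y (p (e' k))) / 2)))"
  using assms
proof (induction P arbitrary: \<Psi> rule: finite_induct)
  case empty
  then show ?case by simp
next
  case (insert k P)
  define g where "g p = cis (a (e k) * y (p (e k)) + a (e' k) * y (p (e' k)))" for p
  define h where "h p = cis ((a (e k) + a (e' k)) * (y (p (e k)) + y (p (e' k))) / 2)
         * cos ((a (e k) - a (e' k)) * (y (p (e k)) - y (p (e' k))) / 2)" for p
  define Z where "Z p = (\<Prod>k\<in>P. cis ((a (e k) + a (e' k)) * (y (p (e k)) + y (p (e' k))) / 2)
         * cos ((a (e k) - a (e' k)) * (y (p (e k)) - y (p (e' k))) / 2))" for p
  have kE: "e k \<in> E" "e' k \<in> E" using insert.prems(1)[of k] by auto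
  have fixed: "Transposition.transpose (e k) (e' k) (e i) = e i"
    "Transposition.transpose (e k) (e' k) (e' i) = e' i" if "i \<in> P" for i
    using insert.prems(2)[of i k] insert.hyps(2) that by (auto simp: Transposition.transpose_def)
  have fixed': "Transposition.transpose (e i) (e' i) (e k) = e k"
    "Transposition.transpose (e i) (e' i) (e' k) = e' k" if "i \<in> P" for i
    using insert.prems(2)[of k i] insert.hyps(2) that by (auto simp: Transposition.transpose_def)
  have Zinv: "Z (p \<circ> Transposition.transpose (e k) (e' k)) = Z p" for p
    unfolding Z_def by (intro prod.cong refl) (simp add: fixed)
  have gswap: "(g p + g (p \<circ> Transposition.transpose (e k) (e' k))) / 2 = h p" for p
  proof -
    define A where "A = (a (e k) + a (e' k)) * (y (p (e k)) + y (p (e' k))) / 2"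
    define B where "B = (a (e k) - a (e' k)) * (y (p (e k)) - y (p (e' k))) / 2"
    have "a (e k) * y (p (e k)) + a (e' k) * y (p (e' k)) = A + B"
      "a (e k) * y (p (e' k)) + a (e' k) * y (p (e k)) = A - B"
      unfolding A_def B_def by argo+
    then have "g p = cis (A + B)" "g (p \<circ> Transposition.transpose (e k) (e' k)) = cis (A - B)"
      by (simp_all add: g_def)
    moreover have "(cis (A + B) + cis (A - B)) / 2 = cis A * cos B"
      by (simp add: complex_eq_iff cos_add cos_diff sin_add sin_diff)
    ultimately show ?thesis by (simp add: h_def A_def B_def)
  qed
  have "perm_avg E (\<lambda>p. \<Psi> p * (\<Prod>k\<in>insert k P. cis (a (e k) * y (p (e k)) + a (e' k) * y (p (e' k)))))
    = perm_avg E (\<lambda>p. (\<Psi> p * g p) * (\<Prod>k\<in>P. cis (a (e k) * y (p (e k)) + a (e' k) * y (p (e' k)))))"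
    using insert.hyps by (simp add: g_def mult.assoc)
  also have "\<dots> = perm_avg E (\<lambda>p. (\<Psi> p * g p) * Z p)"
    unfolding Z_def
  proof (rule insert.IH)
    fix p i assume i: "p permutes E" "i \<in> P"
    have "\<Psi> (p \<circ> Transposition.transpose (e i) (e' i)) = \<Psi> p" using i by (intro insert.prems(3)) auto
    moreover have "g (p \<circ> Transposition.transpose (e i) (e' i)) = g p" using i by (simp add: g_def fixed')
    ultimately show "\<Psi> (p \<circ> Transposition.transpose (e i) (e' i)) * g (p \<circ> Transposition.transpose (e i) (e' i))
      = \<Psi> p * g p" by (simp only:)
  qed (use insert.prems in auto)
  also have "\<dots> = perm_avg E (\<lambda>p. ((\<Psi> p * g p) * Z p + (\<Psi> (p \<circ> Transposition.transpose (e k) (e' k)) *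
      g (p \<circ> Transposition.transpose (e k) (e' k))) * Z (p \<circ> Transposition.transpose (e k) (e' k))) / 2)"
    by (rule perm_avg_swap_sym[OF kE])
  also have "\<dots> = perm_avg E (\<lambda>p. \<Psi> p * (h p * Z p))"
  proof (rule perm_avg_cong)
    fix p assume p: "p permutes E"
    have \<Psi>: "\<Psi> (p \<circ> Transposition.transpose (e k) (e' k)) = \<Psi> p" using p by (intro insert.prems(3)) auto
    show "((\<Psi> p * g p) * Z p + (\<Psi> (p \<circ> Transposition.transpose (e k) (e' k)) *
      g (p \<circ> Transposition.transpose (e k) (e' k))) * Z (p \<circ> Transposition.transpose (e k) (e' k))) / 2
      = \<Psi> p * (h p * Z p)"
      unfolding \<Psi> Zinv gswap[symmetric] by (simp add: algebra_simps)
  qed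
  also have "\<dots> = perm_avg E (\<lambda>p. \<Psi> p * (\<Prod>k\<in>insert k P. cis ((a (e k) + a (e' k)) * (y (p (e k)) + y (p (e' k))) / 2)
         * cos ((a (e k) - a (e' k)) * (y (p (e k)) - y (p (e' k))) / 2)))"
    unfolding h_def Z_def prod.insert[OF insert.hyps] ..
  finally show ?case .
qed

text \<open>Pairs are revealed one by one. A cosine of argument B loses B^2 / 4, that is 1/16 of the
  squared increment \<open>s^2 * \<Delta>^2 * (y (p (e k)) - y (p (e' k)))^2\<close>, and unrevealed
  slots differ by \<open>3/4 * V\<close> in mean square: together 3/64. The bound on
  \<open>s\<close> keeps B in [-1, 1].\<close>

lemma perm_avg_prod_cos_le:
  fixes y a :: "'a \<Rightarrow> real" and V s \<kappa> b :: real
  assumes fin: "finite E" and sum0: "(\<Sum>e\<in>E. y e) = 0" and var: "(\<Sum>e\<in>E. (y e)\<^sup>2) = V * card E"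
    and bd: "\<And>e. e \<in> E \<Longrightarrow> \<bar>y e\<bar> \<le> \<kappa>"
    and "finite P" and E: "\<And>k. k \<in> P \<Longrightarrow> e k \<in> E \<and> e' k \<in> E \<and> e k \<noteq> e' k"
    and dis: "\<And>i k. i \<in> P \<Longrightarrow> k \<in> P \<Longrightarrow> i \<noteq> k \<Longrightarrow> e i \<noteq> e k \<and> e i \<noteq> e' k \<and> e' i \<noteq> e k \<and> e' i \<noteq> e' k"
    and card: "8 * card P \<le> card E"
    and a: "\<And>k. k \<in> P \<Longrightarrow> \<bar>a (e k) - a (e' k)\<bar> \<le> 2 * b" and s: "0 \<le> s" "2 * s * b * \<kappa> \<le> 1"
  shows "perm_avg E (\<lambda>p. of_bool ((\<Sum>i\<in>e ` P \<union> e' ` P. (y (p i))\<^sup>2) \<le> 3/8 * (V * card E)) *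
        (\<Prod>k\<in>P. \<bar>cos (s * (a (e k) - a (e' k)) * (y (p (e k)) - y (p (e' k))) / 2)\<bar>))
     \<le> exp (- (3/64 * V * (\<Sum>k\<in>P. (a (e k) - a (e' k))\<^sup>2)) * s\<^sup>2)"
  using \<open>finite P\<close> E dis card a
proof (induction P rule: finite_induct)
  case empty
  then show ?case by (simp add: perm_avg_le_const[OF fin])
next
  case (insert k P)
  define \<Phi> where "\<Phi> p = of_bool ((\<Sum>i\<in>e ` P \<union> e' ` P. (y (p i))\<^sup>2) \<le> 3/8 * (V * card E)) *
        (\<Prod>k\<in>P. \<bar>cos (s * (a (e k) - a (e' k)) * (y (p (e k)) - y (p (e' k))) / 2)\<bar>)" for p
  define \<Delta> where "\<Delta> = a (e k) - a (e' k)"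
  have kE: "e k \<in> E" "e' k \<in> E" "e k \<noteq> e' k" using insert.prems(1)[of k] by auto
  have \<Phi>nn: "0 \<le> \<Phi> p" for p unfolding \<Phi>_def by (intro mult_nonneg_nonneg prod_nonneg) auto
  have cardP: "card (insert k P) = Suc (card P)" using insert.hyps by simp
  have cardT: "4 * card (e ` P \<union> e' ` P) \<le> card E"
  proof -
    have "card (e ` P \<union> e' ` P) \<le> card P + card P"
      by (rule order_trans[OF card_Un_le add_mono[OF card_image_le card_image_le]]) (use insert.hyps in auto)
    then show ?thesis using insert.prems(3) cardP by simp
  qed
  have "0 \<le> V * real (card E)" unfolding var[symmetric] by (intro sum_nonneg) auto
  moreover have "0 < real (card E)" using kE fin by (auto simp: card_gt_0_iff)
  ultimately have V0: "0 \<le> V" by (simp add: zero_le_mult_iff)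
  have "perm_avg E (\<lambda>p. of_bool ((\<Sum>i\<in>e ` insert k P \<union> e' ` insert k P. (y (p i))\<^sup>2) \<le> 3/8 * (V * card E)) *
        (\<Prod>k\<in>insert k P. \<bar>cos (s * (a (e k) - a (e' k)) * (y (p (e k)) - y (p (e' k))) / 2)\<bar>))
     \<le> perm_avg E (\<lambda>p. \<Phi> p - (s\<^sup>2 * \<Delta>\<^sup>2 / 16) * (\<Phi> p * (y (p (e k)) - y (p (e' k)))\<^sup>2))"
  proof (rule perm_avg_mono)
    fix p assume p: "p permutes E"
    define B where "B = s * \<Delta> * (y (p (e k)) - y (p (e' k))) / 2"
    have "\<bar>B\<bar> \<le> 1"
    proof -
      have "\<bar>y (p (e k)) - y (p (e' k))\<bar> \<le> 2 * \<kappa>"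
        using bd[of "p (e k)"] bd[of "p (e' k)"] kE permutes_in_image[OF p] by fastforce
      moreover have "\<bar>\<Delta>\<bar> \<le> 2 * b" unfolding \<Delta>_def using insert.prems(4)[of k] by simp
      ultimately have "\<bar>\<Delta>\<bar> * \<bar>y (p (e k)) - y (p (e' k))\<bar> \<le> (2 * b) * (2 * \<kappa>)"
        by (intro mult_mono) auto
      then have "s / 2 * (\<bar>\<Delta>\<bar> * \<bar>y (p (e k)) - y (p (e' k))\<bar>) \<le> s / 2 * ((2 * b) * (2 * \<kappa>))"
        using s by (intro mult_left_mono) auto
      then show ?thesis using s by (simp add: B_def abs_mult mult_ac)
    qed
    then have "\<bar>cos B\<bar> \<le> 1 - B\<^sup>2 / 4" by (rule abs_cos_le)
    then have "\<Phi> p * \<bar>cos B\<bar> \<le> \<Phi> p * (1 - B\<^sup>2 / 4)" using \<Phi>nn by (rule mult_left_mono)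
    also have "\<dots> = \<Phi> p - (s\<^sup>2 * \<Delta>\<^sup>2 / 16) * (\<Phi> p * (y (p (e k)) - y (p (e' k)))\<^sup>2)"
    proof -
      have "B\<^sup>2 = s\<^sup>2 * \<Delta>\<^sup>2 * (y (p (e k)) - y (p (e' k)))\<^sup>2 / 4"
        by (simp add: B_def power_mult_distrib power_divide)
      then show ?thesis by (simp add: right_diff_distrib)
    qed
    finally have *: "\<Phi> p * \<bar>cos B\<bar> \<le> \<Phi> p - (s\<^sup>2 * \<Delta>\<^sup>2 / 16) * (\<Phi> p * (y (p (e k)) - y (p (e' k)))\<^sup>2)" .
    have "(\<Sum>i\<in>e ` P \<union> e' ` P. (y (p i))\<^sup>2) \<le> (\<Sum>i\<in>e ` insert k P \<union> e' ` insert k P. (y (p i))\<^sup>2)"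
      using insert.hyps by (intro sum_mono2) auto
    then have "of_bool ((\<Sum>i\<in>e ` insert k P \<union> e' ` insert k P. (y (p i))\<^sup>2) \<le> 3/8 * (V * card E)) *
        (\<Prod>k\<in>P. \<bar>cos (s * (a (e k) - a (e' k)) * (y (p (e k)) - y (p (e' k))) / 2)\<bar>) \<le> \<Phi> p"
      unfolding \<Phi>_def by (intro mult_right_mono prod_nonneg) auto
    then have "of_bool ((\<Sum>i\<in>e ` insert k P \<union> e' ` insert k P. (y (p i))\<^sup>2) \<le> 3/8 * (V * card E)) *
        (\<Prod>k\<in>P. \<bar>cos (s * (a (e k) - a (e' k)) * (y (p (e k)) - y (p (e' k))) / 2)\<bar>) * \<bar>cos B\<bar> \<le> \<Phi> p * \<bar>cos B\<bar>"
      by (intro mult_right_mono) auto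
    moreover have "(\<Prod>k\<in>insert k P. \<bar>cos (s * (a (e k) - a (e' k)) * (y (p (e k)) - y (p (e' k))) / 2)\<bar>)
      = (\<Prod>k\<in>P. \<bar>cos (s * (a (e k) - a (e' k)) * (y (p (e k)) - y (p (e' k))) / 2)\<bar>) * \<bar>cos B\<bar>"
      unfolding prod.insert[OF insert.hyps] B_def \<Delta>_def by (rule mult.commute)
    ultimately show "of_bool ((\<Sum>i\<in>e ` insert k P \<union> e' ` insert k P. (y (p i))\<^sup>2) \<le> 3/8 * (V * card E)) *
        (\<Prod>k\<in>insert k P. \<bar>cos (s * (a (e k) - a (e' k)) * (y (p (e k)) - y (p (e' k))) / 2)\<bar>)
       \<le> \<Phi> p - (s\<^sup>2 * \<Delta>\<^sup>2 / 16) * (\<Phi> p * (y (p (e k)) - y (p (e' k)))\<^sup>2)"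
      using * by (simp only: mult.assoc)
  qed
  also have "\<dots> = perm_avg E \<Phi> - (s\<^sup>2 * \<Delta>\<^sup>2 / 16) * perm_avg E (\<lambda>p. \<Phi> p * (y (p (e k)) - y (p (e' k)))\<^sup>2)"
    by (simp only: perm_avg_diff perm_avg_cmult)
  also have "\<dots> \<le> perm_avg E \<Phi> - (s\<^sup>2 * \<Delta>\<^sup>2 / 16) * (3/4 * V * perm_avg E \<Phi>)"
  proof (intro diff_left_mono mult_left_mono)
    show "3/4 * V * perm_avg E \<Phi> \<le> perm_avg E (\<lambda>p. \<Phi> p * (y (p (e k)) - y (p (e' k)))\<^sup>2)"
    proof (rule perm_avg_diff_square_ge[OF fin sum0 var _ cardT])
      show "e ` P \<union> e' ` P \<subseteq> E" using insert.prems(1) by auto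
      show "e k \<in> E - (e ` P \<union> e' ` P)" "e' k \<in> E - (e ` P \<union> e' ` P)"
        using kE insert.prems(2)[of k] insert.hyps(2) by auto
      show "e k \<noteq> e' k" by (rule kE)
      show "(\<Sum>i\<in>e ` P \<union> e' ` P. (y (p i))\<^sup>2) \<le> 3/8 * (V * card E)" if "\<Phi> p \<noteq> 0" for p
        using that by (simp add: \<Phi>_def split: if_splits)
      fix p \<tau> assume \<tau>: "\<tau> permutes (E - (e ` P \<union> e' ` P))"
      have "\<tau> i = i" if "i \<in> e ` P \<union> e' ` P" for i using \<tau> that by (auto intro: permutes_not_in)
      then show "\<Phi> (p \<circ> \<tau>) = \<Phi> p" by (simp add: \<Phi>_def)
    qed (rule \<Phi>nn)
  qed simp
  also have "\<dots> = (1 - 3/64 * V * \<Delta>\<^sup>2 * s\<^sup>2) * perm_avg E \<Phi>" by (simp add: algebra_simps)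
  also have "\<dots> \<le> exp (- (3/64 * V * \<Delta>\<^sup>2 * s\<^sup>2)) * perm_avg E \<Phi>"
    using exp_ge_add_one_self[of "- (3/64 * V * \<Delta>\<^sup>2 * s\<^sup>2)"]
    by (intro mult_right_mono perm_avg_nonneg \<Phi>nn) simp
  also have "\<dots> \<le> exp (- (3/64 * V * \<Delta>\<^sup>2 * s\<^sup>2)) * exp (- (3/64 * V * (\<Sum>k\<in>P. (a (e k) - a (e' k))\<^sup>2)) * s\<^sup>2)"
    unfolding \<Phi>_def using insert.prems cardP by (intro mult_left_mono insert.IH) auto
  also have "\<dots> = exp (- (3/64 * V * (\<Sum>k\<in>insert k P. (a (e k) - a (e' k))\<^sup>2)) * s\<^sup>2)"
    unfolding exp_add[symmetric] sum.insert[OF insert.hyps] \<Delta>_def[symmetric] by (simp add: algebra_simps)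
  finally show ?case .
qed

text \<open>Slots outside the pairs, and the shift \<open>c\<close>, contribute a factor of modulus
  one that no pair swap touches; taking absolute values leaves the product of cosines.\<close>

lemma perm_avg_char_function_le:
  fixes y a :: "'a \<Rightarrow> real" and V s \<kappa> b c :: real
  assumes fin: "finite E" and sum0: "(\<Sum>e\<in>E. y e) = 0" and var: "(\<Sum>e\<in>E. (y e)\<^sup>2) = V * card E"
    and bd: "\<And>e. e \<in> E \<Longrightarrow> \<bar>y e\<bar> \<le> \<kappa>"
    and finP: "finite P" and E: "\<And>k. k \<in> P \<Longrightarrow> e k \<in> E \<and> e' k \<in> E \<and> e k \<noteq> e' k"
    and dis: "\<And>i k. i \<in> P \<Longrightarrow> k \<in> P \<Longrightarrow> i \<noteq> k \<Longrightarrow> e i \<noteq> e k \<and> e i \<noteq> e' k \<and> e' i \<noteq> e k \<and> e' i \<noteq> e' k"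
    and card: "8 * card P \<le> card E"
    and a: "\<And>k. k \<in> P \<Longrightarrow> \<bar>a (e k) - a (e' k)\<bar> \<le> 2 * b" and s: "0 \<le> s" "2 * s * b * \<kappa> \<le> 1"
  shows "perm_avg E (\<lambda>p. of_bool ((\<Sum>i\<in>e ` P \<union> e' ` P. (y (p i))\<^sup>2) \<le> 3/8 * (V * card E)) *
        cos (s * ((\<Sum>i\<in>E. a i * y (p i)) - c)))
     \<le> exp (- ((3/64 * V * (\<Sum>k\<in>P. (a (e k) - a (e' k))\<^sup>2)) * s\<^sup>2))"
proof -
  define T where "T = e ` P \<union> e' ` P"
  define G where "G p \<longleftrightarrow> (\<Sum>i\<in>T. (y (p i))\<^sup>2) \<le> 3/8 * (V * card E)" for p :: "'a \<Rightarrow> 'a"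
  define g where "g p k = cis (s * a (e k) * y (p (e k)) + s * a (e' k) * y (p (e' k)))" for p :: "'a \<Rightarrow> 'a" and k
  define \<Psi> where "\<Psi> p = of_bool (G p) * cis (s * ((\<Sum>i\<in>E - T. a i * y (p i)) - c))" for p
  have TE: "T \<subseteq> E" using E by (auto simp: T_def)
  have finT: "finite T" using finP by (simp add: T_def)
  have sumT: "(\<Sum>i\<in>T. f i) = (\<Sum>k\<in>P. f (e k) + f (e' k))" for f :: "'a \<Rightarrow> real"
  proof -
    have inj: "inj_on e P" "inj_on e' P" using dis by (auto intro!: inj_onI)
    have "e ` P \<inter> e' ` P = {}" using dis E by auto
    then have "(\<Sum>i\<in>T. f i) = (\<Sum>i\<in>e ` P. f i) + (\<Sum>i\<in>e' ` P. f i)"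
      unfolding T_def using finP by (intro sum.union_disjoint) auto
    then show ?thesis by (simp add: sum.reindex[OF inj(1)] sum.reindex[OF inj(2)] sum.distrib)
  qed
  have cis_sum: "cis (\<Sum>k\<in>A. f k) = (\<Prod>k\<in>A. cis (f k))" if "finite A" for f :: "'b \<Rightarrow> real" and A
    using that by (induction A rule: finite_induct) (auto simp: cis_mult[symmetric])
  have split: "of_bool (G p) * cis (s * ((\<Sum>i\<in>E. a i * y (p i)) - c)) = \<Psi> p * (\<Prod>k\<in>P. g p k)" for p
  proof -
    have "s * ((\<Sum>i\<in>E. a i * y (p i)) - c) = s * ((\<Sum>i\<in>E - T. a i * y (p i)) - c)
        + (\<Sum>k\<in>P. s * a (e k) * y (p (e k)) + s * a (e' k) * y (p (e' k)))"
      unfolding sum.subset_diff[OF TE fin] sumT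
      by (simp add: algebra_simps sum_distrib_left sum.distrib)
    then show ?thesis
      by (simp only: \<Psi>_def g_def cis_sum[OF finP, symmetric] mult.assoc cis_mult)
  qed
  \<comment> \<open>The indicator involves the revealed slots only through their total, which a swap
    inside \<open>T\<close> does not change.\<close>
  have swapinv: "\<Psi> (p \<circ> Transposition.transpose (e k) (e' k)) = \<Psi> p" if k: "k \<in> P" for p k
  proof -
    have kT: "e k \<in> T" "e' k \<in> T" using k by (auto simp: T_def)
    have perm: "Transposition.transpose (e k) (e' k) permutes T" using kT by (rule permutes_swap_id)
    have "(\<Sum>i\<in>T. (y ((p \<circ> Transposition.transpose (e k) (e' k)) i))\<^sup>2) = (\<Sum>i\<in>T. (y (p i))\<^sup>2)"
      using sum.permute[OF perm, of "\<lambda>i. (y (p i))\<^sup>2"] by (simp add: comp_def)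
    moreover have "(\<Sum>i\<in>E - T. a i * y ((p \<circ> Transposition.transpose (e k) (e' k)) i)) = (\<Sum>i\<in>E - T. a i * y (p i))"
      using kT by (intro sum.cong refl) (auto simp: Transposition.transpose_def)
    ultimately show ?thesis by (simp only: \<Psi>_def G_def)
  qed
  have "perm_avg E (\<lambda>p. of_bool (G p) * cos (s * ((\<Sum>i\<in>E. a i * y (p i)) - c)))
      = Re (perm_avg E (\<lambda>p. of_bool (G p) * cis (s * ((\<Sum>i\<in>E. a i * y (p i)) - c))))"
    unfolding Re_perm_avg by (intro perm_avg_cong) simp
  also have "\<dots> \<le> norm (perm_avg E (\<lambda>p. \<Psi> p * (\<Prod>k\<in>P. g p k)))"
    unfolding split by (rule complex_Re_le_cmod)
  also have "perm_avg E (\<lambda>p. \<Psi> p * (\<Prod>k\<in>P. g p k)) =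
    perm_avg E (\<lambda>p. \<Psi> p * (\<Prod>k\<in>P. cis ((s * a (e k) + s * a (e' k)) * (y (p (e k)) + y (p (e' k))) / 2)
         * cos ((s * a (e k) - s * a (e' k)) * (y (p (e k)) - y (p (e' k))) / 2)))"
    unfolding g_def using E dis swapinv
    by (intro perm_avg_cis_pairs[where a = "\<lambda>i. s * a i"] finP) auto
  also have "norm \<dots> \<le> perm_avg E (\<lambda>p. norm (\<Psi> p * (\<Prod>k\<in>P. cis ((s * a (e k) + s * a (e' k)) * (y (p (e k)) + y (p (e' k))) / 2)
         * cos ((s * a (e k) - s * a (e' k)) * (y (p (e k)) - y (p (e' k))) / 2))))"
    by (rule norm_perm_avg_le)
  also have "\<dots> = perm_avg E (\<lambda>p. of_bool (G p) * (\<Prod>k\<in>P. \<bar>cos (s * (a (e k) - a (e' k)) * (y (p (e k)) - y (p (e' k))) / 2)\<bar>))"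
    by (intro perm_avg_cong)
       (simp add: \<Psi>_def norm_mult prod_norm[symmetric] right_diff_distrib)
  also have "\<dots> \<le> exp (- (3/64 * V * (\<Sum>k\<in>P. (a (e k) - a (e' k))\<^sup>2)) * s\<^sup>2)"
    unfolding G_def T_def
    by (rule perm_avg_prod_cos_le[OF fin sum0 var bd finP E dis card a s])
  finally show ?thesis by (simp add: G_def T_def)
qed

text \<open>The lower limit \<open>2 * b * \<kappa>\<close> on \<open>t\<close> is the resolution of
  the method: frequencies up to \<open>1 / t\<close> must keep all cosine arguments in [-1, 1]. It
  is the origin of the term with \<open>n^(-1/2)\<close> in the theorem.\<close>

lemma perm_avg_small_ball_pairs:
  fixes y a :: "'a \<Rightarrow> real" and V \<kappa> b c t :: real
  assumes fin: "finite E" and sum0: "(\<Sum>e\<in>E. y e) = 0" and var: "(\<Sum>e\<in>E. (y e)\<^sup>2) = V * card E"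
    and bd: "\<And>e. e \<in> E \<Longrightarrow> \<bar>y e\<bar> \<le> \<kappa>" and \<kappa>: "0 < \<kappa>"
    and finP: "finite P" and E: "\<And>k. k \<in> P \<Longrightarrow> e k \<in> E \<and> e' k \<in> E \<and> e k \<noteq> e' k"
    and dis: "\<And>i k. i \<in> P \<Longrightarrow> k \<in> P \<Longrightarrow> i \<noteq> k \<Longrightarrow> e i \<noteq> e k \<and> e i \<noteq> e' k \<and> e' i \<noteq> e k \<and> e' i \<noteq> e' k"
    and card: "8 * card P \<le> card E"
    and a: "\<And>k. k \<in> P \<Longrightarrow> \<bar>a (e k) - a (e' k)\<bar> \<le> 2 * b"
    and t: "0 < t" "2 * b * \<kappa> \<le> t"
    and V: "0 < V" and D: "0 < D" "D \<le> (\<Sum>k\<in>P. (a (e k) - a (e' k))\<^sup>2)"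
  shows "perm_avg E (\<lambda>p. of_bool (\<bar>(\<Sum>i\<in>E. a i * y (p i)) - c\<bar> \<le> t))
     \<le> 8 * t / sqrt (3/64 * V * D) + exp (- (V * card E / (64 * \<kappa>\<^sup>2)))"
proof -
  define T where "T = e ` P \<union> e' ` P"
  define G where "G p \<longleftrightarrow> (\<Sum>i\<in>T. (y (p i))\<^sup>2) \<le> 3/8 * (V * card E)" for p :: "'a \<Rightarrow> 'a"
  have TE: "T \<subseteq> E" using E by (auto simp: T_def)
  have cardT: "4 * card T \<le> card E"
  proof -
    have "card T \<le> card P + card P" unfolding T_def
      by (rule order_trans[OF card_Un_le add_mono[OF card_image_le card_image_le]]) (use finP in auto)
    then show ?thesis using card by simp
  qed
  have "perm_avg E (\<lambda>p. of_bool (\<bar>(\<Sum>i\<in>E. a i * y (p i)) - c\<bar> \<le> t) :: real)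
     \<le> perm_avg E (\<lambda>p. of_bool (G p) * of_bool (\<bar>(\<Sum>i\<in>E. a i * y (p i)) - c\<bar> \<le> t)
        + of_bool (3/8 * (V * card E) < (\<Sum>i\<in>T. (y (p i))\<^sup>2)))"
    by (intro perm_avg_mono) (auto simp: G_def)
  also have "\<dots> = perm_avg E (\<lambda>p. of_bool (G p) * of_bool (\<bar>(\<Sum>i\<in>E. a i * y (p i)) - c\<bar> \<le> t))
       + perm_avg E (\<lambda>p. of_bool (3/8 * (V * card E) < (\<Sum>i\<in>T. (y (p i))\<^sup>2)))"
    by (rule perm_avg_add)
  also have "\<dots> \<le> 8 * t / sqrt (3/64 * V * D) + exp (- (V * card E / (64 * \<kappa>\<^sup>2)))"
  proof (rule add_mono)
    show "perm_avg E (\<lambda>p. of_bool (3/8 * (V * card E) < (\<Sum>i\<in>T. (y (p i))\<^sup>2))) \<le> exp (- (V * card E / (64 * \<kappa>\<^sup>2)))"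
      by (rule perm_avg_sum_squares_upper_tail[OF fin var bd \<kappa> TE cardT])
    show "perm_avg E (\<lambda>p. of_bool (G p) * of_bool (\<bar>(\<Sum>i\<in>E. a i * y (p i)) - c\<bar> \<le> t)) \<le> 8 * t / sqrt (3/64 * V * D)"
    proof (rule perm_avg_esseen[OF fin t(1)])
      fix s assume s: "0 \<le> s" "s \<le> 1 / t"
      have sb: "2 * s * b * \<kappa> \<le> 1"
      proof -
        have "s * (2 * b * \<kappa>) \<le> s * t" using s t by (intro mult_left_mono) auto
        also have "\<dots> \<le> 1" using s t by (simp add: le_divide_eq)
        finally show ?thesis by (simp add: mult_ac)
      qed
      have "perm_avg E (\<lambda>p. of_bool (G p) * cos (s * ((\<Sum>i\<in>E. a i * y (p i)) - c)))
         \<le> exp (- ((3/64 * V * (\<Sum>k\<in>P. (a (e k) - a (e' k))\<^sup>2)) * s\<^sup>2))"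
        unfolding G_def T_def
        by (rule perm_avg_char_function_le[OF fin sum0 var bd finP E dis card a s(1) sb])
      also have "\<dots> \<le> exp (- ((3/64 * V * D) * s\<^sup>2))"
        using D(2) V by (simp add: mult_right_mono mult_left_mono)
      finally show "perm_avg E (\<lambda>p. of_bool (G p) * cos (s * ((\<Sum>i\<in>E. a i * y (p i)) - c)))
        \<le> exp (- (3/64 * V * D * s\<^sup>2))" .
    qed (use V D in auto)
  qed
  finally show ?thesis .
qed

section \<open>Matchings and the small ball bound\<close>

text \<open>A random matching captures the average pairwise spread, so some matching does at least as well.\<close>

lemma exists_spread_matching:
  fixes a :: "'a \<Rightarrow> real" and d :: nat and \<sigma> :: real
  assumes finR: "finite R" and d: "2 * d \<le> card R"
    and spread: "card R * \<sigma> \<le> (\<Sum>u\<in>R. \<Sum>v\<in>R. (a u - a v)\<^sup>2)" and \<sigma>: "0 \<le> \<sigma>"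
  obtains e e' :: "nat \<Rightarrow> 'a" where
    "\<And>k. k < d \<Longrightarrow> e k \<in> R \<and> e' k \<in> R \<and> e k \<noteq> e' k"
    "\<And>i k. i < d \<Longrightarrow> k < d \<Longrightarrow> i \<noteq> k \<Longrightarrow> e i \<noteq> e k \<and> e i \<noteq> e' k \<and> e' i \<noteq> e k \<and> e' i \<noteq> e' k"
    "d * \<sigma> \<le> card R * (\<Sum>k<d. (a (e k) - a (e' k))\<^sup>2)"
proof -
  obtain r where r: "bij_betw r {0..<card R} R" using ex_bij_betw_nat_finite[OF finR] by auto
  have rR: "r i \<in> R" if "i < card R" for i using r that by (auto simp: bij_betw_def)
  have rinj: "r i = r j \<longleftrightarrow> i = j" if "i < card R" "j < card R" for i j
    using r that by (auto simp: bij_betw_def inj_on_def)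
  define f where "f p = (\<Sum>k<d. (a (p (r (2 * k))) - a (p (r (2 * k + 1))))\<^sup>2)" for p
  define n where "n = real (card R)"
  have avg: "n * \<sigma> \<le> n\<^sup>2 * perm_avg R (\<lambda>p. (a (p (r (2 * k))) - a (p (r (2 * k + 1))))\<^sup>2)" if k: "k < d" for k
  proof -
    define c where "c = perm_avg R (\<lambda>p. (a (p (r (2 * k))) - a (p (r (2 * k + 1))))\<^sup>2)"
    have c0: "0 \<le> c" unfolding c_def by (intro perm_avg_nonneg) auto
    have k2: "2 * k < card R" "2 * k + 1 < card R" using k d by auto
    have "n * \<sigma> \<le> (\<Sum>u\<in>R. \<Sum>v\<in>R. (a u - a v)\<^sup>2)" using spread by (simp add: n_def)
    also have "\<dots> = perm_avg R (\<lambda>p. \<Sum>u\<in>R. \<Sum>v\<in>R. (a u - a v)\<^sup>2)" by (rule perm_avg_const[OF finR, symmetric])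
    also have "\<dots> = perm_avg R (\<lambda>p. \<Sum>u\<in>R. \<Sum>v\<in>R. (a (p u) - a (p v))\<^sup>2)"
    proof (rule perm_avg_cong)
      fix p assume p: "p permutes R"
      show "(\<Sum>u\<in>R. \<Sum>v\<in>R. (a u - a v)\<^sup>2) = (\<Sum>u\<in>R. \<Sum>v\<in>R. (a (p u) - a (p v))\<^sup>2)"
        using sum.permute[OF p, of "\<lambda>u. \<Sum>v\<in>R. (a u - a v)\<^sup>2"] sum.permute[OF p, of "\<lambda>v. (a _ - a v)\<^sup>2"]
        by (simp add: comp_def)
    qed
    also have "\<dots> = (\<Sum>u\<in>R. \<Sum>v\<in>R. perm_avg R (\<lambda>p. (a (p u) - a (p v))\<^sup>2))"
      by (simp only: perm_avg_sum)
    also have "\<dots> \<le> (\<Sum>u\<in>R. \<Sum>v\<in>R. c)"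
    proof (intro sum_mono)
      fix u v assume uv: "u \<in> R" "v \<in> R"
      show "perm_avg R (\<lambda>p. (a (p u) - a (p v))\<^sup>2) \<le> c"
      proof (cases "u = v")
        case True
        then show ?thesis using c0 perm_avg_const[OF finR, of "0::real"] by simp
      next
        case False
        have "perm_avg R (\<lambda>p. 1 * (a (p u) - a (p v))\<^sup>2) = perm_avg R (\<lambda>p. 1 * (a (p (r (2 * k))) - a (p (r (2 * k + 1))))\<^sup>2)"
          by (rule perm_avg_pair_exchange[where f = "\<lambda>x y. (a x - a y)\<^sup>2" and U = R])
             (use uv False rR k2 rinj in auto)
        then show ?thesis by (simp add: c_def)
      qed
    qed
    also have "\<dots> = n\<^sup>2 * c" by (simp add: n_def power2_eq_square)
    finally show ?thesis by (simp add: c_def)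
  qed
  have "\<exists>p. p permutes R \<and> d * \<sigma> \<le> n * f p"
  proof (rule ccontr)
    assume "\<not> (\<exists>p. p permutes R \<and> d * \<sigma> \<le> n * f p)"
    then have less: "n * f p < d * \<sigma>" if "p permutes R" for p using that by (auto simp: not_le)
    have "n \<noteq> 0"
    proof
      assume "n = 0"
      then have "d = 0" using d by (simp add: n_def)
      then show False using less[OF permutes_id] \<open>n = 0\<close> by simp
    qed
    then have "0 < n" by (simp add: n_def)
    have "n * (d * \<sigma>) \<le> n * (n * perm_avg R f)"
    proof -
      have "n * (d * \<sigma>) = (\<Sum>k<d. n * \<sigma>)" by simp
      also have "\<dots> \<le> (\<Sum>k<d. n\<^sup>2 * perm_avg R (\<lambda>p. (a (p (r (2 * k))) - a (p (r (2 * k + 1))))\<^sup>2))"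
        by (intro sum_mono avg) auto
      also have "\<dots> = n\<^sup>2 * perm_avg R f" unfolding f_def perm_avg_sum sum_distrib_left ..
      finally show ?thesis by (simp add: power2_eq_square)
    qed
    then have "d * \<sigma> \<le> n * perm_avg R f" using \<open>0 < n\<close> by simp
    also have "\<dots> = perm_avg R (\<lambda>p. n * f p)" by (rule perm_avg_cmult[symmetric])
    also have "\<dots> < d * \<sigma>"
    proof -
      have "(\<Sum>p | p permutes R. n * f p) < (\<Sum>p | p permutes R. d * \<sigma>)"
        using less permutes_id[of R] by (intro sum_strict_mono finite_permutations finR) blast+
      then show ?thesis unfolding perm_avg_def using card_permutes_pos[OF finR]
        by (simp add: divide_less_eq mult.commute)
    qed
    finally show False by simp
  qed
  then obtain p where p: "p permutes R" "d * \<sigma> \<le> n * f p" by auto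
  have pinj: "p u = p v \<longleftrightarrow> u = v" for u v using permutes_inj[OF p(1)] by (auto simp: inj_def)
  show ?thesis
  proof (rule that[of "\<lambda>k. p (r (2 * k))" "\<lambda>k. p (r (2 * k + 1))"])
    show "d * \<sigma> \<le> card R * (\<Sum>k<d. (a (p (r (2 * k))) - a (p (r (2 * k + 1))))\<^sup>2)"
      using p(2) by (simp add: f_def n_def)
    fix k assume "k < d"
    then have k: "2 * k < card R" "2 * k + 1 < card R" using d by auto
    show "p (r (2 * k)) \<in> R \<and> p (r (2 * k + 1)) \<in> R \<and> p (r (2 * k)) \<noteq> p (r (2 * k + 1))"
      using k rR rinj permutes_in_image[OF p(1)] pinj by auto
    fix i assume "i < d" "i \<noteq> k"
    then have i: "2 * i < card R" "2 * i + 1 < card R" using d by auto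
    have "2 * i \<noteq> 2 * k + 1" "2 * i + 1 \<noteq> 2 * k" by presburger+
    then show "p (r (2 * i)) \<noteq> p (r (2 * k)) \<and> p (r (2 * i)) \<noteq> p (r (2 * k + 1)) \<and>
        p (r (2 * i + 1)) \<noteq> p (r (2 * k)) \<and> p (r (2 * i + 1)) \<noteq> p (r (2 * k + 1))"
      unfolding pinj using \<open>i \<noteq> k\<close> i k by (auto simp: rinj)
  qed
qed

text \<open>Coordinates in \<open>R\<close> are at most \<open>1 / sqrt m\<close>, so pairs inside
  \<open>R\<close> can be resolved down to \<open>2 * \<kappa> / sqrt m\<close>; this amount is
  added to the radius.\<close>

lemma perm_avg_small_ball_real:
  fixes a y :: "'a \<Rightarrow> real" and V \<kappa> m \<rho> c \<epsilon> :: real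
  assumes fin: "finite E" and n: "16 \<le> card E" and sum0: "(\<Sum>e\<in>E. y e) = 0"
    and var: "(\<Sum>e\<in>E. (y e)\<^sup>2) = V * card E"
    and bd: "\<And>e. e \<in> E \<Longrightarrow> \<bar>y e\<bar> \<le> \<kappa>" and \<kappa>: "0 < \<kappa>" and V: "1/4 \<le> V"
    and m: "0 < m" and \<rho>: "0 < \<rho>" and \<epsilon>: "0 \<le> \<epsilon>"
    and R: "R \<subseteq> E" "3 * card E \<le> 4 * card R" and small: "\<And>u. u \<in> R \<Longrightarrow> \<bar>a u\<bar> \<le> 1 / sqrt m"
    and spread: "card R * \<rho>\<^sup>2 \<le> (\<Sum>u\<in>R. \<Sum>v\<in>R. (a u - a v)\<^sup>2)"
  shows "perm_avg E (\<lambda>p. of_bool (\<bar>(\<Sum>i\<in>E. a i * y (p i)) - c\<bar> \<le> \<epsilon>))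
     \<le> 300 * (\<epsilon> + 2 * \<kappa> / sqrt m) / \<rho> + exp (- (card E / (256 * \<kappa>\<^sup>2)))"
proof -
  \<comment> \<open>The 2d slots of the matching fill at most a quarter of \<open>E\<close>, and
    \<open>16 \<le> card E\<close> keeps \<open>d\<close> above \<open>card E / 16\<close> despite
    the integer division.\<close>
  define d where "d = card E div 8"
  define t where "t = \<epsilon> + 2 * \<kappa> / sqrt m"
  have finR: "finite R" using R fin by (auto intro: finite_subset)
  have cardR: "card R \<le> card E" "0 < card R" using R n card_mono[OF fin R(1)] by auto
  have d: "2 * d \<le> card R" "8 * d \<le> card E" using R(2) by (auto simp: d_def)
  have d16: "real (card E) / 16 \<le> d" using n by (simp add: d_def)
  obtain e e' :: "nat \<Rightarrow> 'a" where e: "\<And>k. k < d \<Longrightarrow> e k \<in> R \<and> e' k \<in> R \<and> e k \<noteq> e' k"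
    "\<And>i k. i < d \<Longrightarrow> k < d \<Longrightarrow> i \<noteq> k \<Longrightarrow> e i \<noteq> e k \<and> e i \<noteq> e' k \<and> e' i \<noteq> e k \<and> e' i \<noteq> e' k"
    "d * \<rho>\<^sup>2 \<le> card R * (\<Sum>k<d. (a (e k) - a (e' k))\<^sup>2)"
    by (rule exists_spread_matching[OF finR d(1) spread]) auto
  have D: "\<rho>\<^sup>2 / 16 \<le> (\<Sum>k<d. (a (e k) - a (e' k))\<^sup>2)"
  proof -
    have "real (card R) * (\<rho>\<^sup>2 / 16) \<le> (real (card E) / 16) * \<rho>\<^sup>2"
      using cardR by (simp add: mult_right_mono)
    also have "\<dots> \<le> d * \<rho>\<^sup>2" using d16 by (rule mult_right_mono) auto
    also note e(3)
    finally show ?thesis using cardR(2) by simp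
  qed
  have t: "0 < t" unfolding t_def using \<epsilon> \<kappa> m by (intro add_nonneg_pos) auto
  have "perm_avg E (\<lambda>p. of_bool (\<bar>(\<Sum>i\<in>E. a i * y (p i)) - c\<bar> \<le> \<epsilon>) :: real)
     \<le> perm_avg E (\<lambda>p. of_bool (\<bar>(\<Sum>i\<in>E. a i * y (p i)) - c\<bar> \<le> t))"
    using \<kappa> m by (intro perm_avg_mono) (auto simp: t_def intro: order_trans)
  also have "\<dots> \<le> 8 * t / sqrt (3/64 * V * (\<rho>\<^sup>2 / 16)) + exp (- (V * card E / (64 * \<kappa>\<^sup>2)))"
  proof (rule perm_avg_small_ball_pairs[OF fin sum0 var bd \<kappa>, where P = "{..<d}" and e = e and e' = e' and b = "1 / sqrt m"])
    fix k assume "k \<in> {..<d}"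
    then have k: "e k \<in> R" "e' k \<in> R" using e(1) by auto
    show "\<bar>a (e k) - a (e' k)\<bar> \<le> 2 * (1 / sqrt m)" using small[OF k(1)] small[OF k(2)] by linarith
  qed (use e R d t D V \<rho> \<epsilon> in \<open>auto simp: t_def\<close>)
  also have "\<dots> \<le> 300 * t / \<rho> + exp (- (card E / (256 * \<kappa>\<^sup>2)))"
  proof (rule add_mono)
    \<comment> \<open>With \<open>V \<ge> 1/4\<close> the factor \<open>3/64 * V / 16\<close> is at
      least 3/4096, which exceeds (8/300)^2.\<close>
    have "(\<rho> * (8 / 300))\<^sup>2 \<le> 3/64 * V * (\<rho>\<^sup>2 / 16)"
    proof -
      have "(64 / 90000) * \<rho>\<^sup>2 \<le> (3/64 * V / 16) * \<rho>\<^sup>2" using V by (intro mult_right_mono) auto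
      then show ?thesis by (simp add: power_mult_distrib power_divide)
    qed
    then have "\<rho> * (8 / 300) \<le> sqrt (3/64 * V * (\<rho>\<^sup>2 / 16))" by (rule real_le_rsqrt)
    then have "8 * t / sqrt (3/64 * V * (\<rho>\<^sup>2 / 16)) \<le> 8 * t / (\<rho> * (8 / 300))"
      using t \<rho> V by (intro divide_left_mono mult_pos_pos) auto
    then show "8 * t / sqrt (3/64 * V * (\<rho>\<^sup>2 / 16)) \<le> 300 * t / \<rho>" by (simp add: field_simps)
    have "(1/4) * card E / (64 * \<kappa>\<^sup>2) \<le> V * card E / (64 * \<kappa>\<^sup>2)"
      using V \<kappa> by (intro divide_right_mono mult_right_mono) auto
    then show "exp (- (V * card E / (64 * \<kappa>\<^sup>2))) \<le> exp (- (card E / (256 * \<kappa>\<^sup>2)))" by simp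
  qed
  finally show ?thesis by (simp add: t_def)
qed

text \<open>A unit vector has at most \<open>m\<close> coordinates above \<open>1 / sqrt m\<close>.
  Taking these for \<open>S\<close> and the mean over the rest for \<open>\<alpha>\<close>, the
  failure of near constancy says that the remaining coordinates are spread. Real or imaginary parts
  carry at least half of this spread, and projecting on them only enlarges the event.\<close>

lemma perm_avg_small_ball:
  fixes \<eta> :: "'a \<Rightarrow> complex" and y :: "'a \<Rightarrow> real" and V \<kappa> m \<rho> \<epsilon> :: real and c :: complex
  assumes fin: "finite E" and n: "16 \<le> card E" and sum0: "(\<Sum>e\<in>E. y e) = 0"
    and var: "(\<Sum>e\<in>E. (y e)\<^sup>2) = V * card E"
    and bd: "\<And>e. e \<in> E \<Longrightarrow> \<bar>y e\<bar> \<le> \<kappa>" and \<kappa>: "0 < \<kappa>" and V: "1/4 \<le> V"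
    and m: "0 < m" "4 * m \<le> card E" and \<rho>: "0 < \<rho>" and \<epsilon>: "0 \<le> \<epsilon>"
    and \<eta>: "(\<Sum>i\<in>E. (cmod (\<eta> i))\<^sup>2) = 1" and nc: "\<not> nearly_constant E m \<rho> \<eta>"
  shows "perm_avg E (\<lambda>p. of_bool (cmod ((\<Sum>i\<in>E. \<eta> i * y (p i)) - c) \<le> \<epsilon>))
     \<le> 300 * (\<epsilon> + 2 * \<kappa> / sqrt m) / \<rho> + exp (- (card E / (256 * \<kappa>\<^sup>2)))"
proof -
  define R where "R = {i\<in>E. cmod (\<eta> i) \<le> 1 / sqrt m}"
  have RE: "R \<subseteq> E" by (auto simp: R_def)
  have finR: "finite R" using RE fin by (rule finite_subset)
  have cardS: "real (card (E - R)) \<le> m"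
  proof -
    have "card (E - R) * (1 / m) = (\<Sum>i\<in>E - R. (1 / sqrt m)\<^sup>2)" using m by (simp add: power_divide)
    also have "\<dots> \<le> (\<Sum>i\<in>E - R. (cmod (\<eta> i))\<^sup>2)"
      by (intro sum_mono power_mono) (use m in \<open>auto simp: R_def\<close>)
    also have "\<dots> \<le> (\<Sum>i\<in>E. (cmod (\<eta> i))\<^sup>2)" using fin by (intro sum_mono2) auto
    finally show ?thesis using m \<eta> by (simp add: divide_le_eq)
  qed
  have cardER: "real (card (E - R)) = real (card E) - card R"
    using card_Diff_subset[OF finR RE] card_mono[OF fin RE] by simp
  have cardR: "3 * card E \<le> 4 * card R" using cardS cardER m by linarith
  then have Rpos: "0 < card R" using n by simp
  define \<alpha> where "\<alpha> = (\<Sum>i\<in>R. \<eta> i) / card R"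
  have "E - (E - R) = R" using RE by auto
  then have dist: "\<rho>\<^sup>2 < (\<Sum>i\<in>R. (cmod (\<eta> i - \<alpha>))\<^sup>2)"
    using nc cardS unfolding nearly_constant_def by (metis Diff_subset not_le)
  have mean: "(\<Sum>i\<in>R. \<eta> i - \<alpha>) = 0" using Rpos by (simp add: sum_subtractf \<alpha>_def)
  define SR where "SR = (\<Sum>u\<in>R. \<Sum>v\<in>R. (Re (\<eta> u) - Re (\<eta> v))\<^sup>2)"
  define SI where "SI = (\<Sum>u\<in>R. \<Sum>v\<in>R. (Im (\<eta> u) - Im (\<eta> v))\<^sup>2)"
  have "SR = (\<Sum>u\<in>R. \<Sum>v\<in>R. (Re (\<eta> u - \<alpha>) - Re (\<eta> v - \<alpha>))\<^sup>2)" by (simp add: SR_def)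
  also have "\<dots> = 2 * (card R * (\<Sum>u\<in>R. (Re (\<eta> u - \<alpha>))\<^sup>2) - (\<Sum>u\<in>R. Re (\<eta> u - \<alpha>))\<^sup>2)"
    by (rule sum_pairwise_diff_squares)
  also have "(\<Sum>u\<in>R. Re (\<eta> u - \<alpha>)) = 0" using arg_cong[OF mean, of Re] by (simp only: Re_sum zero_complex.sel)
  finally have SR: "SR = 2 * (card R * (\<Sum>u\<in>R. (Re (\<eta> u - \<alpha>))\<^sup>2))" by simp
  have "SI = (\<Sum>u\<in>R. \<Sum>v\<in>R. (Im (\<eta> u - \<alpha>) - Im (\<eta> v - \<alpha>))\<^sup>2)" by (simp add: SI_def)
  also have "\<dots> = 2 * (card R * (\<Sum>u\<in>R. (Im (\<eta> u - \<alpha>))\<^sup>2) - (\<Sum>u\<in>R. Im (\<eta> u - \<alpha>))\<^sup>2)"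
    by (rule sum_pairwise_diff_squares)
  also have "(\<Sum>u\<in>R. Im (\<eta> u - \<alpha>)) = 0" using arg_cong[OF mean, of Im] by (simp only: Im_sum zero_complex.sel)
  finally have SI: "SI = 2 * (card R * (\<Sum>u\<in>R. (Im (\<eta> u - \<alpha>))\<^sup>2))" by simp
  have "SR + SI = 2 * (card R * (\<Sum>i\<in>R. (cmod (\<eta> i - \<alpha>))\<^sup>2))"
    unfolding SR SI cmod_power2 sum.distrib by (simp only: distrib_left)
  also have "\<dots> \<ge> 2 * (card R * \<rho>\<^sup>2)" using dist by (intro mult_left_mono) auto
  finally have SR_or_SI: "card R * \<rho>\<^sup>2 \<le> SR \<or> card R * \<rho>\<^sup>2 \<le> SI" by linarith
  have project: ?thesis
    if le: "\<And>u. \<bar>f u\<bar> \<le> cmod u" and spread: "card R * \<rho>\<^sup>2 \<le> (\<Sum>u\<in>R. \<Sum>v\<in>R. (f (\<eta> u) - f (\<eta> v))\<^sup>2)"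
      and lin: "\<And>p. f ((\<Sum>i\<in>E. \<eta> i * y (p i)) - c) = (\<Sum>i\<in>E. f (\<eta> i) * y (p i)) - f c"
    for f :: "complex \<Rightarrow> real"
  proof -
    have "perm_avg E (\<lambda>p. of_bool (cmod ((\<Sum>i\<in>E. \<eta> i * y (p i)) - c) \<le> \<epsilon>) :: real)
       \<le> perm_avg E (\<lambda>p. of_bool (\<bar>(\<Sum>i\<in>E. f (\<eta> i) * y (p i)) - f c\<bar> \<le> \<epsilon>))"
      unfolding lin[symmetric] by (intro perm_avg_mono) (auto intro: order_trans[OF le])
    also have "\<dots> \<le> 300 * (\<epsilon> + 2 * \<kappa> / sqrt m) / \<rho> + exp (- (card E / (256 * \<kappa>\<^sup>2)))"
      by (rule perm_avg_small_ball_real[OF fin n sum0 var bd \<kappa> V m(1) \<rho> \<epsilon> RE cardR _ spread])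
         (auto simp: R_def intro: order_trans[OF le])
    finally show ?thesis .
  qed
  from SR_or_SI show ?thesis
  proof
    assume "card R * \<rho>\<^sup>2 \<le> SR"
    then show ?thesis by (intro project[of Re]) (simp_all add: SR_def abs_Re_le_cmod)
  next
    assume "card R * \<rho>\<^sup>2 \<le> SI"
    then show ?thesis by (intro project[of Im]) (simp_all add: SI_def abs_Im_le_cmod)
  qed
qed

section \<open>Singular values\<close>

lemma mat_adjoint_dim [simp]:
  "dim_row (mat_adjoint A) = dim_col A" "dim_col (mat_adjoint A) = dim_row A"
  by (simp_all add: mat_adjoint_def)

lemma mat_adjoint_carrier [simp]: "A \<in> carrier_mat n m \<Longrightarrow> mat_adjoint A \<in> carrier_mat m n"
  by auto

lemma mat_adjoint_index [simp]:
  "i < dim_col A \<Longrightarrow> j < dim_row A \<Longrightarrow> mat_adjoint A $$ (i, j) = conjugate (A $$ (j, i))"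
  by (simp add: mat_adjoint_def mat_of_rows_def)

lemma mat_adjoint_adjoint [simp]: "mat_adjoint (mat_adjoint A) = A"
  by (rule eq_matI) auto

lemma mat_adjoint_mult:
  fixes A B :: "complex mat"
  assumes "A \<in> carrier_mat n m" "B \<in> carrier_mat m k"
  shows "mat_adjoint (A * B) = mat_adjoint B * mat_adjoint A"
proof (rule eq_matI)
  fix i j assume "i < dim_row (mat_adjoint B * mat_adjoint A)" "j < dim_col (mat_adjoint B * mat_adjoint A)"
  then have ij: "i < k" "j < n" using assms by auto
  show "mat_adjoint (A * B) $$ (i, j) = (mat_adjoint B * mat_adjoint A) $$ (i, j)"
    using assms ij by (simp add: scalar_prod_def mult.commute)
qed (use assms in auto)

lemma mat_adjoint_minus:
  fixes A B :: "complex mat"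
  assumes "A \<in> carrier_mat n m" "B \<in> carrier_mat n m"
  shows "mat_adjoint (A - B) = mat_adjoint A - mat_adjoint B"
  by (rule eq_matI) (use assms in auto)

lemma cscalar_prod_mult_mat_vec:
  fixes A :: "complex mat"
  assumes "A \<in> carrier_mat n m" "v \<in> carrier_vec m" "w \<in> carrier_vec n"
  shows "(A *\<^sub>v v) \<bullet>c w = v \<bullet>c (mat_adjoint A *\<^sub>v w)"
proof -
  have "(A *\<^sub>v v) \<bullet>c w = (\<Sum>i\<in>{0..<n}. \<Sum>j\<in>{0..<m}. A $$ (i, j) * v $ j * cnj (w $ i))"
    using assms by (simp add: scalar_prod_def sum_distrib_right)
  also have "\<dots> = (\<Sum>j\<in>{0..<m}. \<Sum>i\<in>{0..<n}. v $ j * (A $$ (i, j) * cnj (w $ i)))"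
    by (subst sum.swap) (simp add: mult_ac)
  also have "\<dots> = v \<bullet>c (mat_adjoint A *\<^sub>v w)"
    using assms by (simp add: scalar_prod_def sum_distrib_left)
  finally show ?thesis .
qed

lemma cscalar_prod_self:
  fixes v :: "complex vec"
  shows "v \<bullet>c v = complex_of_real (\<Sum>i\<in>{0..<dim_vec v}. (cmod (v $ i))\<^sup>2)"
  by (simp add: scalar_prod_def complex_norm_square[symmetric])

definition real_diag :: "nat \<Rightarrow> (nat \<Rightarrow> real) \<Rightarrow> complex mat" where
  "real_diag n d = Matrix.mat n n (\<lambda>(i, j). if i = j then complex_of_real (d i) else 0)"

lemma real_diag_carrier [simp]: "real_diag n d \<in> carrier_mat n n"
  by (simp add: real_diag_def)

lemma real_diag_dim [simp]: "dim_row (real_diag n d) = n" "dim_col (real_diag n d) = n"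
  by (simp_all add: real_diag_def)

lemma real_diag_adjoint [simp]: "mat_adjoint (real_diag n d) = real_diag n d"
  by (rule eq_matI) (auto simp: real_diag_def)

lemma real_diag_mult: "real_diag n d * real_diag n e = real_diag n (\<lambda>i. d i * e i)"
proof (rule eq_matI)
  fix i j assume "i < dim_row (real_diag n (\<lambda>i. d i * e i))" "j < dim_col (real_diag n (\<lambda>i. d i * e i))"
  then have ij: "i < n" "j < n" by auto
  have "(real_diag n d * real_diag n e) $$ (i, j)
      = (\<Sum>k\<in>{0..<n}. (if i = k then complex_of_real (d i) else 0) * (if k = j then complex_of_real (e k) else 0))"
    using ij by (simp add: scalar_prod_def real_diag_def)
  also have "\<dots> = (\<Sum>k\<in>{0..<n}. if k = i then (complex_of_real (d i) * (if i = j then complex_of_real (e i) else 0)) else 0)"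
    by (intro sum.cong) auto
  also have "\<dots> = real_diag n (\<lambda>i. d i * e i) $$ (i, j)"
    using ij by (simp add: real_diag_def)
  finally show "(real_diag n d * real_diag n e) $$ (i, j) = real_diag n (\<lambda>i. d i * e i) $$ (i, j)" .
qed auto

lemma real_diag_unit_vec:
  "i < n \<Longrightarrow> real_diag n d *\<^sub>v unit_vec n i = complex_of_real (d i) \<cdot>\<^sub>v unit_vec n i"
  by (rule eq_vecI) (auto simp: real_diag_def scalar_prod_def unit_vec_def mult_delta_left)

lemma hermitian_eigenvalue_real:
  fixes A :: "complex mat"
  assumes A: "A \<in> carrier_mat n n" "mat_adjoint A = A" and ev: "eigenvector A v k"
  shows "k \<in> \<real>"
proof -
  have v: "v \<in> carrier_vec n" "v \<noteq> 0\<^sub>v n" "A *\<^sub>v v = k \<cdot>\<^sub>v v"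
    using ev A by (auto simp: eigenvector_def)
  have "k * (v \<bullet>c v) = (A *\<^sub>v v) \<bullet>c v" using v by simp
  also have "\<dots> = v \<bullet>c (A *\<^sub>v v)" using cscalar_prod_mult_mat_vec[OF A(1) v(1) v(1)] A(2) by simp
  also have "\<dots> = cnj k * (v \<bullet>c v)" using v by (simp add: conjugate_smult_vec)
  finally have "k = cnj k" using v conjugate_square_eq_0_vec[OF v(1)] by simp
  then show ?thesis by (metis Reals_cnj_iff)
qed

section \<open>The spectral theorem for Hermitian matrices\<close>

text \<open>Gram-Schmidt leaves its first input unchanged, so after normalization the first column
  is still a multiple of \<open>v\<close>.\<close>

lemma exists_orthonormal_completion:
  fixes v :: "complex vec"
  assumes v: "v \<in> carrier_vec n" "v \<noteq> 0\<^sub>v n"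
  obtains U c where "U \<in> carrier_mat n n" "mat_adjoint U * U = 1\<^sub>m n" "Matrix.col U 0 = c \<cdot>\<^sub>v v" "0 < n"
proof -
  have n: "0 < n" using v by (cases n) auto
  interpret cof_vec_space n "TYPE(complex)" .
  define b where "b = basis_completion v"
  have b: "span (set b) = carrier_vec n" "distinct b" "\<not> lin_dep (set b)" "set b \<subseteq> carrier_vec n"
    "hd b = v" "length b = n"
    using basis_completion[OF v, folded b_def] by auto
  then obtain vs where bv: "b = v # vs" using n by (cases b) auto
  define ws where "ws = gram_schmidt n b"
  have ws: "set ws \<subseteq> carrier_vec n" "corthogonal ws" "length ws = n"
    using gram_schmidt_result[OF b(4) b(2) b(3) refl, folded ws_def] b(6) by auto
  have hdws: "hd ws = v" unfolding ws_def bv using gram_schmidt_hd[OF v(1), of vs] by simp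
  define nrm where "nrm w = complex_of_real (1 / sqrt (\<Sum>i\<in>{0..<n}. (cmod (w $ i))\<^sup>2))" for w :: "complex vec"
  define us where "us = map (\<lambda>w. nrm w \<cdot>\<^sub>v w) ws"
  define U where "U = mat_of_cols n us"
  have U: "U \<in> carrier_mat n n" unfolding U_def us_def using ws mat_of_cols_carrier(1)[of n us] by (simp add: us_def)
  have wsc: "ws ! i \<in> carrier_vec n" if "i < n" for i using ws that by auto
  have col: "Matrix.col U i = nrm (ws ! i) \<cdot>\<^sub>v ws ! i" if "i < n" for i
    unfolding U_def using that ws wsc[OF that] by (subst col_mat_of_cols) (auto simp: us_def)
  have prod: "Matrix.col U i \<bullet>c Matrix.col U j = (if i = j then 1 else 0)" if ij: "i < n" "j < n" for i j
  proof -
    have eq: "Matrix.col U i \<bullet>c Matrix.col U j = nrm (ws ! i) * cnj (nrm (ws ! j)) * ((ws ! i) \<bullet>c (ws ! j))"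
      unfolding col[OF ij(1)] col[OF ij(2)] using wsc[OF ij(1)] wsc[OF ij(2)]
      by (simp add: conjugate_smult_vec)
    show ?thesis
    proof (cases "i = j")
      case True
      define q where "q = (\<Sum>k\<in>{0..<n}. (cmod (ws ! i $ k))\<^sup>2)"
      have self: "(ws ! i) \<bullet>c (ws ! i) = complex_of_real q"
        using cscalar_prod_self[of "ws ! i"] wsc[OF ij(1)] by (simp add: q_def)
      have "(ws ! i) \<bullet>c (ws ! i) \<noteq> 0" using corthogonalD[OF ws(2), of i i] ij ws by auto
      then have "q \<noteq> 0" unfolding self by simp
      moreover have "0 \<le> q" unfolding q_def by (intro sum_nonneg) auto
      ultimately have "0 < q" by simp
      then have "nrm (ws ! i) * cnj (nrm (ws ! i)) * complex_of_real q = 1"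
        unfolding nrm_def q_def[symmetric] by (simp add: of_real_mult[symmetric] del: of_real_mult)
      then show ?thesis using True eq self by simp
    next
      case False
      then have "(ws ! i) \<bullet>c (ws ! j) = 0" using corthogonalD[OF ws(2), of i j] ij ws by auto
      then show ?thesis using False eq by simp
    qed
  qed
  have "mat_adjoint U * U = 1\<^sub>m n"
  proof (rule eq_matI)
    fix i j assume "i < dim_row (1\<^sub>m n :: complex mat)" "j < dim_col (1\<^sub>m n :: complex mat)"
    then have ij: "i < n" "j < n" by auto
    have "(mat_adjoint U * U) $$ (i, j) = Matrix.col U j \<bullet>c Matrix.col U i"
      using ij U by (simp add: scalar_prod_def mult.commute)
    then show "(mat_adjoint U * U) $$ (i, j) = 1\<^sub>m n $$ (i, j)" using prod[OF ij(2) ij(1)] ij by auto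
  qed (use U in auto)
  moreover have "Matrix.col U 0 = nrm (ws ! 0) \<cdot>\<^sub>v v"
    using col[OF n] hdws ws n by (cases ws) auto
  ultimately show ?thesis using that U n by blast
qed

lemma unitary_mult_adjoint:
  fixes U :: "complex mat"
  assumes "U \<in> carrier_mat n n" "mat_adjoint U * U = 1\<^sub>m n"
  shows "U * mat_adjoint U = 1\<^sub>m n"
  using mat_mult_left_right_inverse[of "mat_adjoint U" n U] assms by simp

text \<open>Deflation: in an orthonormal basis that starts with an eigenvector the matrix splits
  into a 1 x 1 block and a smaller Hermitian block, to which the induction hypothesis
  applies.\<close>

lemma hermitian_diagonalization:
  fixes A :: "complex mat"
  assumes "A \<in> carrier_mat n n" "mat_adjoint A = A"
  shows "\<exists>U d. U \<in> carrier_mat n n \<and> mat_adjoint U * U = 1\<^sub>m n \<and> A = U * real_diag n d * mat_adjoint U"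
  using assms
proof (induction n arbitrary: A)
  case 0
  then show ?case by (intro exI[of _ "1\<^sub>m 0"] exI[of _ "\<lambda>_. 0"]) (auto intro!: eq_matI)
next
  case (Suc n)
  note A = Suc.prems
  obtain k v where ev: "eigenvector A v k"
    using spectrum_non_empty[OF A(1)] by (auto simp: spectrum_def eigenvalue_def)
  then have v: "v \<in> carrier_vec (Suc n)" "v \<noteq> 0\<^sub>v (Suc n)" "A *\<^sub>v v = k \<cdot>\<^sub>v v"
    using A by (auto simp: eigenvector_def)
  have "k \<in> \<real>" using hermitian_eigenvalue_real[OF A ev] .
  then obtain r where k: "k = complex_of_real r" by (auto elim: Reals_cases)
  obtain U c where U: "U \<in> carrier_mat (Suc n) (Suc n)" "mat_adjoint U * U = 1\<^sub>m (Suc n)" "Matrix.col U 0 = c \<cdot>\<^sub>v v"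
    by (rule exists_orthonormal_completion[OF v(1,2)])
  have UU: "U * mat_adjoint U = 1\<^sub>m (Suc n)" using unitary_mult_adjoint[OF U(1,2)] .
  define B where "B = mat_adjoint U * A * U"
  have B: "B \<in> carrier_mat (Suc n) (Suc n)" using U A by (auto simp: B_def)
  have Bherm: "mat_adjoint B = B"
  proof -
    have "mat_adjoint B = mat_adjoint U * mat_adjoint (mat_adjoint U * A)"
      unfolding B_def by (rule mat_adjoint_mult[of _ "Suc n" "Suc n" _ "Suc n"]) (use U A in auto)
    also have "mat_adjoint (mat_adjoint U * A) = mat_adjoint A * mat_adjoint (mat_adjoint U)"
      by (rule mat_adjoint_mult[of _ "Suc n" "Suc n" _ "Suc n"]) (use U A in auto)
    finally show ?thesis using U A by (simp add: B_def assoc_mult_mat[of _ "Suc n" "Suc n" _ "Suc n" _ "Suc n"])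
  qed
  have Bcol: "B $$ (i, 0) = (if i = 0 then k else 0)" if i: "i < Suc n" for i
  proof -
    have c0: "Matrix.col (1\<^sub>m (Suc n)) 0 = mat_adjoint U *\<^sub>v (c \<cdot>\<^sub>v v)"
    proof -
      have "Matrix.col (mat_adjoint U * U) 0 = mat_adjoint U *\<^sub>v Matrix.col U 0"
        by (rule col_mult2[of _ "Suc n" "Suc n" _ "Suc n"]) (use U(1) in auto)
      then show ?thesis unfolding U(2,3) .
    qed
    have "Matrix.col B 0 = mat_adjoint U * A *\<^sub>v Matrix.col U 0"
      unfolding B_def using U A by (intro col_mult2[of _ "Suc n" "Suc n" _ "Suc n"]) auto
    also have "\<dots> = mat_adjoint U *\<^sub>v (A *\<^sub>v (c \<cdot>\<^sub>v v))"
      unfolding U(3) using U A v by (intro assoc_mult_mat_vec[of _ "Suc n" "Suc n" _ "Suc n"]) auto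
    also have "A *\<^sub>v (c \<cdot>\<^sub>v v) = k \<cdot>\<^sub>v (c \<cdot>\<^sub>v v)"
      using v A by (simp add: mult_mat_vec[of _ "Suc n" "Suc n"] smult_smult_assoc mult.commute)
    also have "mat_adjoint U *\<^sub>v (k \<cdot>\<^sub>v (c \<cdot>\<^sub>v v)) = k \<cdot>\<^sub>v (mat_adjoint U *\<^sub>v (c \<cdot>\<^sub>v v))"
      using U v by (intro mult_mat_vec[of _ "Suc n" "Suc n"]) auto
    finally have "Matrix.col B 0 = k \<cdot>\<^sub>v Matrix.col (1\<^sub>m (Suc n)) 0" unfolding c0 .
    then have "Matrix.col B 0 $ i = (k \<cdot>\<^sub>v Matrix.col (1\<^sub>m (Suc n)) 0) $ i" by simp
    then show ?thesis using B i by auto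
  qed
  \<comment> \<open>The first row is the conjugate of the first column, and \<open>k\<close> is
    real.\<close>
  have Brow: "B $$ (0, i) = (if i = 0 then k else 0)" if i: "i < Suc n" for i
  proof -
    have "B $$ (0, i) = mat_adjoint B $$ (0, i)" using Bherm by simp
    also have "\<dots> = cnj (B $$ (i, 0))" using B i by simp
    finally show ?thesis using Bcol[OF i] k by simp
  qed
  define B' where "B' = Matrix.mat n n (\<lambda>(i, j). B $$ (Suc i, Suc j))"
  have B': "B' \<in> carrier_mat n n" by (simp add: B'_def)
  have "mat_adjoint B' = B'"
  proof (rule eq_matI)
    fix i j assume "i < dim_row B'" "j < dim_col B'"
    then have ij: "i < n" "j < n" by (auto simp: B'_def)
    have "B $$ (Suc i, Suc j) = mat_adjoint B $$ (Suc i, Suc j)" using Bherm by simp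
    also have "\<dots> = cnj (B $$ (Suc j, Suc i))" using B ij by simp
    finally show "mat_adjoint B' $$ (i, j) = B' $$ (i, j)" using ij by (simp add: B'_def)
  qed (auto simp: B'_def)
  from Suc.IH[OF B' this] obtain U' d where U': "U' \<in> carrier_mat n n" "mat_adjoint U' * U' = 1\<^sub>m n"
    "B' = U' * real_diag n d * mat_adjoint U'" by auto
  \<comment> \<open>Products and adjoints respect this block form, so the smaller diagonalization
    lifts by padding its unitary matrix with a 1.\<close>
  define blk where "blk a M = four_block_mat (Matrix.mat 1 1 (\<lambda>_. a)) (0\<^sub>m 1 n) (0\<^sub>m n 1) M"
    for a :: complex and M
  have blk_carrier: "blk a M \<in> carrier_mat (Suc n) (Suc n)" if "M \<in> carrier_mat n n" for a M
    using that four_block_carrier_mat[of "Matrix.mat 1 1 (\<lambda>_. a)" 1 1 M n n "0\<^sub>m 1 n" "0\<^sub>m n 1"] by (simp add: blk_def)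
  have blk_mult: "blk a M * blk b N = blk (a * b) (M * N)" if MN: "M \<in> carrier_mat n n" "N \<in> carrier_mat n n" for a b M N
  proof -
    have "blk a M * blk b N = four_block_mat
        (Matrix.mat 1 1 (\<lambda>_. a) * Matrix.mat 1 1 (\<lambda>_. b) + 0\<^sub>m 1 n * 0\<^sub>m n 1)
        (Matrix.mat 1 1 (\<lambda>_. a) * 0\<^sub>m 1 n + 0\<^sub>m 1 n * N)
        (0\<^sub>m n 1 * Matrix.mat 1 1 (\<lambda>_. b) + M * 0\<^sub>m n 1) (0\<^sub>m n 1 * 0\<^sub>m 1 n + M * N)"
      unfolding blk_def by (rule mult_four_block_mat[of _ 1 1 _ n _ n _ _ 1 _ n]) (use MN in auto)
    also have "\<dots> = blk (a * b) (M * N)"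
      unfolding blk_def using MN
      by (intro cong_four_block_mat) (auto intro!: eq_matI simp: scalar_prod_def)
    finally show ?thesis .
  qed
  have blk_adj: "mat_adjoint (blk a M) = blk (cnj a) (mat_adjoint M)" if M: "M \<in> carrier_mat n n" for a M
  proof (rule eq_matI)
    fix i j assume "i < dim_row (blk (cnj a) (mat_adjoint M))" "j < dim_col (blk (cnj a) (mat_adjoint M))"
    then have ij: "i < Suc n" "j < Suc n" using blk_carrier[of "mat_adjoint M" "cnj a"] M by auto
    then show "mat_adjoint (blk a M) $$ (i, j) = blk (cnj a) (mat_adjoint M) $$ (i, j)"
      using blk_carrier[OF M, of a] M by (auto simp: blk_def)
  qed (use blk_carrier[OF M, of a] blk_carrier[of "mat_adjoint M" "cnj a"] M in auto)
  define d' where "d' i = (if i = 0 then r else d (i - 1))" for i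
  have Bblk: "B = blk k B'"
    by (rule eq_matI) (use B B' Bcol Brow in \<open>auto simp: blk_def B'_def\<close>)
  have Dblk: "real_diag (Suc n) d' = blk k (real_diag n d)"
    by (rule eq_matI) (auto simp: blk_def real_diag_def d'_def k)
  have one_blk: "(1\<^sub>m (Suc n) :: complex mat) = blk 1 (1\<^sub>m n)"
    by (rule eq_matI) (auto simp: blk_def)
  define W where "W = U * blk 1 U'"
  have bU: "blk 1 U' \<in> carrier_mat (Suc n) (Suc n)" by (rule blk_carrier[OF U'(1)])
  have W: "W \<in> carrier_mat (Suc n) (Suc n)" using U(1) bU by (simp add: W_def)
  have Wadj: "mat_adjoint W = blk 1 (mat_adjoint U') * mat_adjoint U"
    unfolding W_def using mat_adjoint_mult[OF U(1) bU] blk_adj[OF U'(1), of 1] by simp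
  have bUa: "blk 1 (mat_adjoint U') \<in> carrier_mat (Suc n) (Suc n)" using U' by (intro blk_carrier) simp
  have closed: "X * Y \<in> carrier_mat (Suc n) (Suc n)"
    if "X \<in> carrier_mat (Suc n) (Suc n)" "Y \<in> carrier_mat (Suc n) (Suc n)" for X Y :: "complex mat"
    using that by auto
  note assoc = assoc_mult_mat[of _ "Suc n" "Suc n" _ "Suc n" _ "Suc n"] closed
  have "mat_adjoint W * W = blk 1 (mat_adjoint U') * (mat_adjoint U * U) * blk 1 U'"
    unfolding Wadj unfolding W_def using U(1) bU bUa by (simp add: assoc)
  also have "\<dots> = 1\<^sub>m (Suc n)"
    unfolding U(2) using bUa bU U' by (simp add: blk_mult one_blk)
  finally have WW: "mat_adjoint W * W = 1\<^sub>m (Suc n)" .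
  have "W * real_diag (Suc n) d' * mat_adjoint W
      = U * (blk 1 U' * blk k (real_diag n d) * blk 1 (mat_adjoint U')) * mat_adjoint U"
    unfolding Wadj unfolding W_def Dblk using U(1) bU bUa blk_carrier[of "real_diag n d" k] by (simp add: assoc)
  also have "blk 1 U' * blk k (real_diag n d) * blk 1 (mat_adjoint U') = B"
    unfolding Bblk U'(3) using U' by (simp add: blk_mult)
  also have "U * B * mat_adjoint U = (U * mat_adjoint U) * A * (U * mat_adjoint U)"
    unfolding B_def using U(1) A(1) by (simp add: assoc)
  also have "\<dots> = A" unfolding UU using A(1) by simp
  finally show ?case using W WW by metis
qed

section \<open>Positive square roots\<close>

lemma pos_semidef_mult_adjoint:
  fixes B :: "complex mat"
  assumes B: "B \<in> carrier_mat n m"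
  shows "pos_semidef (B * mat_adjoint B)"
  unfolding pos_semidef_def
proof (intro conjI ballI)
  have adj: "mat_adjoint B \<in> carrier_mat m n" using B by simp
  show "square_mat (B * mat_adjoint B)" using B by auto
  show "mat_adjoint (B * mat_adjoint B) = B * mat_adjoint B"
    using mat_adjoint_mult[OF B adj] by simp
  fix v :: "complex vec" assume "v \<in> carrier_vec (dim_row (B * mat_adjoint B))"
  then have v: "v \<in> carrier_vec n" using B by simp
  define w where "w = mat_adjoint B *\<^sub>v v"
  have w: "w \<in> carrier_vec m" unfolding w_def using adj v by auto
  have "((B * mat_adjoint B) *\<^sub>v v) \<bullet>c v = (B *\<^sub>v w) \<bullet>c v"
    unfolding w_def using B adj v by (simp add: assoc_mult_mat_vec[of _ n m _ n])
  also have "\<dots> = w \<bullet>c w" using cscalar_prod_mult_mat_vec[OF B w v] by (simp add: w_def)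
  finally show "0 \<le> Re (((B * mat_adjoint B) *\<^sub>v v) \<bullet>c v)"
    unfolding cscalar_prod_self by (simp add: sum_nonneg)
qed

lemma diagonalization_eigenvectors:
  fixes U :: "complex mat"
  assumes U: "U \<in> carrier_mat n n" "mat_adjoint U * U = 1\<^sub>m n" and A: "A = U * real_diag n d * mat_adjoint U"
    and i: "i < n"
  defines "u \<equiv> U *\<^sub>v unit_vec n i"
  shows "u \<in> carrier_vec n" "A *\<^sub>v u = complex_of_real (d i) \<cdot>\<^sub>v u" "u \<bullet>c u = 1"
proof -
  have e: "unit_vec n i \<in> carrier_vec n" by simp
  have adj: "mat_adjoint U \<in> carrier_mat n n" using U by simp
  show u: "u \<in> carrier_vec n" unfolding u_def using U by auto
  have Uu: "mat_adjoint U *\<^sub>v u = unit_vec n i"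
    unfolding u_def using U adj e by (simp add: assoc_mult_mat_vec[of _ n n _ n, symmetric])
  have "A *\<^sub>v u = (U * real_diag n d) *\<^sub>v (mat_adjoint U *\<^sub>v u)"
    unfolding A using U adj u by (intro assoc_mult_mat_vec[of _ n n _ n]) auto
  also have "\<dots> = U *\<^sub>v (real_diag n d *\<^sub>v unit_vec n i)"
    unfolding Uu using U by (intro assoc_mult_mat_vec[of _ n n _ n]) auto
  also have "\<dots> = complex_of_real (d i) \<cdot>\<^sub>v u"
    unfolding real_diag_unit_vec[OF i] u_def using U by (intro mult_mat_vec[of _ n n]) auto
  finally show "A *\<^sub>v u = complex_of_real (d i) \<cdot>\<^sub>v u" .
  have "u \<bullet>c u = unit_vec n i \<bullet>c (mat_adjoint U *\<^sub>v u)"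
    using cscalar_prod_mult_mat_vec[OF U(1) e u] by (simp add: u_def)
  also have "\<dots> = 1" unfolding Uu using i by (simp add: scalar_prod_def unit_vec_def if_distrib cong: if_cong)
  finally show "u \<bullet>c u = 1" .
qed

lemma pos_semidef_sqrt_exists:
  fixes A :: "complex mat"
  assumes A: "A \<in> carrier_mat n n" and psd: "pos_semidef A"
  shows "\<exists>P \<in> carrier_mat n n. pos_semidef P \<and> P * P = A"
proof -
  obtain U d where U: "U \<in> carrier_mat n n" "mat_adjoint U * U = 1\<^sub>m n"
    and AU: "A = U * real_diag n d * mat_adjoint U"
    using hermitian_diagonalization[OF A] psd by (auto simp: pos_semidef_def)
  have adj: "mat_adjoint U \<in> carrier_mat n n" using U by simp
  have d0: "0 \<le> d i" if i: "i < n" for i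
  proof -
    note ev = diagonalization_eigenvectors[OF U AU i]
    have "0 \<le> Re ((A *\<^sub>v (U *\<^sub>v unit_vec n i)) \<bullet>c (U *\<^sub>v unit_vec n i))"
      using psd A ev(1) by (auto simp: pos_semidef_def)
    also have "(A *\<^sub>v (U *\<^sub>v unit_vec n i)) \<bullet>c (U *\<^sub>v unit_vec n i) = complex_of_real (d i)"
      unfolding ev(2) using ev(1,3) by simp
    finally show ?thesis by simp
  qed
  have closed: "X * Y \<in> carrier_mat n n" if "X \<in> carrier_mat n n" "Y \<in> carrier_mat n n" for X Y :: "complex mat"
    using that by auto
  note assoc = assoc_mult_mat[of _ n n _ n _ n] closed
  \<comment> \<open>Fourth roots: the square root of \<open>A\<close> is produced as
    \<open>R * mat_adjoint R\<close>, which is positive semidefinite by its form.\<close>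
  define q where "q i = sqrt (sqrt (d i))" for i
  define R where "R = U * real_diag n q"
  have R: "R \<in> carrier_mat n n" using U by (simp add: R_def closed)
  have Radj: "mat_adjoint R = real_diag n q * mat_adjoint U"
    unfolding R_def using mat_adjoint_mult[OF U(1) real_diag_carrier[of n q]] by simp
  have RR: "R * mat_adjoint R = U * real_diag n (\<lambda>i. sqrt (d i)) * mat_adjoint U"
  proof -
    have "R * mat_adjoint R = U * (real_diag n q * real_diag n q) * mat_adjoint U"
      unfolding Radj unfolding R_def using U adj by (simp add: assoc)
    also have "real_diag n q * real_diag n q = real_diag n (\<lambda>i. sqrt (d i))"
      unfolding real_diag_mult using d0 by (auto simp: real_diag_def q_def intro!: eq_matI)
    finally show ?thesis .
  qed
  have "(R * mat_adjoint R) * (R * mat_adjoint R)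
     = U * (real_diag n (\<lambda>i. sqrt (d i)) * (mat_adjoint U * U) * real_diag n (\<lambda>i. sqrt (d i))) * mat_adjoint U"
    unfolding RR using U(1) adj by (simp add: assoc)
  also have "real_diag n (\<lambda>i. sqrt (d i)) * (mat_adjoint U * U) * real_diag n (\<lambda>i. sqrt (d i)) = real_diag n d"
  proof -
    have "real_diag n (\<lambda>i. sqrt (d i)) * 1\<^sub>m n = real_diag n (\<lambda>i. sqrt (d i))"
      by (rule right_mult_one_mat[OF real_diag_carrier])
    then have "real_diag n (\<lambda>i. sqrt (d i)) * (mat_adjoint U * U) * real_diag n (\<lambda>i. sqrt (d i))
      = real_diag n (\<lambda>i. sqrt (d i) * sqrt (d i))"
      unfolding U(2) by (simp add: real_diag_mult)
    also have "\<dots> = real_diag n d"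
      using d0 by (intro eq_matI) (auto simp: real_diag_def of_real_mult[symmetric] simp del: of_real_mult)
    finally show ?thesis .
  qed
  finally have "(R * mat_adjoint R) * (R * mat_adjoint R) = A" unfolding AU .
  moreover have "R * mat_adjoint R \<in> carrier_mat n n" using R by (simp add: closed)
  ultimately show ?thesis using pos_semidef_mult_adjoint[OF R] by blast
qed

text \<open>With \<open>D = P - Q\<close> the hypothesis reads P D + D Q = 0. On a unit eigenvector
  of \<open>D\<close> with eigenvalue d this says d (p + q) = 0 for the quadratic forms p, q of
  \<open>P\<close>, \<open>Q\<close>, while d = p - q. If d is nonzero, then p + q = 0 with p and q
  nonnegative, so both vanish and d = 0 after all. Commutativity does not enter.\<close>

lemma pos_semidef_sqrt_unique:
  fixes P Q :: "complex mat"
  assumes P: "P \<in> carrier_mat n n" "pos_semidef P" and Q: "Q \<in> carrier_mat n n" "pos_semidef Q"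
    and eq: "P * P = Q * Q"
  shows "P = Q"
proof -
  have Padj: "mat_adjoint P = P" and Qadj: "mat_adjoint Q = Q" using P Q by (auto simp: pos_semidef_def)
  define D where "D = P - Q"
  have D: "D \<in> carrier_mat n n" using minus_carrier_mat[OF Q(1)] by (simp add: D_def)
  have Dadj: "mat_adjoint D = D" unfolding D_def using mat_adjoint_minus[OF P(1) Q(1)] Padj Qadj by simp
  obtain U d where U: "U \<in> carrier_mat n n" "mat_adjoint U * U = 1\<^sub>m n"
    and DU: "D = U * real_diag n d * mat_adjoint U"
    using hermitian_diagonalization[OF D Dadj] by auto
  have "d i = 0" if i: "i < n" for i
  proof (rule ccontr)
    assume nz: "d i \<noteq> 0"
    define u where "u = U *\<^sub>v unit_vec n i"
    have u: "u \<in> carrier_vec n" "D *\<^sub>v u = complex_of_real (d i) \<cdot>\<^sub>v u" "u \<bullet>c u = 1"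
      using diagonalization_eigenvectors[OF U DU i] by (simp_all add: u_def)
    have Pu: "P *\<^sub>v u \<in> carrier_vec n" and Qu: "Q *\<^sub>v u \<in> carrier_vec n" using P Q u by auto
    have split: "D *\<^sub>v w = P *\<^sub>v w - Q *\<^sub>v w" if "w \<in> carrier_vec n" for w
      unfolding D_def using P Q that by (intro minus_mult_distrib_mat_vec) auto
    have "P *\<^sub>v (P *\<^sub>v u) = Q *\<^sub>v (Q *\<^sub>v u)"
      using P Q u eq by (metis assoc_mult_mat_vec)
    have "(P *\<^sub>v (D *\<^sub>v u)) \<bullet>c u + (D *\<^sub>v (Q *\<^sub>v u)) \<bullet>c u = 0"
    proof -
      have "P *\<^sub>v (D *\<^sub>v u) = P *\<^sub>v (P *\<^sub>v u) - P *\<^sub>v (Q *\<^sub>v u)"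
        unfolding split[OF u(1)] using P Pu Qu by (intro mult_minus_distrib_mat_vec) auto
      moreover have "D *\<^sub>v (Q *\<^sub>v u) = P *\<^sub>v (Q *\<^sub>v u) - Q *\<^sub>v (Q *\<^sub>v u)" by (rule split[OF Qu])
      moreover have "P *\<^sub>v (P *\<^sub>v u) \<in> carrier_vec n" "P *\<^sub>v (Q *\<^sub>v u) \<in> carrier_vec n" "Q *\<^sub>v (Q *\<^sub>v u) \<in> carrier_vec n"
        using P Q Pu Qu by auto
      ultimately show ?thesis using \<open>P *\<^sub>v (P *\<^sub>v u) = Q *\<^sub>v (Q *\<^sub>v u)\<close> u(1)
        by (simp add: minus_scalar_prod_distrib[of _ n])
    qed
    moreover have "(P *\<^sub>v (D *\<^sub>v u)) \<bullet>c u = complex_of_real (d i) * ((P *\<^sub>v u) \<bullet>c u)"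
      unfolding u(2) using P u Pu by (simp add: mult_mat_vec[of _ n n])
    moreover have "(D *\<^sub>v (Q *\<^sub>v u)) \<bullet>c u = complex_of_real (d i) * ((Q *\<^sub>v u) \<bullet>c u)"
      using cscalar_prod_mult_mat_vec[OF D Qu u(1)] u Qu
      by (simp add: Dadj u(2) conjugate_smult_vec)
    ultimately have "complex_of_real (d i) * ((P *\<^sub>v u) \<bullet>c u + (Q *\<^sub>v u) \<bullet>c u) = 0"
      by (simp add: distrib_left)
    then have "(P *\<^sub>v u) \<bullet>c u + (Q *\<^sub>v u) \<bullet>c u = 0" using nz by simp
    then have "Re ((P *\<^sub>v u) \<bullet>c u) + Re ((Q *\<^sub>v u) \<bullet>c u) = 0" by (metis plus_complex.sel(1) zero_complex.sel(1))
    moreover have "0 \<le> Re ((P *\<^sub>v u) \<bullet>c u)" "0 \<le> Re ((Q *\<^sub>v u) \<bullet>c u)"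
      using P Q u by (auto simp: pos_semidef_def)
    moreover have "complex_of_real (d i) = (P *\<^sub>v u) \<bullet>c u - (Q *\<^sub>v u) \<bullet>c u"
    proof -
      have "complex_of_real (d i) = (D *\<^sub>v u) \<bullet>c u" unfolding u(2) using u by simp
      also have "\<dots> = (P *\<^sub>v u) \<bullet>c u - (Q *\<^sub>v u) \<bullet>c u"
        unfolding split[OF u(1)] using Pu Qu u by (simp add: minus_scalar_prod_distrib[of _ n])
      finally show ?thesis .
    qed
    then have "d i = Re ((P *\<^sub>v u) \<bullet>c u) - Re ((Q *\<^sub>v u) \<bullet>c u)"
      by (metis Re_complex_of_real minus_complex.sel(1))
    ultimately show False using nz by linarith
  qed
  then have "real_diag n d = 0\<^sub>m n n" by (auto simp: real_diag_def intro!: eq_matI)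
  then have "D = 0\<^sub>m n n" unfolding DU using U by simp
  show ?thesis
  proof (rule eq_matI)
    fix i j assume "i < dim_row Q" "j < dim_col Q"
    then have ij: "i < n" "j < n" using Q by auto
    have "D $$ (i, j) = 0" using \<open>D = 0\<^sub>m n n\<close> ij by simp
    then show "P $$ (i, j) = Q $$ (i, j)" using P Q ij by (simp add: D_def)
  qed (use P Q in auto)
qed

lemma psd_sqrt_props:
  fixes A :: "complex mat"
  assumes A: "A \<in> carrier_mat n n" and psd: "pos_semidef A"
  shows "psd_sqrt A \<in> carrier_mat n n" "pos_semidef (psd_sqrt A)" "psd_sqrt A * psd_sqrt A = A"
proof -
  have "\<exists>!P. P \<in> carrier_mat (dim_row A) (dim_row A) \<and> pos_semidef P \<and> P * P = A"
    using pos_semidef_sqrt_exists[OF A psd] pos_semidef_sqrt_unique[of _ n] A by (metis carrier_matD(1))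
  from theI'[OF this, folded psd_sqrt_def] A
  show "psd_sqrt A \<in> carrier_mat n n" "pos_semidef (psd_sqrt A)" "psd_sqrt A * psd_sqrt A = A" by auto
qed

section \<open>Vectors attached to singular values\<close>

text \<open>An eigenvector \<open>w\<close> of the square root of \<open>A * mat_adjoint A\<close>
  satisfies |A^* w| = s |w|. Passing to the conjugate of \<open>w\<close> turns this into a
  statement about linear combinations of the rows of \<open>A\<close>, the form in which the random
  sums appear.\<close>

lemma smallest_singular_value_witness:
  fixes A :: "complex mat"
  assumes A: "A \<in> carrier_mat n n" and n: "1 \<le> n"
  obtains v :: "nat \<Rightarrow> complex" where "(\<Sum>i\<in>{0..<n}. (cmod (v i))\<^sup>2) = 1"
    "L2_set (\<lambda>j. cmod (\<Sum>i\<in>{0..<n}. v i * A $$ (i, j))) {0..<n} = smallest_singular_value A"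
proof -
  define H where "H = A * mat_adjoint A"
  define P where "P = psd_sqrt H"
  have adj: "mat_adjoint A \<in> carrier_mat n n" using A by simp
  have H: "H \<in> carrier_mat n n" using A by (simp add: H_def)
  have P: "P \<in> carrier_mat n n" "pos_semidef P" "P * P = H"
    using psd_sqrt_props[OF H] pos_semidef_mult_adjoint[OF A] by (simp_all add: P_def H_def)
  define S where "S = {s :: real. eigenvalue P (complex_of_real s)}"
  define s where "s = smallest_singular_value A"
  have "finite (spectrum P)" using card_finite_spectrum[OF P(1)] by simp
  then have "finite (complex_of_real -` spectrum P)" by (rule finite_vimageI) (simp add: inj_def)
  then have finS: "finite S" by (simp add: S_def spectrum_def vimage_def)
  obtain k v where "eigenvector P v k"
    using spectrum_non_empty[OF P(1)] n by (auto simp: spectrum_def eigenvalue_def)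
  moreover from this have "k \<in> \<real>" using hermitian_eigenvalue_real[OF P(1)] P(2) by (auto simp: pos_semidef_def)
  ultimately have "S \<noteq> {}" by (auto simp: S_def eigenvalue_def elim!: Reals_cases)
  then have "s \<in> S" using Min_in[OF finS] by (simp add: s_def smallest_singular_value_def S_def P_def H_def)
  then obtain w where "eigenvector P w (complex_of_real s)" by (auto simp: S_def eigenvalue_def)
  then have w: "w \<in> carrier_vec n" "w \<noteq> 0\<^sub>v n" "P *\<^sub>v w = complex_of_real s \<cdot>\<^sub>v w"
    using P by (auto simp: eigenvector_def)
  define q where "q = (\<Sum>i\<in>{0..<n}. (cmod (w $ i))\<^sup>2)"
  have ww: "w \<bullet>c w = complex_of_real q" using cscalar_prod_self[of w] w by (simp add: q_def)
  have "q \<noteq> 0" using conjugate_square_eq_0_vec[OF w(1)] w(2) unfolding ww by simp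
  moreover have "0 \<le> q" unfolding q_def by (intro sum_nonneg) auto
  ultimately have q: "0 < q" by simp
  \<comment> \<open>The norm computed below determines \<open>s\<close> only up to sign.\<close>
  have s0: "0 \<le> s"
  proof -
    have "0 \<le> Re ((P *\<^sub>v w) \<bullet>c w)" using P w by (auto simp: pos_semidef_def)
    then show ?thesis unfolding w(3) using w ww q by (simp add: zero_le_mult_iff)
  qed
  have Hw: "H *\<^sub>v w = complex_of_real (s\<^sup>2) \<cdot>\<^sub>v w"
  proof -
    have "H *\<^sub>v w = P *\<^sub>v (P *\<^sub>v w)" unfolding P(3)[symmetric] using P w by (intro assoc_mult_mat_vec) auto
    also have "\<dots> = complex_of_real s \<cdot>\<^sub>v (complex_of_real s \<cdot>\<^sub>v w)"
      unfolding w(3) using P w by (simp add: mult_mat_vec[of _ n n])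
    finally show ?thesis by (simp add: smult_smult_assoc power2_eq_square)
  qed
  define a where "a = mat_adjoint A *\<^sub>v w"
  have a: "a \<in> carrier_vec n" unfolding a_def using adj w by auto
  have "a \<bullet>c a = (H *\<^sub>v w) \<bullet>c w"
  proof -
    have "H *\<^sub>v w = A *\<^sub>v a" unfolding H_def a_def using A adj w by (intro assoc_mult_mat_vec) auto
    then show ?thesis using cscalar_prod_mult_mat_vec[OF A a w(1)] by (simp add: a_def)
  qed
  also have "\<dots> = complex_of_real (s\<^sup>2 * q)" unfolding Hw using w ww by simp
  finally have aa: "(\<Sum>j\<in>{0..<n}. (cmod (a $ j))\<^sup>2) = s\<^sup>2 * q"
    unfolding cscalar_prod_self of_real_eq_iff using a by simp
  have aj: "cmod (a $ j) = cmod (\<Sum>i\<in>{0..<n}. cnj (w $ i) * A $$ (i, j))" if j: "j < n" for j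
  proof -
    have "a $ j = (\<Sum>i\<in>{0..<n}. cnj (A $$ (i, j)) * w $ i)"
      unfolding a_def using A w j by (simp add: scalar_prod_def)
    also have "\<dots> = cnj (\<Sum>i\<in>{0..<n}. cnj (w $ i) * A $$ (i, j))" by (simp add: mult.commute)
    finally show ?thesis by (simp only: complex_mod_cnj)
  qed
  define v where "v i = cnj (w $ i) / complex_of_real (sqrt q)" for i
  show ?thesis
  proof (rule that[of v])
    have "(\<Sum>i\<in>{0..<n}. (cmod (v i))\<^sup>2) = (\<Sum>i\<in>{0..<n}. (cmod (w $ i))\<^sup>2) / q"
      using q by (simp add: v_def norm_divide power_divide sum_divide_distrib)
    then show "(\<Sum>i\<in>{0..<n}. (cmod (v i))\<^sup>2) = 1" using q by (simp add: q_def)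
    have "(\<Sum>j\<in>{0..<n}. (cmod (\<Sum>i\<in>{0..<n}. v i * A $$ (i, j)))\<^sup>2) = (\<Sum>j\<in>{0..<n}. (cmod (a $ j))\<^sup>2 / q)"
    proof (rule sum.cong[OF refl])
      fix j assume "j \<in> {0..<n}"
      then have j: "j < n" by simp
      have "(\<Sum>i\<in>{0..<n}. v i * A $$ (i, j)) = (\<Sum>i\<in>{0..<n}. cnj (w $ i) * A $$ (i, j)) / complex_of_real (sqrt q)"
        by (simp add: v_def sum_divide_distrib)
      then show "(cmod (\<Sum>i\<in>{0..<n}. v i * A $$ (i, j)))\<^sup>2 = (cmod (a $ j))\<^sup>2 / q"
        unfolding aj[OF j] using q by (simp add: norm_divide power_divide)
    qed
    also have "\<dots> = s\<^sup>2" unfolding sum_divide_distrib[symmetric] aa using q by simp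
    finally show "L2_set (\<lambda>j. cmod (\<Sum>i\<in>{0..<n}. v i * A $$ (i, j))) {0..<n} = smallest_singular_value A"
      using s0 by (simp add: L2_set_def s_def)
  qed
qed

text \<open>Replacing row \<open>i\<close> by zeros makes the determinant vanish, by expansion along
  that row; a null vector of the new matrix is orthogonal to all other rows.\<close>

lemma singular_row_deleted_kernel:
  fixes A :: "complex mat"
  assumes A: "A \<in> carrier_mat n n" and i: "i < n"
  obtains \<eta> :: "nat \<Rightarrow> complex" where "(\<Sum>j\<in>{0..<n}. (cmod (\<eta> j))\<^sup>2) = 1"
    "\<And>k. k < n \<Longrightarrow> k \<noteq> i \<Longrightarrow> (\<Sum>j\<in>{0..<n}. A $$ (k, j) * \<eta> j) = 0"
proof -
  define B where "B = Matrix.mat n n (\<lambda>(k, j). if k = i then 0 else A $$ (k, j))"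
  have B: "B \<in> carrier_mat n n" by (simp add: B_def)
  have "Determinant.det B = 0"
  proof -
    have "Determinant.det B = (\<Sum>j<n. B $$ (i, j) * cofactor B i j)" by (rule laplace_expansion_row[OF B i])
    also have "\<dots> = 0" using i by (intro sum.neutral) (auto simp: B_def)
    finally show ?thesis .
  qed
  then obtain w where w: "w \<in> carrier_vec n" "w \<noteq> 0\<^sub>v n" "B *\<^sub>v w = 0\<^sub>v n"
    using det_0_iff_vec_prod_zero_field[OF B] by auto
  define q where "q = (\<Sum>j\<in>{0..<n}. (cmod (w $ j))\<^sup>2)"
  have "w \<bullet>c w = complex_of_real q" using cscalar_prod_self[of w] w by (simp add: q_def)
  then have "q \<noteq> 0" using conjugate_square_eq_0_vec[OF w(1)] w(2) by auto
  moreover have "0 \<le> q" unfolding q_def by (intro sum_nonneg) auto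
  ultimately have q: "0 < q" by simp
  show ?thesis
  proof (rule that[of "\<lambda>j. w $ j / complex_of_real (sqrt q)"])
    have "(\<Sum>j\<in>{0..<n}. (cmod (w $ j / complex_of_real (sqrt q)))\<^sup>2) = (\<Sum>j\<in>{0..<n}. (cmod (w $ j))\<^sup>2) / q"
      using q by (simp add: norm_divide power_divide sum_divide_distrib)
    then show "(\<Sum>j\<in>{0..<n}. (cmod (w $ j / complex_of_real (sqrt q)))\<^sup>2) = 1" using q by (simp add: q_def)
    fix k assume k: "k < n" "k \<noteq> i"
    have "(B *\<^sub>v w) $ k = 0" using w(3) k by simp
    then have "(\<Sum>j\<in>{0..<n}. A $$ (k, j) * w $ j) = 0" using k w(1) by (simp add: B_def scalar_prod_def)
    then show "(\<Sum>j\<in>{0..<n}. A $$ (k, j) * (w $ j / complex_of_real (sqrt q))) = 0"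
      by (simp add: sum_divide_distrib[symmetric])
  qed
qed

section \<open>Assembling the bound\<close>

lemma perm_avg_commute:
  "perm_avg A (\<lambda>a. perm_avg B (\<lambda>b. f a b)) = perm_avg B (\<lambda>b. perm_avg A (\<lambda>a. f a b))"
  unfolding perm_avg_def sum_divide_distrib[symmetric]
  by (subst sum.swap) (simp add: sum_divide_distrib mult.commute)

definition permute_row :: "'i set \<Rightarrow> 'i \<Rightarrow> ('i \<Rightarrow> 'i) \<Rightarrow> 'i \<times> 'i \<Rightarrow> 'i \<times> 'i" where
  "permute_row I i \<sigma> e = (if fst e = i \<and> snd e \<in> I then (i, \<sigma> (snd e)) else e)"

lemma permute_row_simps:
  "j \<in> I \<Longrightarrow> permute_row I i \<sigma> (i, j) = (i, \<sigma> j)"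
  "k \<noteq> i \<Longrightarrow> permute_row I i \<sigma> (k, j) = (k, j)"
  by (simp_all add: permute_row_def)

lemma permute_row_permutes:
  assumes "i \<in> I" "\<sigma> permutes I"
  shows "permute_row I i \<sigma> permutes (I \<times> I)"
proof (rule bij_imp_permutes)
  show "bij_betw (permute_row I i \<sigma>) (I \<times> I) (I \<times> I)"
    by (rule bij_betw_byWitness[where f' = "permute_row I i (Hilbert_Choice.inv \<sigma>)"])
       (use assms permutes_in_image[OF assms(2)] permutes_in_image[OF permutes_inv[OF assms(2)]] permutes_inverses[OF assms(2)] in
        \<open>auto simp: permute_row_def split: if_splits\<close>)
qed (auto simp: permute_row_def assms)

text \<open>Reordering row \<open>i\<close> by an independent uniform \<open>\<sigma>\<close> does
  not change the law. With \<open>p\<close> held fixed, everything that depends on the other rows is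
  frozen while \<open>\<sigma>\<close> remains random.\<close>

lemma perm_avg_permute_row:
  fixes f :: "('i \<times> 'i \<Rightarrow> 'i \<times> 'i) \<Rightarrow> real"
  assumes "finite I" "i \<in> I"
  shows "perm_avg (I \<times> I) f = perm_avg (I \<times> I) (\<lambda>p. perm_avg I (\<lambda>\<sigma>. f (p \<circ> permute_row I i \<sigma>)))"
proof -
  have "perm_avg (I \<times> I) f = perm_avg I (\<lambda>\<sigma>. perm_avg (I \<times> I) f)"
    by (rule perm_avg_const[OF assms(1), symmetric])
  also have "\<dots> = perm_avg I (\<lambda>\<sigma>. perm_avg (I \<times> I) (\<lambda>p. f (p \<circ> permute_row I i \<sigma>)))"
    by (intro perm_avg_cong perm_avg_compose[symmetric] permute_row_permutes assms)
  also have "\<dots> = perm_avg (I \<times> I) (\<lambda>p. perm_avg I (\<lambda>\<sigma>. f (p \<circ> permute_row I i \<sigma>)))"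
    by (rule perm_avg_commute)
  finally show ?thesis .
qed

text \<open>The random matrix and its transpose have the same law. \<open>prod.swap\<close> also
  moves points outside the index square, so it is cut off there; hence the condition that
  \<open>f\<close> sees entries inside only.\<close>

lemma perm_avg_transpose:
  fixes f :: "('i \<times> 'i \<Rightarrow> 'a) \<Rightarrow> real" and x :: "'i \<times> 'i \<Rightarrow> 'a"
  assumes "\<And>X Y. (\<And>e. e \<in> I \<times> I \<Longrightarrow> X e = Y e) \<Longrightarrow> f X = f Y"
  shows "perm_avg (I \<times> I) (\<lambda>p. f (\<lambda>e. x (p (prod.swap e)))) = perm_avg (I \<times> I) (\<lambda>p. f (\<lambda>e. x (p e)))"
proof -
  define \<tau> where "\<tau> = (\<lambda>e. if e \<in> I \<times> I then prod.swap e else e)"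
  have "\<tau> permutes (I \<times> I)"
    by (rule bij_imp_permutes)
       (auto simp: \<tau>_def intro!: bij_betw_byWitness[where f' = \<tau>])
  then have "perm_avg (I \<times> I) (\<lambda>p. f (\<lambda>e. x ((p \<circ> \<tau>) e))) = perm_avg (I \<times> I) (\<lambda>p. f (\<lambda>e. x (p e)))"
    by (rule perm_avg_compose)
  moreover have "f (\<lambda>e. x ((p \<circ> \<tau>) e)) = f (\<lambda>e. x (p (prod.swap e)))" for p
    by (rule assms) (auto simp: \<tau>_def)
  ultimately show ?thesis by simp
qed

text \<open>Invariant under reordering the row, and exactly what leaves variance at least 1/2 - 1/4
  = 1/4 after the row has been centred.\<close>

definition balanced_row :: "'i set \<Rightarrow> ('i \<times> 'i \<Rightarrow> real) \<Rightarrow> 'i \<Rightarrow> ('i \<times> 'i \<Rightarrow> 'i \<times> 'i) \<Rightarrow> bool" where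
  "balanced_row I x i p \<longleftrightarrow> card I / 2 \<le> (\<Sum>j\<in>I. (x (p (i, j)))\<^sup>2) \<and> \<bar>\<Sum>j\<in>I. x (p (i, j))\<bar> \<le> card I / 2"

context
  fixes I :: "'i set" and x :: "'i \<times> 'i \<Rightarrow> real" and K :: real
  assumes finI: "finite I" "I \<noteq> {}" and sum0: "(\<Sum>e\<in>I \<times> I. x e) = 0"
    and var: "(\<Sum>e\<in>I \<times> I. (x e)\<^sup>2) = card (I \<times> I)"
    and bd: "\<And>e. e \<in> I \<times> I \<Longrightarrow> \<bar>x e\<bar> \<le> K" and K: "1 \<le> K"
begin

text \<open>Removes the two side conditions of \<open>nearly_constant_prob\<close> by paying for
  their failure: operator norm above \<open>56 * K * sqrt (card I)\<close>, or more than 3/8 of the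
  variance in the lines of \<open>J\<close>.\<close>

lemma almost_null_prob:
  fixes m \<rho> :: real and w :: complex
  assumes J: "J \<subseteq> I" "4 * card J \<le> card I" "card I \<le> 5 * card J"
    and m: "0 < m" "4 * m \<le> card I" and \<rho>: "0 < \<rho>" "\<rho> \<le> 1/8"
    and small: "4 * \<rho> * (56 * K * sqrt (card I) + cmod w) \<le> sqrt (card I) / 60"
  shows "perm_avg (I \<times> I) (\<lambda>p. of_bool (almost_null I (\<lambda>e. x (p e)) J m \<rho> w))
    \<le> 25 / \<rho>\<^sup>2 * exp (m * (ln (card I / m) + 4 * ln (1 / \<rho>) + 18) - card I / (20000 * K\<^sup>2))
      + exp (- real (card I)) + exp (- ((real (card I))\<^sup>2 / (64 * K\<^sup>2)))"
proof -
  let ?E = "I \<times> I"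
  define H where "H = 56 * K * sqrt (card I)"
  have cardE: "real (card ?E) = (real (card I))\<^sup>2" by (simp add: card_cartesian_product power2_eq_square)
  have "perm_avg ?E (\<lambda>p. of_bool (almost_null I (\<lambda>e. x (p e)) J m \<rho> w) :: real)
    \<le> perm_avg ?E (\<lambda>p. of_bool (bilinear_bound I (\<lambda>e. x (p e)) H \<and>
        (\<Sum>e\<in>I \<times> J. (x (p e))\<^sup>2) \<le> 3/8 * card (I \<times> I) \<and>
        almost_null I (\<lambda>e. x (p e)) J m \<rho> w)
      + of_bool (\<not> bilinear_bound I (\<lambda>e. x (p e)) H)
      + of_bool (3/8 * ((1::real) * card ?E) < (\<Sum>e\<in>I \<times> J. (x (p e))\<^sup>2)))"
    by (intro perm_avg_mono) auto
  also have "\<dots> = perm_avg ?E (\<lambda>p. of_bool (bilinear_bound I (\<lambda>e. x (p e)) H \<and>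
        (\<Sum>e\<in>I \<times> J. (x (p e))\<^sup>2) \<le> 3/8 * card (I \<times> I) \<and>
        almost_null I (\<lambda>e. x (p e)) J m \<rho> w))
      + perm_avg ?E (\<lambda>p. of_bool (\<not> bilinear_bound I (\<lambda>e. x (p e)) H))
      + perm_avg ?E (\<lambda>p. of_bool (3/8 * ((1::real) * card ?E) < (\<Sum>e\<in>I \<times> J. (x (p e))\<^sup>2)))"
    by (simp only: perm_avg_add)
  also have "\<dots> \<le> 25 / \<rho>\<^sup>2 * exp (m * (ln (card I / m) + 4 * ln (1 / \<rho>) + 18) - card I / (20000 * K\<^sup>2))
      + exp (- real (card I)) + exp (- ((1::real) * card ?E / (64 * K\<^sup>2)))"
  proof (intro add_mono)
    show "perm_avg ?E (\<lambda>p. of_bool (\<not> bilinear_bound I (\<lambda>e. x (p e)) H)) \<le> exp (- real (card I))"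
      unfolding H_def using K by (intro bilinear_bound_prob finI sum0 bd) auto
    show "perm_avg ?E (\<lambda>p. of_bool (3/8 * ((1::real) * card ?E) < (\<Sum>e\<in>I \<times> J. (x (p e))\<^sup>2))) \<le> exp (- ((1::real) * card ?E / (64 * K\<^sup>2)))"
    proof (rule perm_avg_sum_squares_upper_tail)
      show "4 * card (I \<times> J) \<le> card ?E" using J by (simp add: card_cartesian_product)
    qed (use finI J var bd K in auto)
    show "perm_avg ?E (\<lambda>p. of_bool (bilinear_bound I (\<lambda>e. x (p e)) H \<and>
        (\<Sum>e\<in>I \<times> J. (x (p e))\<^sup>2) \<le> 3/8 * card (I \<times> I) \<and>
        almost_null I (\<lambda>e. x (p e)) J m \<rho> w))
      \<le> 25 / \<rho>\<^sup>2 * exp (m * (ln (card I / m) + 4 * ln (1 / \<rho>) + 18) - card I / (20000 * K\<^sup>2))"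
      by (rule nearly_constant_prob[OF finI sum0 var bd K J m \<rho>]) (use K small in \<open>auto simp: H_def\<close>)
  qed
  finally show ?thesis by (simp add: cardE)
qed

text \<open>Needed for normals to rows: their equations run over rows where those of a singular
  vector run over columns.\<close>

lemma almost_null_transpose_prob:
  assumes J: "J \<subseteq> I"
  shows "perm_avg (I \<times> I) (\<lambda>p. of_bool (almost_null I (\<lambda>e. x (p (prod.swap e))) J m \<rho> w) :: real)
    = perm_avg (I \<times> I) (\<lambda>p. of_bool (almost_null I (\<lambda>e. x (p e)) J m \<rho> w))"
proof (rule perm_avg_transpose[where f = "\<lambda>X. of_bool (almost_null I X J m \<rho> w)"])
  fix X Y :: "'i \<times> 'i \<Rightarrow> real"
  assume eq: "\<And>e. e \<in> I \<times> I \<Longrightarrow> X e = Y e"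
  have "L2_set (\<lambda>j. cmod ((\<Sum>i\<in>I. v i * X (i, j)) - w * v j)) J = L2_set (\<lambda>j. cmod ((\<Sum>i\<in>I. v i * Y (i, j)) - w * v j)) J"
    for v :: "'i \<Rightarrow> complex"
  proof (rule L2_set_cong[OF refl])
    fix j assume "j \<in> J"
    then have "(\<Sum>i\<in>I. v i * X (i, j)) = (\<Sum>i\<in>I. v i * Y (i, j))"
      using J by (intro sum.cong refl) (auto simp: eq)
    then show "cmod ((\<Sum>i\<in>I. v i * X (i, j)) - w * v j) = cmod ((\<Sum>i\<in>I. v i * Y (i, j)) - w * v j)" by simp
  qed
  then show "of_bool (almost_null I X J m \<rho> w) = (of_bool (almost_null I Y J m \<rho> w) :: real)"
    by (simp add: almost_null_def)
qed

lemma balanced_row_prob: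
  assumes i: "i \<in> I"
  shows "perm_avg (I \<times> I) (\<lambda>p. of_bool (\<not> balanced_row I x i p)) \<le> 3 * exp (- (card I / (64 * K\<^sup>2)))"
proof -
  let ?E = "I \<times> I"
  define n where "n = real (card I)"
  define T where "T = {i} \<times> I"
  have T: "T \<subseteq> ?E" "card T = card I" using i by (auto simp: T_def card_cartesian_product)
  have finE: "finite ?E" using finI by simp
  have sumT: "(\<Sum>e\<in>T. f e) = (\<Sum>j\<in>I. f (i, j))" for f :: "'i \<times> 'i \<Rightarrow> real"
    unfolding T_def by (simp add: sum.cartesian_product')
  have sq: "perm_avg ?E (\<lambda>p. of_bool ((\<Sum>j\<in>I. (x (p (i, j)))\<^sup>2) < n / 2)) \<le> exp (- (n / (64 * K\<^sup>2)))"
  proof -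
    have "perm_avg ?E (\<lambda>p. of_bool ((\<Sum>e\<in>T. (x (p e))\<^sup>2) < card T / 2)) \<le> exp (- (card T / (8 * K\<^sup>2)))"
      by (rule perm_avg_sum_squares_lower_tail[OF finE var bd]) (use K T in auto)
    also have "\<dots> \<le> exp (- (n / (64 * K\<^sup>2)))"
      using K by (simp add: T n_def frac_le)
    finally show ?thesis by (simp add: sumT T n_def)
  qed
  have lin: "perm_avg ?E (\<lambda>p. of_bool (n / 2 < s * (\<Sum>j\<in>I. x (p (i, j))))) \<le> exp (- (n / (64 * K\<^sup>2)))"
    if s: "s = 1 \<or> s = -1" for s :: real
  proof -
    \<comment> \<open>The minimizer of \<open>4 * K^2 * n * \<mu>^2 - \<mu> * n / 2\<close>.\<close>
    define \<mu> where "\<mu> = 1 / (16 * K\<^sup>2)"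
    have \<mu>: "0 < \<mu>" using K by (simp add: \<mu>_def)
    have "perm_avg ?E (\<lambda>p. of_bool (n / 2 < s * (\<Sum>j\<in>I. x (p (i, j)))))
      \<le> perm_avg ?E (\<lambda>p. exp (\<mu> * (s * (\<Sum>j\<in>I. x (p (i, j))) - n / 2)))"
      using \<mu> by (intro perm_avg_le_exp_moment mult_nonneg_nonneg) auto
    also have "\<dots> = perm_avg ?E (\<lambda>p. exp (- (\<mu> * (n / 2))) * exp (\<Sum>e\<in>T. (\<mu> * s) * x (p e)))"
      unfolding exp_add[symmetric] sumT sum_distrib_left[symmetric] by (simp add: algebra_simps)
    also have "\<dots> = exp (- (\<mu> * (n / 2))) * perm_avg ?E (\<lambda>p. exp (\<Sum>e\<in>T. (\<mu> * s) * x (p e)))"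
      by (rule perm_avg_cmult)
    also have "\<dots> \<le> exp (- (\<mu> * (n / 2))) * exp (4 * K\<^sup>2 * (\<Sum>e\<in>T. (\<mu> * s)\<^sup>2))"
      by (intro mult_left_mono perm_avg_exp_le finE sum0 bd T) auto
    also have "(\<Sum>e\<in>T. (\<mu> * s)\<^sup>2) = n * \<mu>\<^sup>2" using s T by (auto simp: n_def)
    also have "exp (- (\<mu> * (n / 2))) * exp (4 * K\<^sup>2 * (n * \<mu>\<^sup>2)) = exp (- (n / (64 * K\<^sup>2)))"
    proof -
      have "4 * K\<^sup>2 * (n * \<mu>\<^sup>2) = \<mu> * (n / 4)" using K by (simp add: \<mu>_def power2_eq_square)
      then show ?thesis unfolding exp_add[symmetric] by (simp add: \<mu>_def)
    qed
    finally show ?thesis .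
  qed
  have "perm_avg ?E (\<lambda>p. of_bool (\<not> balanced_row I x i p) :: real)
     \<le> perm_avg ?E (\<lambda>p. of_bool ((\<Sum>j\<in>I. (x (p (i, j)))\<^sup>2) < n / 2)
        + of_bool (n / 2 < 1 * (\<Sum>j\<in>I. x (p (i, j)))) + of_bool (n / 2 < (-1) * (\<Sum>j\<in>I. x (p (i, j)))))"
    by (intro perm_avg_mono) (auto simp: balanced_row_def n_def)
  also have "\<dots> = perm_avg ?E (\<lambda>p. of_bool ((\<Sum>j\<in>I. (x (p (i, j)))\<^sup>2) < n / 2))
        + perm_avg ?E (\<lambda>p. of_bool (n / 2 < 1 * (\<Sum>j\<in>I. x (p (i, j)))))
        + perm_avg ?E (\<lambda>p. of_bool (n / 2 < (-1) * (\<Sum>j\<in>I. x (p (i, j)))))"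
    by (simp only: perm_avg_add)
  also have "\<dots> \<le> exp (- (n / (64 * K\<^sup>2))) + exp (- (n / (64 * K\<^sup>2))) + exp (- (n / (64 * K\<^sup>2)))"
    by (intro add_mono sq lin) auto
  finally show ?thesis by (simp add: n_def)
qed

text \<open>The vector \<open>\<eta> p\<close> and the target \<open>c p\<close> ignore the order of
  row \<open>i\<close>, so after conditioning on all but that order they are constants and the small
  ball bound applies to the rearranged row.\<close>

lemma row_small_ball_prob:
  fixes m \<rho> \<epsilon> :: real and \<eta> :: "('i \<times> 'i \<Rightarrow> 'i \<times> 'i) \<Rightarrow> 'i \<Rightarrow> complex" and c :: "('i \<times> 'i \<Rightarrow> 'i \<times> 'i) \<Rightarrow> complex"
  assumes n: "16 \<le> card I" and i: "i \<in> I" and m: "0 < m" "4 * m \<le> card I" and \<rho>: "0 < \<rho>" and \<epsilon>: "0 \<le> \<epsilon>"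
    and \<eta>: "\<And>p. p permutes (I \<times> I) \<Longrightarrow> (\<Sum>j\<in>I. (cmod (\<eta> p j))\<^sup>2) = 1"
    and \<eta>_inv: "\<And>p \<sigma>. \<sigma> permutes I \<Longrightarrow> \<eta> (p \<circ> permute_row I i \<sigma>) = \<eta> p"
    and c_inv: "\<And>p \<sigma>. \<sigma> permutes I \<Longrightarrow> c (p \<circ> permute_row I i \<sigma>) = c p"
  shows "perm_avg (I \<times> I) (\<lambda>p. of_bool (\<not> nearly_constant I m \<rho> (\<eta> p) \<and> balanced_row I x i p \<and>
        cmod ((\<Sum>j\<in>I. \<eta> p j * x (p (i, j))) - c p) \<le> \<epsilon>))
     \<le> 300 * (\<epsilon> + 4 * K / sqrt m) / \<rho> + exp (- (card I / (1024 * K\<^sup>2)))" (is "perm_avg _ (\<lambda>p. of_bool (?F p)) \<le> ?B")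
proof -
  let ?E = "I \<times> I"
  define N where "N = real (card I)"
  have N: "0 < N" using n by (simp add: N_def)
  have "perm_avg ?E (\<lambda>p. of_bool (?F p) :: real) = perm_avg ?E (\<lambda>p. perm_avg I (\<lambda>\<sigma>. of_bool (?F (p \<circ> permute_row I i \<sigma>))))"
    by (rule perm_avg_permute_row[OF finI(1) i])
  also have "\<dots> \<le> ?B"
  proof (rule perm_avg_le_const)
    fix p assume p: "p permutes ?E"
    define u where "u j = x (p (i, j))" for j
    have u_bd: "\<bar>u j\<bar> \<le> K" if "j \<in> I" for j
      unfolding u_def using that i permutes_in_image[OF p] by (intro bd) simp
    have row: "x ((p \<circ> permute_row I i \<sigma>) (i, j)) = u (\<sigma> j)" if "j \<in> I" for \<sigma> j
      using that by (simp add: u_def permute_row_simps)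
    have bal: "balanced_row I x i (p \<circ> permute_row I i \<sigma>) \<longleftrightarrow> balanced_row I x i p" if \<sigma>: "\<sigma> permutes I" for \<sigma>
    proof -
      have "(\<Sum>j\<in>I. x ((p \<circ> permute_row I i \<sigma>) (i, j))) = (\<Sum>j\<in>I. u (\<sigma> j))"
        by (intro sum.cong refl row)
      also have "\<dots> = (\<Sum>j\<in>I. u j)" using sum.permute[OF \<sigma>, of u] by (simp add: comp_def)
      finally have 1: "(\<Sum>j\<in>I. x ((p \<circ> permute_row I i \<sigma>) (i, j))) = (\<Sum>j\<in>I. u j)" .
      have "(\<Sum>j\<in>I. (x ((p \<circ> permute_row I i \<sigma>) (i, j)))\<^sup>2) = (\<Sum>j\<in>I. (u (\<sigma> j))\<^sup>2)"
        by (intro sum.cong refl) (simp only: row)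
      also have "\<dots> = (\<Sum>j\<in>I. (u j)\<^sup>2)" using sum.permute[OF \<sigma>, of "\<lambda>j. (u j)\<^sup>2"] by (simp add: comp_def)
      finally have 2: "(\<Sum>j\<in>I. (x ((p \<circ> permute_row I i \<sigma>) (i, j)))\<^sup>2) = (\<Sum>j\<in>I. (u j)\<^sup>2)" .
      show ?thesis unfolding balanced_row_def 1 2 by (simp add: u_def)
    qed
    show "perm_avg I (\<lambda>\<sigma>. of_bool (?F (p \<circ> permute_row I i \<sigma>))) \<le> ?B"
    proof (cases "\<not> nearly_constant I m \<rho> (\<eta> p) \<and> balanced_row I x i p")
      case False
      have "perm_avg I (\<lambda>\<sigma>. of_bool (?F (p \<circ> permute_row I i \<sigma>))) \<le> (0 :: real)"
        using False by (intro perm_avg_le_const finI) (auto simp: \<eta>_inv bal)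
      also have "0 \<le> ?B" using \<epsilon> K m \<rho> by (intro add_nonneg_nonneg divide_nonneg_nonneg mult_nonneg_nonneg) auto
      finally show ?thesis .
    next
      case True
      \<comment> \<open>The row is centred because the small ball bound wants sum zero; this shifts
        the target by the constant \<open>a\<close> times the sum of \<open>\<eta> p\<close>. As
        \<open>a\<close> is at most 1/2 in modulus, entries stay below \<open>2 * K\<close>, which
        is where 1024 = 4 * 256 comes from.\<close>
      define a where "a = (\<Sum>j\<in>I. u j) / N"
      define y where "y j = u j - a" for j
      define V where "V = (\<Sum>j\<in>I. (y j)\<^sup>2) / N"
      have bal_p: "N / 2 \<le> (\<Sum>j\<in>I. (u j)\<^sup>2)" "\<bar>\<Sum>j\<in>I. u j\<bar> \<le> N / 2"
        using True by (auto simp: balanced_row_def u_def N_def)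
      have a: "\<bar>a\<bar> \<le> 1/2" using bal_p(2) N by (simp add: a_def field_simps)
      have aN: "(\<Sum>j\<in>I. u j) = a * N" using N by (simp add: a_def)
      have "(\<Sum>j\<in>I. (y j)\<^sup>2) = (\<Sum>j\<in>I. (u j)\<^sup>2) - 2 * a * (\<Sum>j\<in>I. u j) + N * a\<^sup>2"
      proof -
        have "(y j)\<^sup>2 = (u j)\<^sup>2 - 2 * a * u j + a\<^sup>2" for j
          by (simp add: y_def power2_diff mult_ac)
        then have "(\<Sum>j\<in>I. (y j)\<^sup>2) = (\<Sum>j\<in>I. (u j)\<^sup>2) - 2 * a * (\<Sum>j\<in>I. u j) + (\<Sum>j\<in>I. a\<^sup>2)"
          by (simp only: sum.distrib sum_subtractf sum_distrib_left)
        also have "(\<Sum>j\<in>I. a\<^sup>2) = N * a\<^sup>2" by (simp only: sum_constant N_def)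
        finally show ?thesis .
      qed
      also have "\<dots> = (\<Sum>j\<in>I. (u j)\<^sup>2) - N * a\<^sup>2" unfolding aN by (simp add: power2_eq_square)
      also have "\<dots> \<ge> N / 2 - N * (1/4)"
      proof -
        have "\<bar>a\<bar>\<^sup>2 \<le> (1/2)\<^sup>2" using a by (intro power_mono) auto
        then have "N * a\<^sup>2 \<le> N * (1/4)" using N by (intro mult_left_mono) (auto simp: power2_eq_square)
        then show ?thesis using bal_p(1) by linarith
      qed
      finally have V: "1/4 \<le> V" using N by (simp add: V_def field_simps)
      have sum_y: "(\<Sum>j\<in>I. y j) = 0" using aN by (simp add: y_def sum_subtractf N_def)
      have var_y: "(\<Sum>j\<in>I. (y j)\<^sup>2) = V * card I" using N by (simp add: V_def N_def)
      have y_bd: "\<bar>y j\<bar> \<le> 2 * K" if "j \<in> I" for j using u_bd[OF that] a K by (simp add: y_def)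
      have "perm_avg I (\<lambda>\<sigma>. of_bool (?F (p \<circ> permute_row I i \<sigma>)) :: real)
        \<le> perm_avg I (\<lambda>\<sigma>. of_bool (cmod ((\<Sum>j\<in>I. \<eta> p j * y (\<sigma> j)) - (c p - a * (\<Sum>j\<in>I. \<eta> p j))) \<le> \<epsilon>))"
      proof (rule perm_avg_mono)
        fix \<sigma> assume \<sigma>: "\<sigma> permutes I"
        have "(\<Sum>j\<in>I. \<eta> p j * x ((p \<circ> permute_row I i \<sigma>) (i, j))) = (\<Sum>j\<in>I. \<eta> p j * complex_of_real (u (\<sigma> j)))"
          by (intro sum.cong refl) (simp only: row)
        also have "\<dots> = (\<Sum>j\<in>I. \<eta> p j * y (\<sigma> j)) + a * (\<Sum>j\<in>I. \<eta> p j)"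
          by (simp add: y_def right_diff_distrib sum_subtractf sum_distrib_left mult.commute)
        finally have eq: "(\<Sum>j\<in>I. \<eta> p j * x ((p \<circ> permute_row I i \<sigma>) (i, j))) - c p
          = (\<Sum>j\<in>I. \<eta> p j * y (\<sigma> j)) - (c p - a * (\<Sum>j\<in>I. \<eta> p j))" by simp
        show "of_bool (?F (p \<circ> permute_row I i \<sigma>))
          \<le> (of_bool (cmod ((\<Sum>j\<in>I. \<eta> p j * y (\<sigma> j)) - (c p - a * (\<Sum>j\<in>I. \<eta> p j))) \<le> \<epsilon>) :: real)"
          unfolding \<eta>_inv[OF \<sigma>] c_inv[OF \<sigma>] eq by simp
      qed
      also have "\<dots> \<le> 300 * (\<epsilon> + 2 * (2 * K) / sqrt m) / \<rho> + exp (- (card I / (256 * (2 * K)\<^sup>2)))"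
        by (rule perm_avg_small_ball[OF finI(1) n sum_y var_y y_bd _ V m \<rho> \<epsilon> \<eta>[OF p]]) (use K True in auto)
      also have "\<dots> = ?B" by (simp add: power_mult_distrib)
      finally show ?thesis .
    qed
  qed (use finI in auto)
  finally show ?thesis .
qed

end

section \<open>Normals to all rows but one\<close>

text \<open>The normal need not be unique, so one is chosen. The chosen property mentions only rows
  other than \<open>i\<close>, which makes the choice independent of row \<open>i\<close>.\<close>

definition row_kernel :: "nat \<Rightarrow> (nat \<times> nat \<Rightarrow> real) \<Rightarrow> complex \<Rightarrow> nat \<Rightarrow> nat \<Rightarrow> complex" where
  "row_kernel n X w i = (SOME \<eta>. (\<Sum>j\<in>{0..<n}. (cmod (\<eta> j))\<^sup>2) = 1 \<and>
     (\<forall>k\<in>{0..<n} - {i}. (\<Sum>j\<in>{0..<n}. \<eta> j * X (k, j)) - w * \<eta> k = 0))"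

lemma sum_mult_minus_diagonal:
  fixes a :: "'i \<Rightarrow> complex"
  assumes "finite I" "k \<in> I"
  shows "(\<Sum>j\<in>I. a j * (b j - (if j = k then w else 0))) = (\<Sum>j\<in>I. a j * b j) - w * a k"
    and "(\<Sum>j\<in>I. a j * (b j - (if k = j then w else 0))) = (\<Sum>j\<in>I. a j * b j) - w * a k"
proof -
  have "(\<Sum>j\<in>I. a j * (if j = k then w else 0)) = (\<Sum>j\<in>I. if j = k then a k * w else 0)"
    by (intro sum.cong) auto
  then have "(\<Sum>j\<in>I. a j * (if j = k then w else 0)) = w * a k" using assms by simp
  then show 1: "(\<Sum>j\<in>I. a j * (b j - (if j = k then w else 0))) = (\<Sum>j\<in>I. a j * b j) - w * a k"
    by (simp add: right_diff_distrib sum_subtractf)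
  have "(\<Sum>j\<in>I. a j * (b j - (if k = j then w else 0))) = (\<Sum>j\<in>I. a j * (b j - (if j = k then w else 0)))"
    by (intro sum.cong) auto
  then show "(\<Sum>j\<in>I. a j * (b j - (if k = j then w else 0))) = (\<Sum>j\<in>I. a j * b j) - w * a k"
    unfolding 1 .
qed

lemma row_kernel_props:
  assumes i: "i < n"
  shows "(\<Sum>j\<in>{0..<n}. (cmod (row_kernel n X w i j))\<^sup>2) = 1"
    and "k < n \<Longrightarrow> k \<noteq> i \<Longrightarrow> (\<Sum>j\<in>{0..<n}. row_kernel n X w i j * X (k, j)) - w * row_kernel n X w i k = 0"
proof -
  define A where "A = Matrix.mat n n (\<lambda>(k, j). complex_of_real (X (k, j)) - (if k = j then w else 0))"
  have A: "A \<in> carrier_mat n n" by (simp add: A_def)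
  obtain \<eta> :: "nat \<Rightarrow> complex" where \<eta>: "(\<Sum>j\<in>{0..<n}. (cmod (\<eta> j))\<^sup>2) = 1"
    "\<And>k. k < n \<Longrightarrow> k \<noteq> i \<Longrightarrow> (\<Sum>j\<in>{0..<n}. A $$ (k, j) * \<eta> j) = 0"
    by (rule singular_row_deleted_kernel[OF A i]) blast
  have "(\<Sum>j\<in>{0..<n}. \<eta> j * X (k, j)) - w * \<eta> k = 0" if k: "k < n" "k \<noteq> i" for k
  proof -
    have "(\<Sum>j\<in>{0..<n}. \<eta> j * X (k, j)) - w * \<eta> k = (\<Sum>j\<in>{0..<n}. \<eta> j * (complex_of_real (X (k, j)) - (if k = j then w else 0)))"
      using k by (subst sum_mult_minus_diagonal(2)) auto
    also have "\<dots> = (\<Sum>j\<in>{0..<n}. A $$ (k, j) * \<eta> j)"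
      using k by (intro sum.cong refl) (simp add: A_def mult.commute)
    finally show ?thesis using \<eta>(2)[OF k] by simp
  qed
  then have "\<exists>\<eta> :: nat \<Rightarrow> complex. (\<Sum>j\<in>{0..<n}. (cmod (\<eta> j))\<^sup>2) = 1 \<and>
     (\<forall>k\<in>{0..<n} - {i}. (\<Sum>j\<in>{0..<n}. \<eta> j * X (k, j)) - w * \<eta> k = 0)"
    using \<eta>(1) by (intro exI[of _ \<eta>]) auto
  from someI_ex[OF this, folded row_kernel_def]
  show "(\<Sum>j\<in>{0..<n}. (cmod (row_kernel n X w i j))\<^sup>2) = 1"
    and "k < n \<Longrightarrow> k \<noteq> i \<Longrightarrow> (\<Sum>j\<in>{0..<n}. row_kernel n X w i j * X (k, j)) - w * row_kernel n X w i k = 0"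
    by auto
qed

text \<open>The defining predicates coincide, so the choice operator returns the same vector. This
  yields the invariance under \<open>permute_row\<close>.\<close>

lemma row_kernel_cong:
  assumes "\<And>k j. k < n \<Longrightarrow> j < n \<Longrightarrow> k \<noteq> i \<Longrightarrow> X (k, j) = Y (k, j)"
  shows "row_kernel n X w i = row_kernel n Y w i"
proof -
  have eq: "(\<Sum>j\<in>{0..<n}. \<eta> j * X (k, j)) = (\<Sum>j\<in>{0..<n}. \<eta> j * Y (k, j))" if "k \<in> {0..<n} - {i}"
    for \<eta> :: "nat \<Rightarrow> complex" and k
    using that assms by (intro sum.cong refl) auto
  have "(\<forall>k\<in>{0..<n} - {i}. (\<Sum>j\<in>{0..<n}. \<eta> j * X (k, j)) - w * \<eta> k = 0)
    \<longleftrightarrow> (\<forall>k\<in>{0..<n} - {i}. (\<Sum>j\<in>{0..<n}. \<eta> j * Y (k, j)) - w * \<eta> k = 0)" for \<eta> :: "nat \<Rightarrow> complex"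
    by (intro ball_cong refl) (simp only: eq)
  then show ?thesis unfolding row_kernel_def by simp
qed

text \<open>Pairing the singular vector \<open>v\<close> with the unit normal to all rows but the \<open>i\<close>-th one bounds the
  inner product of row \<open>i\<close> with that normal by \<open>t / |v i|\<close>.\<close>

lemma almost_null_or_many_close_rows:
  fixes X :: "nat \<times> nat \<Rightarrow> real" and v :: "nat \<Rightarrow> complex" and m \<rho> t :: real
  assumes n: "0 < n" and m: "0 < m" and \<rho>: "0 < \<rho>" and t: "t \<le> sqrt n / 60"
    and v: "(\<Sum>i\<in>{0..<n}. (cmod (v i))\<^sup>2) = 1"
    and vA: "L2_set (\<lambda>j. cmod ((\<Sum>i\<in>{0..<n}. v i * X (i, j)) - w * v j)) {0..<n} \<le> t"
    and J: "J \<subseteq> {0..<n}" and J': "\<And>i. i < n \<Longrightarrow> J' i \<subseteq> {0..<n} - {i}"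
  shows "almost_null {0..<n} X J m \<rho> w \<or>
    m < card {i\<in>{0..<n}. almost_null {0..<n} (\<lambda>e. X (prod.swap e)) (J' i) m \<rho> w \<or>
      (\<not> nearly_constant {0..<n} m \<rho> (row_kernel n X w i) \<and>
       cmod ((\<Sum>j\<in>{0..<n}. row_kernel n X w i j * X (i, j)) - w * row_kernel n X w i i) \<le> t * sqrt n / \<rho>)}"
    (is "_ \<or> m < card ?G")
proof (cases "nearly_constant {0..<n} m \<rho> v")
  case True
  have "L2_set (\<lambda>j. cmod ((\<Sum>i\<in>{0..<n}. v i * X (i, j)) - w * v j)) J
     \<le> L2_set (\<lambda>j. cmod ((\<Sum>i\<in>{0..<n}. v i * X (i, j)) - w * v j)) {0..<n}"
    using J by (intro L2_set_subset_mono) auto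
  then have "L2_set (\<lambda>j. cmod ((\<Sum>i\<in>{0..<n}. v i * X (i, j)) - w * v j)) J \<le> sqrt (card {0..<n}) / 60"
    using vA t by simp
  then show ?thesis using True v unfolding almost_null_def by (intro disjI1 exI[of _ v] conjI)
next
  case False
  define S where "S = {i\<in>{0..<n}. \<rho> / sqrt n \<le> cmod (v i)}"
  have S: "S \<subseteq> {0..<n}" by (auto simp: S_def)
  \<comment> \<open>Otherwise \<open>v\<close> would be nearly constant with \<alpha> = 0, because
    coordinates outside \<open>S\<close> are below \<open>\<rho> / sqrt n\<close>.\<close>
  have "m < card S"
  proof (rule ccontr)
    assume "\<not> m < card S"
    moreover have "(\<Sum>i\<in>{0..<n} - S. (cmod (v i - 0))\<^sup>2) \<le> \<rho>\<^sup>2"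
    proof -
      have "(\<Sum>i\<in>{0..<n} - S. (cmod (v i - 0))\<^sup>2) \<le> (\<Sum>i\<in>{0..<n} - S. (\<rho> / sqrt n)\<^sup>2)"
        by (intro sum_mono power_mono) (auto simp: S_def)
      also have "\<dots> \<le> (\<Sum>i\<in>{0..<n}. (\<rho> / sqrt n)\<^sup>2)" by (intro sum_mono2) auto
      also have "\<dots> = \<rho>\<^sup>2" using n by (simp add: power_divide)
      finally show ?thesis .
    qed
    ultimately have "nearly_constant {0..<n} m \<rho> v"
      unfolding nearly_constant_def using S by (intro exI[of _ 0] exI[of _ S]) auto
    then show False using False by simp
  qed
  moreover have "S \<subseteq> ?G"
  proof
    fix i assume iS: "i \<in> S"
    then have i: "i < n" by (simp add: S_def)
    define \<eta> where "\<eta> = row_kernel n X w i"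
    have \<eta>1: "(\<Sum>j\<in>{0..<n}. (cmod (\<eta> j))\<^sup>2) = 1" unfolding \<eta>_def by (rule row_kernel_props(1)[OF i])
    define r where "r k = (\<Sum>j\<in>{0..<n}. \<eta> j * X (k, j)) - w * \<eta> k" for k
    have r0: "r k = 0" if "k < n" "k \<noteq> i" for k
      unfolding r_def \<eta>_def by (rule row_kernel_props(2)[OF i that])
    show "i \<in> ?G"
    proof (cases "nearly_constant {0..<n} m \<rho> \<eta>")
      case True
      \<comment> \<open>The equations of the rows other than \<open>i\<close> hold exactly, so a
        nearly constant normal is almost null for the transpose with defect zero.\<close>
      have "L2_set (\<lambda>k. cmod ((\<Sum>j\<in>{0..<n}. \<eta> j * X (prod.swap (j, k))) - w * \<eta> k)) (J' i) = L2_set (\<lambda>k. 0) (J' i)"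
      proof (rule L2_set_cong[OF refl])
        fix k assume "k \<in> J' i"
        then have "k < n" "k \<noteq> i" using J'[OF i] by auto
        then show "cmod ((\<Sum>j\<in>{0..<n}. \<eta> j * X (prod.swap (j, k))) - w * \<eta> k) = 0"
          using r0[of k] by (simp add: r_def)
      qed
      also have "\<dots> \<le> sqrt (card {0..<n}) / 60" by (simp add: L2_set_def)
      finally have "almost_null {0..<n} (\<lambda>e. X (prod.swap e)) (J' i) m \<rho> w"
        using True \<eta>1 unfolding almost_null_def by (intro exI[of _ \<eta>] conjI)
      then show ?thesis using i by simp
    next
      case False
      \<comment> \<open>Only the omitted row survives here; summing over columns first instead
        bounds the same quantity by \<open>t\<close> through Cauchy-Schwarz.\<close>
      have "(\<Sum>k\<in>{0..<n}. v k * r k) = (\<Sum>k\<in>{0..<n}. if k = i then v i * r i else 0)"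
        using r0 by (intro sum.cong) auto
      then have pair: "(\<Sum>k\<in>{0..<n}. v k * r k) = v i * r i" using i by simp
      have "(\<Sum>k\<in>{0..<n}. v k * r k) = (\<Sum>j\<in>{0..<n}. ((\<Sum>k\<in>{0..<n}. v k * X (k, j)) - w * v j) * \<eta> j)"
      proof -
        have "(\<Sum>k\<in>{0..<n}. v k * r k)
           = (\<Sum>k\<in>{0..<n}. \<Sum>j\<in>{0..<n}. v k * \<eta> j * X (k, j)) - (\<Sum>k\<in>{0..<n}. w * v k * \<eta> k)"
          by (simp add: r_def right_diff_distrib sum_subtractf sum_distrib_left mult_ac)
        also have "(\<Sum>k\<in>{0..<n}. \<Sum>j\<in>{0..<n}. v k * \<eta> j * X (k, j)) = (\<Sum>j\<in>{0..<n}. \<Sum>k\<in>{0..<n}. v k * \<eta> j * X (k, j))"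
          by (rule sum.swap)
        also have "(\<Sum>j\<in>{0..<n}. \<Sum>k\<in>{0..<n}. v k * \<eta> j * X (k, j)) - (\<Sum>k\<in>{0..<n}. w * v k * \<eta> k)
          = (\<Sum>j\<in>{0..<n}. ((\<Sum>k\<in>{0..<n}. v k * X (k, j)) - w * v j) * \<eta> j)"
          by (simp add: right_diff_distrib sum_subtractf sum_distrib_left mult_ac)
        finally show ?thesis .
      qed
      then have "cmod (v i * r i) \<le> (\<Sum>j\<in>{0..<n}. \<bar>cmod ((\<Sum>k\<in>{0..<n}. v k * X (k, j)) - w * v j)\<bar> * \<bar>cmod (\<eta> j)\<bar>)"
        unfolding pair by (simp add: norm_mult[symmetric] norm_sum)
      also have "\<dots> \<le> L2_set (\<lambda>j. cmod ((\<Sum>k\<in>{0..<n}. v k * X (k, j)) - w * v j)) {0..<n} * L2_set (\<lambda>j. cmod (\<eta> j)) {0..<n}"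
        by (rule L2_set_mult_ineq)
      also have "\<dots> \<le> t * 1" using vA \<eta>1 by (simp add: L2_set_def)
      finally have "cmod (v i) * cmod (r i) \<le> t" by (simp add: norm_mult)
      moreover have "\<rho> / sqrt n * cmod (r i) \<le> cmod (v i) * cmod (r i)"
        using iS by (intro mult_right_mono) (auto simp: S_def)
      ultimately have "\<rho> / sqrt n * cmod (r i) \<le> t" by linarith
      then have "cmod (r i) \<le> t * sqrt n / \<rho>" using \<rho> n by (simp add: field_simps)
      then show ?thesis using False i by (simp add: r_def \<eta>_def)
    qed
  qed
  then have "card S \<le> card ?G" by (intro card_mono) auto
  ultimately show ?thesis by linarith
qed

section \<open>Averaging over the rows\<close>

lemma prob_uniform_index_perm:
  "measure_pmf.prob (uniform_index_perm n) {p. P p}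
    = perm_avg ({0..<n} \<times> {0..<n}) (\<lambda>p. of_bool (P p))"
proof -
  let ?S = "{p. p permutes ({0..<n} \<times> {0..<n})}"
  have fin: "finite ?S" by (intro finite_permutations) auto
  have "?S \<noteq> {}" using permutes_id by blast
  then have "measure_pmf.prob (uniform_index_perm n) {p. P p} = card (?S \<inter> {p. P p}) / card ?S"
    unfolding uniform_index_perm_def using fin by (rule measure_pmf_of_set)
  then show ?thesis using fin by (simp add: perm_avg_def)
qed

lemma sum_index_square:
  fixes f :: "nat \<times> nat \<Rightarrow> 'b::comm_monoid_add"
  shows "(\<Sum>e\<in>{0..<n} \<times> {0..<n}. f e) = (\<Sum>i = 0..<n. \<Sum>j = 0..<n. f (i, j))"
  by (simp add: sum.cartesian_product')

text \<open>Unless the singular vector is nearly constant, more than \<open>m\<close> of the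
  \<open>n\<close> rows are exceptional. Markov's inequality for their number produces the factor
  \<open>n / m\<close> in front of the bound for a single row.\<close>

lemma perm_avg_small_singular_value:
  fixes x :: "real mat" and K t m \<rho> :: real and z :: complex
  assumes n: "60 \<le> n" and x: "x \<in> carrier_mat n n"
    and sum0: "(\<Sum>i = 0..<n. \<Sum>j = 0..<n. x $$ (i, j)) = 0"
    and var: "(\<Sum>i = 0..<n. \<Sum>j = 0..<n. (x $$ (i, j))\<^sup>2) = (real n)\<^sup>2"
    and bd: "\<And>i j. i < n \<Longrightarrow> j < n \<Longrightarrow> \<bar>x $$ (i, j)\<bar> \<le> K" and K: "1 \<le> K"
    and m: "0 < m" "4 * m \<le> n" and \<rho>: "0 < \<rho>" "\<rho> \<le> 1/8"
    and small: "4 * \<rho> * (56 * K + cmod z) \<le> 1 / 60" and t: "0 \<le> t" "t \<le> sqrt n / 60"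
  defines "\<delta> \<equiv> 25 / \<rho>\<^sup>2 * exp (m * (ln (n / m) + 4 * ln (1 / \<rho>) + 18) - n / (20000 * K\<^sup>2))
      + exp (- real n) + exp (- ((real n)\<^sup>2 / (64 * K\<^sup>2)))"
  shows "perm_avg ({0..<n} \<times> {0..<n}) (\<lambda>\<pi>. of_bool (smallest_singular_value
               (map_mat complex_of_real (permute_entries \<pi> x)
                 - (complex_of_real (sqrt (real n)) * z) \<cdot>\<^sub>m 1\<^sub>m n) \<le> t))
    \<le> \<delta> + n / m * (\<delta> + 3 * exp (- (n / (64 * K\<^sup>2))) +
        (300 * (t * sqrt n / \<rho> + 4 * K / sqrt m) / \<rho> + exp (- (n / (1024 * K\<^sup>2)))))"
proof -
  define I where "I = {0..<n}"
  define E where "E = I \<times> I"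
  define y where "y e = x $$ e" for e :: "nat \<times> nat"
  define w where "w = complex_of_real (sqrt (real n)) * z"
  \<comment> \<open>For \<open>n \<ge> 60\<close> the integer division still gives
    \<open>n \<le> 5 * q\<close>.\<close>
  define q where "q = n div 4"
  \<comment> \<open>Two disjoint blocks of length \<open>q\<close>; at least one of them avoids
    \<open>i\<close>, as required for the normal that omits row \<open>i\<close>. The singular
    vector itself may use either, here \<open>J 0\<close>.\<close>
  define J where "J i = (if i < q then {q..<2 * q} else {0..<q})" for i :: nat
  define B where "B \<pi> \<longleftrightarrow> smallest_singular_value (map_mat complex_of_real (permute_entries \<pi> x) - w \<cdot>\<^sub>m 1\<^sub>m n) \<le> t"
    for \<pi>
  define \<eta> where "\<eta> p i = row_kernel n (\<lambda>e. y (p e)) w i" for p i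
  define F where "F i p \<longleftrightarrow> \<not> nearly_constant I m \<rho> (\<eta> p i) \<and> balanced_row I y i p \<and>
        cmod ((\<Sum>j\<in>I. \<eta> p i j * y (p (i, j))) - w * \<eta> p i i) \<le> t * sqrt n / \<rho>" for i p
  have finI: "finite I" "I \<noteq> {}" using n by (auto simp: I_def)
  have cardI: "card I = n" by (simp add: I_def)
  have sum0': "(\<Sum>e\<in>I \<times> I. y e) = 0" using sum0 by (simp add: I_def y_def sum_index_square)
  have var': "(\<Sum>e\<in>I \<times> I. (y e)\<^sup>2) = card (I \<times> I)"
    using var by (simp add: I_def y_def sum_index_square card_cartesian_product power2_eq_square)
  have bd': "\<bar>y e\<bar> \<le> K" if "e \<in> I \<times> I" for e using that bd by (auto simp: I_def y_def)
  have q: "4 * q \<le> n" "n \<le> 5 * q" using n by (auto simp: q_def)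
  have J: "J i \<subseteq> I" "i \<notin> J i" "card (J i) = q" for i using q by (auto simp: J_def I_def)
  have small': "4 * \<rho> * (56 * K * sqrt (card I) + cmod w) \<le> sqrt (card I) / 60"
    using mult_right_mono[OF small, of "sqrt n"] by (simp add: cardI w_def norm_mult algebra_simps)
  have null: "perm_avg E (\<lambda>p. of_bool (almost_null I (\<lambda>e. y (p e)) (J i) m \<rho> w)) \<le> \<delta>" for i
    using almost_null_prob[OF finI sum0' var' bd' K, of "J i" m \<rho> w] J[of i] q m \<rho> small'
    by (simp add: E_def \<delta>_def cardI)
  have null': "perm_avg E (\<lambda>p. of_bool (almost_null I (\<lambda>e. y (p (prod.swap e))) (J i) m \<rho> w)) \<le> \<delta>" for i
    using null[of i] almost_null_transpose_prob[OF finI sum0' var' bd' K, of "J i" m \<rho> w] J[of i]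
    by (simp add: E_def)
  have bal: "perm_avg E (\<lambda>p. of_bool (\<not> balanced_row I y i p)) \<le> 3 * exp (- (n / (64 * K\<^sup>2)))" if "i \<in> I" for i
    using balanced_row_prob[OF finI sum0' var' bd' K that] by (simp add: E_def cardI)
  have close: "perm_avg E (\<lambda>p. of_bool (F i p)) \<le> 300 * (t * sqrt n / \<rho> + 4 * K / sqrt m) / \<rho> + exp (- (n / (1024 * K\<^sup>2)))"
    if i: "i \<in> I" for i
  proof -
    have inv: "\<eta> (p \<circ> permute_row I i \<sigma>) i = \<eta> p i" for p \<sigma>
      unfolding \<eta>_def by (rule row_kernel_cong) (simp add: permute_row_simps)
    have "perm_avg (I \<times> I) (\<lambda>p. of_bool (\<not> nearly_constant I m \<rho> (\<eta> p i) \<and> balanced_row I y i p \<and>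
        cmod ((\<Sum>j\<in>I. \<eta> p i j * y (p (i, j))) - w * \<eta> p i i) \<le> t * sqrt n / \<rho>))
     \<le> 300 * (t * sqrt n / \<rho> + 4 * K / sqrt m) / \<rho> + exp (- (card I / (1024 * K\<^sup>2)))"
    proof (rule row_small_ball_prob[OF finI sum0' var' bd' K, where \<eta> = "\<lambda>p. \<eta> p i" and c = "\<lambda>p. w * \<eta> p i i"])
      show "(\<Sum>j\<in>I. (cmod (\<eta> p i j))\<^sup>2) = 1" for p
        unfolding \<eta>_def I_def using i by (intro row_kernel_props(1)) (simp add: I_def)
      show "0 \<le> t * sqrt n / \<rho>" using t \<rho> by simp
    qed (use n i m \<rho> inv cardI in auto)
    then show ?thesis by (simp add: E_def F_def cardI)
  qed
  \<comment> \<open>Markov's inequality pointwise: if the left event occurs and the singular vector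
    is not almost null, the sum over rows exceeds \<open>m\<close>.\<close>
  have key: "of_bool (B p) \<le> of_bool (almost_null I (\<lambda>e. y (p e)) (J 0) m \<rho> w)
      + 1 / m * (\<Sum>i\<in>I. of_bool (almost_null I (\<lambda>e. y (p (prod.swap e))) (J i) m \<rho> w)
         + of_bool (\<not> balanced_row I y i p) + (of_bool (F i p) :: real))" if p: "p permutes E" for p
  proof (cases "B p \<and> \<not> almost_null I (\<lambda>e. y (p e)) (J 0) m \<rho> w")
    case False
    have "0 \<le> 1 / m * (\<Sum>i\<in>I. of_bool (almost_null I (\<lambda>e. y (p (prod.swap e))) (J i) m \<rho> w)
         + of_bool (\<not> balanced_row I y i p) + (of_bool (F i p) :: real))"
      using m by (intro mult_nonneg_nonneg sum_nonneg) auto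
    then show ?thesis using False by auto
  next
    case True
    define A where "A = map_mat complex_of_real (permute_entries p x) - w \<cdot>\<^sub>m 1\<^sub>m n"
    have A: "A \<in> carrier_mat n n" using x by (auto simp: A_def permute_entries_def)
    have Aij: "A $$ (i, j) = complex_of_real (y (p (i, j))) - (if i = j then w else 0)" if "i < n" "j < n" for i j
      using that x by (simp add: A_def permute_entries_def y_def)
    obtain v where v: "(\<Sum>i\<in>{0..<n}. (cmod (v i))\<^sup>2) = 1"
      "L2_set (\<lambda>j. cmod (\<Sum>i\<in>{0..<n}. v i * A $$ (i, j))) {0..<n} = smallest_singular_value A"
      by (rule smallest_singular_value_witness[OF A]) (use n in auto)
    have "L2_set (\<lambda>j. cmod ((\<Sum>i\<in>{0..<n}. v i * y (p (i, j))) - w * v j)) {0..<n}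
       = L2_set (\<lambda>j. cmod (\<Sum>i\<in>{0..<n}. v i * A $$ (i, j))) {0..<n}"
    proof (intro L2_set_cong refl arg_cong[where f = cmod])
      fix j assume j: "j \<in> {0..<n}"
      have "(\<Sum>i\<in>{0..<n}. v i * A $$ (i, j)) = (\<Sum>i\<in>{0..<n}. v i * (complex_of_real (y (p (i, j))) - (if i = j then w else 0)))"
        using j by (intro sum.cong refl) (simp add: Aij)
      also have "\<dots> = (\<Sum>i\<in>{0..<n}. v i * y (p (i, j))) - w * v j"
        by (rule sum_mult_minus_diagonal(1)[OF _ j]) simp
      finally show "(\<Sum>i\<in>{0..<n}. v i * y (p (i, j))) - w * v j = (\<Sum>i\<in>{0..<n}. v i * A $$ (i, j))" by simp
    qed
    then have vA: "L2_set (\<lambda>j. cmod ((\<Sum>i\<in>{0..<n}. v i * y (p (i, j))) - w * v j)) {0..<n} \<le> t"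
      using v(2) True by (simp add: B_def A_def)
    define G where "G = {i\<in>{0..<n}. almost_null {0..<n} (\<lambda>e. y (p (prod.swap e))) (J i) m \<rho> w \<or>
      (\<not> nearly_constant {0..<n} m \<rho> (\<eta> p i) \<and>
       cmod ((\<Sum>j\<in>{0..<n}. \<eta> p i j * y (p (i, j))) - w * \<eta> p i i) \<le> t * sqrt n / \<rho>)}"
    have "almost_null {0..<n} (\<lambda>e. y (p e)) (J 0) m \<rho> w \<or> m < card G"
      unfolding G_def \<eta>_def
      by (rule almost_null_or_many_close_rows[OF _ m(1) \<rho>(1) t(2) v(1) vA])
         (use n J in \<open>auto simp: I_def\<close>)
    then have "m < card G" using True by (simp add: I_def)
    also have "real (card G) = (\<Sum>i\<in>G. 1)" by simp
    also have "\<dots> \<le> (\<Sum>i\<in>G. of_bool (almost_null I (\<lambda>e. y (p (prod.swap e))) (J i) m \<rho> w)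
         + of_bool (\<not> balanced_row I y i p) + (of_bool (F i p) :: real))"
      by (intro sum_mono) (auto simp: G_def F_def I_def)
    also have "\<dots> \<le> (\<Sum>i\<in>I. of_bool (almost_null I (\<lambda>e. y (p (prod.swap e))) (J i) m \<rho> w)
         + of_bool (\<not> balanced_row I y i p) + (of_bool (F i p) :: real))"
      by (intro sum_mono2 finI) (auto simp: G_def I_def)
    finally show ?thesis using True m by (simp add: field_simps)
  qed
  have "perm_avg E (\<lambda>p. of_bool (B p) :: real)
     \<le> perm_avg E (\<lambda>p. of_bool (almost_null I (\<lambda>e. y (p e)) (J 0) m \<rho> w)
      + 1 / m * (\<Sum>i\<in>I. of_bool (almost_null I (\<lambda>e. y (p (prod.swap e))) (J i) m \<rho> w)
         + of_bool (\<not> balanced_row I y i p) + (of_bool (F i p) :: real)))"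
    by (rule perm_avg_mono) (rule key)
  also have "\<dots> = perm_avg E (\<lambda>p. of_bool (almost_null I (\<lambda>e. y (p e)) (J 0) m \<rho> w))
      + 1 / m * (\<Sum>i\<in>I. perm_avg E (\<lambda>p. of_bool (almost_null I (\<lambda>e. y (p (prod.swap e))) (J i) m \<rho> w))
         + perm_avg E (\<lambda>p. of_bool (\<not> balanced_row I y i p)) + perm_avg E (\<lambda>p. of_bool (F i p)))"
    by (simp only: perm_avg_add perm_avg_cmult perm_avg_sum)
  also have "\<dots> \<le> \<delta> + 1 / m * (\<Sum>i\<in>I. \<delta> + 3 * exp (- (n / (64 * K\<^sup>2))) +
        (300 * (t * sqrt n / \<rho> + 4 * K / sqrt m) / \<rho> + exp (- (n / (1024 * K\<^sup>2)))))"
    using m by (intro add_mono mult_left_mono sum_mono null null' bal close) auto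
  also have "\<dots> = \<delta> + n / m * (\<delta> + 3 * exp (- (n / (64 * K\<^sup>2))) +
        (300 * (t * sqrt n / \<rho> + 4 * K / sqrt m) / \<rho> + exp (- (n / (1024 * K\<^sup>2)))))"
    by (simp add: cardI)
  finally show ?thesis by (simp add: B_def E_def I_def w_def)
qed

section \<open>Choice of parameters\<close>

text \<open>The constant \<open>14000\<close> makes the mesh small against the operator norm bound \<open>56 K \<surd>n\<close>, and \<open>10\<^sup>7\<close> makes
  the entropy of the net at most half of the exponent \<open>n / (20000 K\<^sup>2)\<close>.\<close>

lemma net_exponent_le:
  fixes K M L m \<rho> N :: real
  assumes K: "1 \<le> K" "K \<le> M" and L: "L = ln (1 + M)" and N: "0 < N"
    and m: "m = N / (10 ^ 7 * K\<^sup>2 * L)" and \<rho>: "\<rho> = 1 / (14000 * M)"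
  shows "m * (ln (N / m) + 4 * ln (1 / \<rho>) + 18) \<le> N / (40000 * K\<^sup>2)"
proof -
  have M: "1 \<le> M" using K by simp
  have "ln 2 \<le> L" unfolding L using M by simp
  then have L2: "1/2 \<le> L" using ln2_ge_two_thirds by linarith
  have two: "(2::real) \<le> exp 1" using exp_ge_add_one_self[of "1::real"] by simp
  have ln_le: "ln a \<le> real k" if "0 < a" "a \<le> 2 ^ k" for a :: real and k
  proof -
    have "a \<le> exp 1 ^ k" using that power_mono[OF two, of k] by simp
    also have "\<dots> = exp (real k)" by (simp add: exp_of_nat_mult[symmetric])
    finally show ?thesis using that ln_le_cancel_iff[of a "exp (real k)"] by simp
  qed
  have c1: "ln ((10::real) ^ 7) \<le> 24" using ln_le[of "10 ^ 7" 24] by simp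
  have c2: "ln (14000::real) \<le> 14" using ln_le[of 14000 14] by simp
  have lnM: "ln M \<le> L" unfolding L using M by simp
  have "ln K \<le> ln M" using K by simp
  then have lnK: "ln K \<le> L" using lnM by linarith
  have lnL: "ln L \<le> L" using ln_le_minus_one[of L] L2 by simp
  have "N / m = 10 ^ 7 * K\<^sup>2 * L" using m N K L2 by simp
  then have "ln (N / m) = ln (10 ^ 7) + 2 * ln K + ln L"
    using K L2 by (simp add: ln_mult ln_realpow)
  moreover have "ln (1 / \<rho>) = ln 14000 + ln M" using M by (simp add: \<rho> ln_mult)
  \<comment> \<open>98 is 24 + 4 * 14 + 18; the 7 counts twice ln K, once ln L and four times ln M,
    each at most \<open>L\<close>.\<close>
  ultimately have "ln (N / m) + 4 * ln (1 / \<rho>) + 18 \<le> 98 + 7 * L"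
    using c1 c2 lnM lnK lnL by linarith
  \<comment> \<open>From \<open>L \<ge> 1/2\<close>, 98 is at most \<open>196 * L\<close>. In the
    end 203 / 10^7 has to stay below 1/40000, that is 250 / 10^7.\<close>
  also have "\<dots> \<le> 203 * L" using L2 by simp
  finally have "m * (ln (N / m) + 4 * ln (1 / \<rho>) + 18) \<le> m * (203 * L)"
    using m N K L2 by (intro mult_left_mono) auto
  also have "\<dots> = 203 / 10 ^ 7 * (N / K\<^sup>2)" using K L2 by (simp add: m)
  also have "\<dots> \<le> 1 / 40000 * (N / K\<^sup>2)" using N by (intro mult_right_mono) auto
  finally show ?thesis by simp
qed

text \<open>Quadratic decay suffices to absorb all exponential errors: with \<open>u\<close> of
  order N / K^2 it gives K^4 / N^2.\<close>

lemma exp_minus_le_inverse_square: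
  fixes u :: real
  assumes "0 < u"
  shows "exp (- u) \<le> 4 / u\<^sup>2"
proof -
  have "u / 2 \<le> exp (u / 2)" using exp_ge_add_one_self[of "u / 2"] by linarith
  then have "(u / 2)\<^sup>2 \<le> (exp (u / 2))\<^sup>2" using assms by (intro power_mono) auto
  also have "\<dots> = exp u" by (simp add: exp_double[symmetric])
  finally have "u\<^sup>2 / 4 \<le> exp u" by (simp add: power_divide)
  then show ?thesis using assms by (simp add: exp_minus field_simps)
qed

text \<open>The row factor \<open>N / m\<close> is of order K^2 L and the small ball term of order M
  (\<epsilon> + K^2 sqrt L / sqrt N); their product yields the two main terms. The exponential
  errors are of order K^2 L M^2 exp (- u) and are absorbed by the second term in the given
  regime.\<close>

lemma assembled_bound_le:
  fixes K M L m \<rho> N \<epsilon> :: real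
  assumes K: "1 \<le> K" "K \<le> M" and L: "L = ln (1 + M)" and N: "1 \<le> N"
    and m: "m = N / (10 ^ 7 * K\<^sup>2 * L)" and \<rho>: "\<rho> = 1 / (14000 * M)" and \<epsilon>: "0 < \<epsilon>"
    and regime: "K ^ 4 * M * (L * sqrt L) \<le> sqrt N"
    and t: "t = \<epsilon> / (M * sqrt N)"
    and \<delta>: "\<delta> = 25 / \<rho>\<^sup>2 * exp (m * (ln (N / m) + 4 * ln (1 / \<rho>) + 18) - N / (20000 * K\<^sup>2))
      + exp (- N) + exp (- (N\<^sup>2 / (64 * K\<^sup>2)))"
  shows "\<delta> + N / m * (\<delta> + 3 * exp (- (N / (64 * K\<^sup>2))) +
        (300 * (t * sqrt N / \<rho> + 4 * K / sqrt m) / \<rho> + exp (- (N / (1024 * K\<^sup>2)))))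
    \<le> 10 ^ 30 * (K\<^sup>2 * M * L * \<epsilon>) + 10 ^ 30 * (K ^ 4 * M * (L * sqrt L) / sqrt N)"
proof -
  have M: "1 \<le> M" using K by simp
  have "ln 2 \<le> L" unfolding L using M by simp
  then have L2: "1/2 \<le> L" using ln2_ge_two_thirds by linarith
  have sL: "1/2 \<le> sqrt L" using L2 by (intro real_le_rsqrt) (simp add: power2_eq_square)
  have K2: "1 \<le> K\<^sup>2" "K \<noteq> 0" using K by simp_all
  define B where "B = 10 ^ 7 * K\<^sup>2 * L"
  have B: "1 \<le> B"
  proof -
    have "1 * (1/2) \<le> K\<^sup>2 * L" using K2 L2 by (intro mult_mono) auto
    then show ?thesis by (simp add: B_def)
  qed
  have NmB: "N / m = B" using m N K L2 by (simp add: B_def)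
  \<comment> \<open>Half of the exponent \<open>N / (20000 * K^2)\<close>, the other half having
    paid for the net. It is the slowest decay present and dominates the other exponentials.\<close>
  define u where "u = N / (40000 * K\<^sup>2)"
  define e where "e = exp (- u)"
  have e0: "0 \<le> e" by (simp add: e_def)
  have u0: "0 < u" using N K2 by (simp add: u_def)
  have exp_le: "exp (- (N / (c * K\<^sup>2))) \<le> e" if "0 < c" "c \<le> 40000" for c
    unfolding e_def u_def using that N K2 by (simp add: divide_left_mono)
  have eN: "exp (- N) \<le> e"
  proof -
    have "u \<le> N / 1" unfolding u_def using N K2 by (intro divide_left_mono) auto
    then show ?thesis by (simp add: e_def)
  qed
  have eN2: "exp (- (N\<^sup>2 / (64 * K\<^sup>2))) \<le> e"
  proof -
    have "u \<le> N / (64 * K\<^sup>2)" unfolding u_def using N K2 by (intro divide_left_mono) auto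
    also have "\<dots> \<le> N\<^sup>2 / (64 * K\<^sup>2)"
      using N by (intro divide_right_mono) (auto simp: power2_eq_square)
    finally show ?thesis by (simp add: e_def)
  qed
  have \<delta>_le: "\<delta> \<le> (25 * 14000\<^sup>2 * M\<^sup>2 + 2) * e"
  proof -
    have "m * (ln (N / m) + 4 * ln (1 / \<rho>) + 18) - N / (20000 * K\<^sup>2) \<le> - u"
      using net_exponent_le[OF K L _ m \<rho>] N by (simp add: u_def)
    then have "25 / \<rho>\<^sup>2 * exp (m * (ln (N / m) + 4 * ln (1 / \<rho>) + 18) - N / (20000 * K\<^sup>2)) \<le> 25 / \<rho>\<^sup>2 * e"
      by (intro mult_left_mono) (auto simp: e_def)
    moreover have "25 / \<rho>\<^sup>2 * e = 25 * 14000\<^sup>2 * M\<^sup>2 * e"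
      using M by (simp add: \<rho> power_divide power_mult_distrib)
    ultimately show ?thesis unfolding \<delta> distrib_right using eN eN2 by linarith
  qed
  have \<delta>0: "0 \<le> \<delta>" unfolding \<delta> by (intro add_nonneg_nonneg mult_nonneg_nonneg) auto
  define A where "A = 300 * (t * sqrt N / \<rho> + 4 * K / sqrt m) / \<rho>"
  have sqrtm: "1 / sqrt m \<le> 3200 * K * sqrt L / sqrt N"
  proof -
    have "m = N / B" by (simp add: m B_def)
    then have "1 / sqrt m = sqrt (B / N)" by (simp add: real_sqrt_divide)
    also have "B / N \<le> (3200 * K * sqrt L)\<^sup>2 / N"
      using L2 K2 N by (intro divide_right_mono) (auto simp: B_def power_mult_distrib)
    then have "sqrt (B / N) \<le> sqrt ((3200 * K * sqrt L)\<^sup>2 / N)" by (rule real_sqrt_le_mono)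
    also have "\<dots> = 3200 * K * sqrt L / sqrt N" using K L2 by (simp add: real_sqrt_divide real_sqrt_mult)
    finally show ?thesis .
  qed
  have A_le: "A \<le> 300 * 14000 * M * (14000 * \<epsilon> + 12800 * K\<^sup>2 * sqrt L / sqrt N)"
  proof -
    have "t * sqrt N / \<rho> = 14000 * \<epsilon>" using N M by (simp add: t \<rho>)
    moreover have "4 * K / sqrt m \<le> 12800 * K\<^sup>2 * sqrt L / sqrt N"
      using mult_left_mono[OF sqrtm, of "4 * K"] K by (simp add: power2_eq_square mult_ac)
    ultimately have "300 * (t * sqrt N / \<rho> + 4 * K / sqrt m) \<le> 300 * (14000 * \<epsilon> + 12800 * K\<^sup>2 * sqrt L / sqrt N)" by simp
    then have "A \<le> 300 * (14000 * \<epsilon> + 12800 * K\<^sup>2 * sqrt L / sqrt N) / \<rho>"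
      unfolding A_def using M by (intro divide_right_mono) (auto simp: \<rho>)
    then show ?thesis by (simp add: \<rho> mult_ac)
  qed
  have "\<delta> + N / m * (\<delta> + 3 * exp (- (N / (64 * K\<^sup>2))) + (A + exp (- (N / (1024 * K\<^sup>2)))))
     \<le> B * \<delta> + B * (\<delta> + 3 * e + (A + e))"
    unfolding NmB using exp_le[of 64] exp_le[of 1024] B \<delta>0
    by (intro add_mono mult_left_mono) (auto simp: mult_le_cancel_right1)
  also have "\<dots> = B * (2 * \<delta> + 4 * e + A)" by (simp add: algebra_simps)
  also have "\<dots> \<le> B * (10 ^ 10 * M\<^sup>2 * e + A)"
  proof -
    have "1 \<le> M\<^sup>2" using M by simp
    then have "(2 * (25 * 14000\<^sup>2 * M\<^sup>2 + 2) + 4) * e \<le> (10 ^ 10 * M\<^sup>2) * e"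
      using e0 by (intro mult_right_mono) auto
    then have "2 * \<delta> + 4 * e \<le> 10 ^ 10 * M\<^sup>2 * e" using \<delta>_le by (simp add: algebra_simps)
    then show ?thesis using B by (intro mult_left_mono add_right_mono) auto
  qed
  also have "\<dots> = B * (10 ^ 10 * M\<^sup>2 * e) + B * A" by (rule distrib_left)
  also have "B * A \<le> 10 ^ 30 * (K\<^sup>2 * M * L * \<epsilon>) + 10 ^ 29 * (K ^ 4 * M * (L * sqrt L) / sqrt N)"
  proof -
    have "B * A \<le> B * (300 * 14000 * M * (14000 * \<epsilon> + 12800 * K\<^sup>2 * sqrt L / sqrt N))"
      using A_le B by (intro mult_left_mono) auto
    also have "\<dots> = (10 ^ 7 * 300 * 14000 * 14000) * (K\<^sup>2 * M * L * \<epsilon>)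
        + (10 ^ 7 * 300 * 14000 * 12800) * (K ^ 4 * M * (L * sqrt L) / sqrt N)"
      by (simp add: B_def power2_eq_square power4_eq_xxxx algebra_simps)
    also have "\<dots> \<le> 10 ^ 30 * (K\<^sup>2 * M * L * \<epsilon>) + 10 ^ 29 * (K ^ 4 * M * (L * sqrt L) / sqrt N)"
      using K M L2 \<epsilon> N by (intro add_mono mult_right_mono) auto
    finally show ?thesis .
  qed
  also have "B * (10 ^ 10 * M\<^sup>2 * e) \<le> 10 ^ 29 * (K ^ 4 * M * (L * sqrt L) / sqrt N)"
  proof -
    \<comment> \<open>The only use of the regime: K^4 \<ge> K^2 and L sqrt L \<ge> 1/4. It trades
      the surplus factor K^2 M for sqrt N.\<close>
    have K2M: "K\<^sup>2 * M \<le> 4 * sqrt N"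
    proof -
      have "K\<^sup>2 * M * (1/2 * (1/2)) \<le> K ^ 4 * M * (L * sqrt L)"
        using K M L2 sL by (intro mult_mono power_increasing) auto
      then show ?thesis using regime by linarith
    qed
    have "e \<le> 4 / u\<^sup>2" unfolding e_def by (rule exp_minus_le_inverse_square[OF u0])
    also have "\<dots> = 64 * 10 ^ 8 * K ^ 4 / N\<^sup>2"
      using N K2 by (simp add: u_def power_divide power_mult_distrib field_simps power2_eq_square power4_eq_xxxx)
    finally have e: "e \<le> 64 * 10 ^ 8 * K ^ 4 / N\<^sup>2" .
    have "B * (10 ^ 10 * M\<^sup>2 * e) \<le> B * (10 ^ 10 * M\<^sup>2 * (64 * 10 ^ 8 * K ^ 4 / N\<^sup>2))"
      using e B by (intro mult_left_mono) auto
    also have "\<dots> = 64 * 10 ^ 25 * (K ^ 4 * M * L) * (K\<^sup>2 * M) / N\<^sup>2"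
      by (simp add: B_def power2_eq_square)
    also have "\<dots> \<le> 64 * 10 ^ 25 * (K ^ 4 * M * L) * (4 * sqrt N) / N\<^sup>2"
      using K2M K M L2 by (intro divide_right_mono mult_left_mono) auto
    also have "\<dots> = 256 * 10 ^ 25 * (K ^ 4 * M * L / sqrt N) * (N / N\<^sup>2)"
    proof -
      have "sqrt N * sqrt N = N" using N by simp
      then have "sqrt N = N / sqrt N" using N by (simp add: field_simps)
      then have eq: "sqrt N / N\<^sup>2 = N / sqrt N / N\<^sup>2" by (rule arg_cong)
      have "64 * 10 ^ 25 * (K ^ 4 * M * L) * (4 * sqrt N) / N\<^sup>2 = 256 * 10 ^ 25 * (K ^ 4 * M * L) * (sqrt N / N\<^sup>2)"
        by simp
      then show ?thesis unfolding eq by simp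
    qed
    also have "\<dots> \<le> 256 * 10 ^ 25 * (K ^ 4 * M * L / sqrt N) * 1"
      using K M L2 N by (intro mult_left_mono) (auto simp: power2_eq_square)
    \<comment> \<open>Inserts the missing root of \<open>L\<close>, which is at least 1/2.\<close>
    also have "\<dots> \<le> 256 * 10 ^ 25 * (K ^ 4 * M * L / sqrt N) * (2 * sqrt L)"
      using K M L2 N sL by (intro mult_left_mono) auto
    also have "\<dots> = 512 * 10 ^ 25 * (K ^ 4 * M * (L * sqrt L) / sqrt N)" by simp
    also have "\<dots> \<le> 10 ^ 29 * (K ^ 4 * M * (L * sqrt L) / sqrt N)"
      using K M L2 N by (intro mult_right_mono) auto
    finally show ?thesis .
  qed
  also have "10 ^ 29 * (K ^ 4 * M * (L * sqrt L) / sqrt N) + (10 ^ 30 * (K\<^sup>2 * M * L * \<epsilon>) + 10 ^ 29 * (K ^ 4 * M * (L * sqrt L) / sqrt N))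
     \<le> 10 ^ 30 * (K\<^sup>2 * M * L * \<epsilon>) + 10 ^ 30 * (K ^ 4 * M * (L * sqrt L) / sqrt N)"
  proof -
    have "10 ^ 29 * X + (Y + 10 ^ 29 * X) \<le> Y + 10 ^ 30 * X" if "0 \<le> X" for X Y :: real
      using that by simp
    moreover have "0 \<le> K ^ 4 * M * (L * sqrt L) / sqrt N" using K M L2 N by auto
    ultimately show ?thesis by blast
  qed
  finally show ?thesis by (simp add: A_def)
qed

theorem theorem4p1:
  "\<exists>C::real. C > 0 \<and>
    (\<forall>(n::nat) (x::real mat) (K::real) (z::complex) (\<epsilon>::real).
      n \<ge> 1 \<longrightarrow>
      x \<in> carrier_mat n n \<longrightarrow>
      (\<Sum>i = 0..<n. \<Sum>j = 0..<n. x $$ (i, j)) = 0 \<longrightarrow>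
      (\<Sum>i = 0..<n. \<Sum>j = 0..<n. (x $$ (i, j))\<^sup>2) = (real n)\<^sup>2 \<longrightarrow>
      K = Max ((\<lambda>(i, j). \<bar>x $$ (i, j)\<bar>) ` ({0..<n} \<times> {0..<n})) \<longrightarrow>
      0 < \<epsilon> \<longrightarrow> \<epsilon> < 1 \<longrightarrow>
      measure_pmf.prob (uniform_index_perm n)
        {\<pi>. smallest_singular_value
               (map_mat complex_of_real (permute_entries \<pi> x)
                 - (complex_of_real (sqrt (real n)) * z) \<cdot>\<^sub>m 1\<^sub>m n)
             \<le> 1 / (K + cmod z) * \<epsilon> * real n powr (- 1 / 2)}
      \<le> C * K\<^sup>2 * (K + cmod z) * ln (1 + K + cmod z) * \<epsilon>
        + C * (K ^ 4 * (K + cmod z) * ln (1 + K + cmod z) powr (3 / 2)) / real n powr (1 / 2))"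
\<comment> \<open>A generous round value; the largest factor met in the estimates is
  \<open>512 * 10 ^ 25\<close>.\<close>
proof (rule exI[of _ "10 ^ 30"], intro conjI allI impI)
  fix n :: nat and x :: "real mat" and K :: real and z :: complex and \<epsilon> :: real
  assume n: "1 \<le> n" and x: "x \<in> carrier_mat n n"
    and sum0: "(\<Sum>i = 0..<n. \<Sum>j = 0..<n. x $$ (i, j)) = 0"
    and var: "(\<Sum>i = 0..<n. \<Sum>j = 0..<n. (x $$ (i, j))\<^sup>2) = (real n)\<^sup>2"
    and Kdef: "K = Max ((\<lambda>(i, j). \<bar>x $$ (i, j)\<bar>) ` ({0..<n} \<times> {0..<n}))"
    and \<epsilon>: "0 < \<epsilon>" "\<epsilon> < 1"
  define N where "N = real n"
  define M where "M = K + cmod z"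
  define L where "L = ln (1 + M)"
  define P where "P = measure_pmf.prob (uniform_index_perm n)
        {\<pi>. smallest_singular_value
               (map_mat complex_of_real (permute_entries \<pi> x)
                 - (complex_of_real (sqrt (real n)) * z) \<cdot>\<^sub>m 1\<^sub>m n)
             \<le> 1 / (K + cmod z) * \<epsilon> * real n powr (- 1 / 2)}"
  have N: "1 \<le> N" using n by (simp add: N_def)
  have bd: "\<bar>x $$ (i, j)\<bar> \<le> K" if "i < n" "j < n" for i j
    unfolding Kdef using that by (intro Max_ge) (auto intro!: image_eqI[of _ _ "(i, j)"])
  \<comment> \<open>The squares of the entries have mean 1, so their maximum is at least 1.\<close>
  have K: "1 \<le> K"
  proof -
    have K0: "0 \<le> K" using bd[of 0 0] n by simp
    have "N\<^sup>2 \<le> (\<Sum>i = 0..<n. \<Sum>j = 0..<n. K\<^sup>2)"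
      unfolding N_def var[symmetric]
    proof (intro sum_mono)
      fix i j assume "i \<in> {0..<n}" "j \<in> {0..<n}"
      then have "\<bar>x $$ (i, j)\<bar>\<^sup>2 \<le> K\<^sup>2" using bd by (intro power_mono) auto
      then show "(x $$ (i, j))\<^sup>2 \<le> K\<^sup>2" by simp
    qed
    also have "\<dots> = N\<^sup>2 * K\<^sup>2" by (simp add: N_def power2_eq_square)
    finally have "1\<^sup>2 \<le> K\<^sup>2" using N by simp
    then show ?thesis using K0 by (rule power2_le_imp_le)
  qed
  have KM: "K \<le> M" by (simp add: M_def)
  have M: "1 \<le> M" using K KM by simp
  have "ln 2 \<le> L" unfolding L_def using M by simp
  then have L2: "1/2 \<le> L" using ln2_ge_two_thirds by linarith
  have L32: "ln (1 + K + cmod z) powr (3 / 2) = L * sqrt L"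
  proof -
    have "L powr (3 / 2) = L powr 1 * L powr (1 / 2)" unfolding powr_add[symmetric] by simp
    then show ?thesis using L2 by (simp add: L_def M_def powr_half_sqrt add.assoc)
  qed
  have N12: "real n powr (1 / 2) = sqrt N" using N by (simp add: N_def powr_half_sqrt)
  have Nm12: "real n powr (- 1 / 2) = 1 / sqrt N"
    using N powr_minus[of "real n" "1/2"] by (simp add: N_def powr_half_sqrt inverse_eq_divide)
  have "P \<le> 10 ^ 30 * (K\<^sup>2 * M * L * \<epsilon>) + 10 ^ 30 * (K ^ 4 * M * (L * sqrt L) / sqrt N)"
  \<comment> \<open>If \<open>n\<close> is too small, the second term alone exceeds 1. Otherwise
    \<open>K\<close>, \<open>M\<close> at least 1 and \<open>L\<close> at least 1/2 force
    \<open>sqrt N \<ge> 25\<close>, more than the \<open>n \<ge> 60\<close> needed.\<close>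
  proof (cases "100 * (K ^ 4 * M * (L * sqrt L)) \<le> sqrt N")
    case False
    have "P \<le> 1" unfolding P_def by (rule measure_pmf.prob_le_1)
    also have "1 \<le> 100 * (K ^ 4 * M * (L * sqrt L) / sqrt N)" using False N by (simp add: field_simps)
    also have "\<dots> \<le> 10 ^ 30 * (K ^ 4 * M * (L * sqrt L) / sqrt N)"
      using K M L2 N by (intro mult_right_mono) auto
    also have "\<dots> \<le> 10 ^ 30 * (K\<^sup>2 * M * L * \<epsilon>) + 10 ^ 30 * (K ^ 4 * M * (L * sqrt L) / sqrt N)"
      using K M L2 \<epsilon> by simp
    finally show ?thesis .
  next
    case True
    have sL: "1/2 \<le> sqrt L" using L2 by (intro real_le_rsqrt) (simp add: power2_eq_square)
    have regime: "K ^ 4 * M * (L * sqrt L) \<le> sqrt N"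
    proof -
      have "0 \<le> K ^ 4 * M * (L * sqrt L)" using K M L2 by auto
      then show ?thesis using True by linarith
    qed
    have "1 * 1 * (1/2 * (1/2)) \<le> K ^ 4 * M * (L * sqrt L)"
      using K M L2 sL by (intro mult_mono) auto
    then have "25 \<le> sqrt N" using True by linarith
    then have "25\<^sup>2 \<le> (sqrt N)\<^sup>2" by (rule power_mono) simp
    then have N625: "625 \<le> N" using N by simp
    have n60: "60 \<le> n" using N625 by (simp add: N_def)
    define m where "m = N / (10 ^ 7 * K\<^sup>2 * L)"
    define \<rho> where "\<rho> = 1 / (14000 * M)"
    define t where "t = \<epsilon> / (M * sqrt N)"
    have m: "0 < m" "4 * m \<le> N"
    proof -
      show "0 < m" using N K L2 by (simp add: m_def)
      have "1 * (1/2) \<le> K\<^sup>2 * L" using K L2 by (intro mult_mono) auto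
      then have "4 \<le> 10000000 * (K\<^sup>2 * L)" by linarith
      then have "4 \<le> 10 ^ 7 * K\<^sup>2 * L" by (simp add: mult.assoc)
      then have "N * 4 \<le> N * (10 ^ 7 * K\<^sup>2 * L)" using N by (intro mult_left_mono) auto
      moreover have "4 * m = N * 4 / (10 ^ 7 * K\<^sup>2 * L)" by (simp add: m_def)
      moreover have "0 < 10 ^ 7 * K\<^sup>2 * L" using K L2 by simp
      ultimately show "4 * m \<le> N" by (simp only: pos_divide_le_eq)
    qed
    have \<rho>: "0 < \<rho>" "\<rho> \<le> 1/8" using M by (simp_all add: \<rho>_def divide_le_eq)
    have small: "4 * \<rho> * (56 * K + cmod z) \<le> 1 / 60"
    proof -
      have "4 * \<rho> * (56 * K + cmod z) \<le> 4 * \<rho> * (56 * M)"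
        using \<rho> by (intro mult_left_mono) (auto simp: M_def)
      \<comment> \<open>Here 4 * 56 / 14000 = 2/125, just below 1/60.\<close>
      also have "\<dots> \<le> 1 / 60" using M by (simp add: \<rho>_def)
      finally show ?thesis .
    qed
    have t: "0 \<le> t" "t \<le> sqrt n / 60"
    proof -
      show "0 \<le> t" using \<epsilon> M N by (simp add: t_def)
      have "1 * 1 \<le> M * sqrt N" using M N by (intro mult_mono) auto
      then have "t \<le> \<epsilon> / 1" unfolding t_def using \<epsilon> by (intro divide_left_mono) auto
      have "1 * sqrt N \<le> M * sqrt N" using M N by (intro mult_right_mono) auto
      then have "t \<le> \<epsilon> / sqrt N" unfolding t_def using \<epsilon> M N by (intro divide_left_mono) auto
      also have "\<dots> \<le> 1 / sqrt N" using \<epsilon> N by (intro divide_right_mono) auto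
      also have "\<dots> \<le> sqrt N / 60" using N625 by (simp add: field_simps)
      finally show "t \<le> sqrt n / 60" by (simp add: N_def)
    qed
    have "P = perm_avg ({0..<n} \<times> {0..<n}) (\<lambda>\<pi>. of_bool (smallest_singular_value
               (map_mat complex_of_real (permute_entries \<pi> x)
                 - (complex_of_real (sqrt (real n)) * z) \<cdot>\<^sub>m 1\<^sub>m n) \<le> t))"
      unfolding P_def prob_uniform_index_perm Nm12 by (simp add: t_def M_def)
    also note perm_avg_small_singular_value[OF n60 x sum0 var bd K m[unfolded N_def] \<rho> small t]
    also note assembled_bound_le[OF K KM L_def N m_def \<rho>_def \<epsilon>(1) regime t_def refl, unfolded N_def]
    finally show ?thesis by (simp add: N_def)
  qed
  then show "measure_pmf.prob (uniform_index_perm n)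
        {\<pi>. smallest_singular_value
               (map_mat complex_of_real (permute_entries \<pi> x)
                 - (complex_of_real (sqrt (real n)) * z) \<cdot>\<^sub>m 1\<^sub>m n)
             \<le> 1 / (K + cmod z) * \<epsilon> * real n powr (- 1 / 2)}
      \<le> 10 ^ 30 * K\<^sup>2 * (K + cmod z) * ln (1 + K + cmod z) * \<epsilon>
        + 10 ^ 30 * (K ^ 4 * (K + cmod z) * ln (1 + K + cmod z) powr (3 / 2)) / real n powr (1 / 2)"
    unfolding L32 N12 P_def[symmetric] by (simp add: L_def M_def mult.assoc add.assoc)
qed simp

end
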